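(* Let $(\mathcal M,g)$ be a closed connected Riemannian manifold of dimension $n$, and let $p\in\{1,\dots,n\}$. Assume that $R\in[0,+\infty)$, that $A(\alpha,t)$ and $\varphi(\alpha,t)$ are both independent of $t$, and that $\underline u\in C^2(\mathcal M)$ satisfies $$\lambda\bigl(g^{-1}(A(\mathrm d\underline u,\underline u)+\nabla^2\underline u)\bigr)(x)+R\,\mathbf e_n\in\Gamma_p,\qquad\forall x\in\mathcal M .$$ Then $\underline u$ satisfies the pseudo-supersolution condition.
   Context: Notation. $\sigma_p(\mu)=\sum_{1\le j_1<\dots<j_p\le n}\mu_{j_1}\cdots\mu_{j_p}$ for $\mu\in\mathbb R^n$; $\Gamma_p=\{\mu\in\mathbb R^n:\sigma_q(\mu)>0\ \forall q\in\{1,\dots,p\}\}$, with closure $\overline\Gamma_p$; $\mathbf 1_n=(1,\dots,1)^T$; $\mathbf e_n=(0,\dots,0,1)^T$. "Closed" means compact without boundary. $\pi:T^*\mathcal M\to\mathcal M$ is the projection. $A$ is a smooth map assigning to each $(\alpha,t)\in T^*\mathcal M\times\mathbb R$ a symmetric bilinear form $A(\alpha,t)$ on $T_{\pi(\alpha)}\mathcal M$; $\varphi(\alpha,t)$ is a positive smooth function on $T^*\mathcal M\times\mathbb R$. For $u\in C^2(\mathcal M)$, $\mathrm du$ is its differential, $\nabla^2u$ its Hessian for the Levi-Civita connection, and $A(\mathrm du,u)$ is the tensor field $x\mapsto A(\mathrm du(x),u(x))$. For a symmetric $(0,2)$-tensor field $B$, $\lambda(g^{-1}B)(x)\in\mathbb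 R^n$ is the vector of eigenvalues, in non-decreasing order, of the matrix product $(g^{jk}(x))(B_{jk}(x))$ in any local coordinates, where $(g^{jk})=(g_{jk})^{-1}$. $|\alpha|_g=(g^{jk}\alpha_j\alpha_k)^{1/2}$ (summation over repeated indices). The general $p$-Hessian equation for $u\in C^2(\mathcal M)$ is: for all $x\in\mathcal M$, $$\sigma_p^{1/p}\bigl(\lambda(g^{-1}(A(\mathrm du,u)+\nabla^2u))(x)\bigr)=\varphi(\mathrm du(x),u(x)),\qquad \lambda(g^{-1}(A(\mathrm du,u)+\nabla^2u))(x)\in\Gamma_p .$$ A solution is a $u$ satisfying both requirements. $\underline u\in C^2(\mathcal M)$ satisfies the pseudo-supersolution condition if: there exist constants $\delta_2>0$ and $M_2\ge0$, depending only on $\mathcal M,g,n,p,A,\varphi,\underline u$, such that for any solution $u\in C^2(\mathcal M)$ and any $x\in\mathcal M$ with $\lambda(g^{-1}\nabla^2(u-\underline u))(x)+\delta_2\mathbf 1_n\in\overline\Gamma_n$ and $|\mathrm d(u-\underline u)(x)|_g\le\delta_2$, $$\sigma_n\bigl(\lambda(g^{-1}(\delta_2g+\nabla^2(u-\underline u)))(x)\bigr)\le M_2 .$$ *)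

theory Defs
  imports "HOL-Analysis.Analysis"
begin

section \<open>Elementary symmetric functions and eigenvalue vectors\<close>

text \<open>The index type \<open>'n\<close> is finite and linearly ordered; it plays the role of \<open>{1..n}\<close>
  with \<open>n = CARD('n)\<close>. The increasing tuples of indices of length \<open>p\<close> correspond to the
  subsets of \<open>'n\<close> with \<open>p\<close> elements.\<close>

definition sigma :: "nat \<Rightarrow> real^'n \<Rightarrow> real" where
  "sigma p \<mu> = (\<Sum>J\<in>{J :: 'n set. card J = p}. \<Prod>j\<in>J. \<mu> $ j)"

definition Gamma_cone :: "nat \<Rightarrow> (real^'n) set" where
  "Gamma_cone p = {\<mu>. \<forall>q\<in>{1..p}. sigma q \<mu> > 0}"

definition ones_vec :: "real^'n" where
  "ones_vec = (\<chi> i. 1)"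

definition last_unit_vec :: "real^'n::{finite,linorder}" where
  "last_unit_vec = axis (Max UNIV) 1"

text \<open>Eigenvalues are counted with multiplicity, so the vector consists of the roots of the
  characteristic polynomial. It exists (and is then unique) iff all eigenvalues are real; this is
  the case for \<open>G\<^sup>-\<^sup>1 B\<close> with \<open>G\<close> symmetric positive definite and \<open>B\<close> symmetric.\<close>

definition is_eigenvalue_vec :: "real^'n::{finite,linorder}^'n::{finite,linorder} \<Rightarrow> real^'n::{finite,linorder} \<Rightarrow> bool" where
  "is_eigenvalue_vec B \<mu> \<longleftrightarrow>
     (\<forall>i j. i \<le> j \<longrightarrow> \<mu> $ i \<le> \<mu> $ j) \<and>
     (\<forall>s. det (mat s - B) = (\<Prod>i\<in>UNIV. s - \<mu> $ i))"

definition eigenvalue_vec :: "real^'n::{finite,linorder}^'n::{finite,linorder} \<Rightarrow> real^'n::{finite,linorder}" where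
  "eigenvalue_vec B = (THE \<mu>. is_eigenvalue_vec B \<mu>)"


section \<open>Functions of class \<open>C\<^sup>k\<close>\<close>

text \<open>Intended for open \<open>S\<close>; \<open>Ck_on (Suc k) f S\<close> says that all directional derivatives of the
  differentiable function \<open>f\<close> are of class \<open>C\<^sup>k\<close>, which in finite dimension is the usual notion.\<close>

primrec Ck_on :: "nat \<Rightarrow> ('v::euclidean_space \<Rightarrow> 'w::euclidean_space) \<Rightarrow> 'v set \<Rightarrow> bool" where
  "Ck_on 0 f S \<longleftrightarrow> continuous_on S f"
| "Ck_on (Suc k) f S \<longleftrightarrow>
     (\<forall>x\<in>S. f differentiable (at x)) \<and>
     (\<forall>v. Ck_on k (\<lambda>x. frechet_derivative f (at x) v) S)"

definition smooth_on :: "('v::euclidean_space \<Rightarrow> 'w::euclidean_space) \<Rightarrow> 'v set \<Rightarrow> bool" where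
  "smooth_on f S \<longleftrightarrow> (\<forall>k. Ck_on k f S)"

definition partial :: "'n \<Rightarrow> (real^'n \<Rightarrow> real) \<Rightarrow> real^'n \<Rightarrow> real" where
  "partial j f y = frechet_derivative f (at y) (axis j 1)"


section \<open>Smooth manifolds\<close>

text \<open>A chart is a pair of its domain and its coordinate map; values of the coordinate map
  outside the domain are irrelevant.\<close>

type_synonym ('a, 'n) chart = "'a set \<times> ('a \<Rightarrow> real^'n)"

definition chart_image :: "('a, 'n) chart \<Rightarrow> (real^'n) set" where
  "chart_image c = snd c ` fst c"

definition chart_inv :: "('a, 'n) chart \<Rightarrow> real^'n \<Rightarrow> 'a" where
  "chart_inv c = inv_into (fst c) (snd c)"

definition is_chart :: "'a topology \<Rightarrow> ('a, 'n::finite) chart \<Rightarrow> bool" where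
  "is_chart X c \<longleftrightarrow>
     openin X (fst c) \<and> open (chart_image c) \<and>
     homeomorphic_map (subtopology X (fst c)) (top_of_set (chart_image c)) (snd c)"

definition transition :: "('a, 'n) chart \<Rightarrow> ('a, 'n) chart \<Rightarrow> real^'n \<Rightarrow> real^'n" where
  "transition c d = snd d \<circ> chart_inv c"

definition smooth_atlas :: "'a topology \<Rightarrow> ('a, 'n::finite) chart set \<Rightarrow> bool" where
  "smooth_atlas X \<A> \<longleftrightarrow>
     (\<forall>c\<in>\<A>. is_chart X c) \<and> \<Union>(fst ` \<A>) = topspace X \<and>
     (\<forall>c\<in>\<A>. \<forall>d\<in>\<A>. smooth_on (transition c d) (snd c ` (fst c \<inter> fst d)))"

definition smooth_manifold :: "'a topology \<Rightarrow> ('a, 'n::finite) chart set \<Rightarrow> bool" where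
  "smooth_manifold X \<A> \<longleftrightarrow> Hausdorff_space X \<and> second_countable X \<and> smooth_atlas X \<A>"

text \<open>Charts take values in open subsets of \<open>real^'n\<close>, so there is no boundary.\<close>

definition closed_manifold :: "'a topology \<Rightarrow> ('a, 'n::finite) chart set \<Rightarrow> bool" where
  "closed_manifold X \<A> \<longleftrightarrow> smooth_manifold X \<A> \<and> compact_space X"

definition charts_at :: "('a, 'n) chart set \<Rightarrow> 'a \<Rightarrow> ('a, 'n) chart set" where
  "charts_at \<A> x = {c \<in> \<A>. x \<in> fst c}"

text \<open>An arbitrary chart around \<open>x\<close>, used to evaluate coordinate expressions that do not depend
  on the choice of local coordinates.\<close>

definition chart_at :: "('a, 'n) chart set \<Rightarrow> 'a \<Rightarrow> ('a, 'n) chart" where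
  "chart_at \<A> x = (SOME c. c \<in> charts_at \<A> x)"


section \<open>Tangent and cotangent spaces\<close>

text \<open>A tangent vector at \<open>x\<close> is the family of its component vectors with respect to all charts
  around \<open>x\<close>, related by the differentials of the transition maps (and \<open>0\<close> at all other indices).
  The vector space operations are pointwise.\<close>

type_synonym ('a, 'n) tvec = "('a, 'n) chart \<Rightarrow> real^'n"
type_synonym ('a, 'n) tform = "('a, 'n) tvec \<Rightarrow> ('a, 'n) tvec \<Rightarrow> real"

definition tangent_space :: "('a, 'n::finite) chart set \<Rightarrow> 'a \<Rightarrow> ('a, 'n) tvec set" where
  "tangent_space \<A> x =
     {v. (\<forall>c\<in>charts_at \<A> x. \<forall>d\<in>charts_at \<A> x.
            v d = frechet_derivative (transition c d) (at (snd c x)) (v c)) \<and>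
         (\<forall>c. c \<notin> charts_at \<A> x \<longrightarrow> v c = 0)}"

definition tangent_vec ::
  "('a, 'n::finite) chart set \<Rightarrow> ('a, 'n) chart \<Rightarrow> 'a \<Rightarrow> real^'n \<Rightarrow> ('a, 'n) tvec" where
  "tangent_vec \<A> c x \<xi> =
     (\<lambda>d. if d \<in> charts_at \<A> x
          then frechet_derivative (transition c d) (at (snd c x)) \<xi> else 0)"

definition coord_vec ::
  "('a, 'n::finite) chart set \<Rightarrow> ('a, 'n) chart \<Rightarrow> 'a \<Rightarrow> 'n \<Rightarrow> ('a, 'n) tvec" where
  "coord_vec \<A> c x j = tangent_vec \<A> c x (axis j 1)"

definition linear_functional_at ::
  "('a, 'n::finite) chart set \<Rightarrow> 'a \<Rightarrow> (('a, 'n) tvec \<Rightarrow> real) \<Rightarrow> bool" where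
  "linear_functional_at \<A> x \<alpha> \<longleftrightarrow>
     (\<forall>v\<in>tangent_space \<A> x. \<forall>w\<in>tangent_space \<A> x. \<forall>a b.
        \<alpha> (\<lambda>c. a *\<^sub>R v c + b *\<^sub>R w c) = a * \<alpha> v + b * \<alpha> w)"

text \<open>Covectors are extended by \<open>0\<close> outside the tangent space, so that equality of functions is
  equality of covectors.\<close>

definition cotangent_space ::
  "('a, 'n::finite) chart set \<Rightarrow> 'a \<Rightarrow> (('a, 'n) tvec \<Rightarrow> real) set" where
  "cotangent_space \<A> x =
     {\<alpha>. linear_functional_at \<A> x \<alpha> \<and> (\<forall>v. v \<notin> tangent_space \<A> x \<longrightarrow> \<alpha> v = 0)}"

type_synonym ('a, 'n) covec = "'a \<times> (('a, 'n) tvec \<Rightarrow> real)"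

definition cotangent_bundle ::
  "'a topology \<Rightarrow> ('a, 'n::finite) chart set \<Rightarrow> ('a, 'n) covec set" where
  "cotangent_bundle X \<A> = Sigma (topspace X) (cotangent_space \<A>)"

definition coord_covec ::
  "('a, 'n::finite) chart set \<Rightarrow> ('a, 'n) chart \<Rightarrow> 'a \<Rightarrow> real^'n \<Rightarrow> ('a, 'n) covec" where
  "coord_covec \<A> c x \<xi> = (x, \<lambda>v. if v \<in> tangent_space \<A> x then \<xi> \<bullet> v c else 0)"

definition sym_bilinear_at ::
  "('a, 'n::finite) chart set \<Rightarrow> 'a \<Rightarrow> ('a, 'n) tform \<Rightarrow> bool" where
  "sym_bilinear_at \<A> x B \<longleftrightarrow>
     (\<forall>v\<in>tangent_space \<A> x. linear_functional_at \<A> x (B v)) \<and>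
     (\<forall>v\<in>tangent_space \<A> x. \<forall>w\<in>tangent_space \<A> x. B v w = B w v)"

definition form_matrix ::
  "('a, 'n::finite) chart set \<Rightarrow> ('a, 'n) chart \<Rightarrow> 'a \<Rightarrow> ('a, 'n) tform \<Rightarrow> real^'n^'n" where
  "form_matrix \<A> c x B = (\<chi> j k. B (coord_vec \<A> c x j) (coord_vec \<A> c x k))"


section \<open>Riemannian geometry\<close>

definition riemannian_metric ::
  "'a topology \<Rightarrow> ('a, 'n::finite) chart set \<Rightarrow> ('a \<Rightarrow> ('a, 'n) tform) \<Rightarrow> bool" where
  "riemannian_metric X \<A> g \<longleftrightarrow>
     (\<forall>x\<in>topspace X. sym_bilinear_at \<A> x (g x) \<and>
        (\<forall>v\<in>tangent_space \<A> x. v \<noteq> (\<lambda>_. 0) \<longrightarrow> g x v v > 0)) \<and>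
     (\<forall>c\<in>\<A>. smooth_on (\<lambda>y. form_matrix \<A> c (chart_inv c y) (g (chart_inv c y)))
               (chart_image c))"

definition metric_coord ::
  "('a, 'n::finite) chart set \<Rightarrow> ('a \<Rightarrow> ('a, 'n) tform) \<Rightarrow> ('a, 'n) chart \<Rightarrow>
     'n \<Rightarrow> 'n \<Rightarrow> real^'n \<Rightarrow> real" where
  "metric_coord \<A> g c j k y = form_matrix \<A> c (chart_inv c y) (g (chart_inv c y)) $ j $ k"

definition inv_metric_coord ::
  "('a, 'n::finite) chart set \<Rightarrow> ('a \<Rightarrow> ('a, 'n) tform) \<Rightarrow> ('a, 'n) chart \<Rightarrow>
     'n \<Rightarrow> 'n \<Rightarrow> real^'n \<Rightarrow> real" where
  "inv_metric_coord \<A> g c j k y =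
     matrix_inv (form_matrix \<A> c (chart_inv c y) (g (chart_inv c y))) $ j $ k"

text \<open>The coefficient \<open>\<Gamma>\<^sup>l\<^sub>j\<^sub>k\<close> of the Levi-Civita connection in the chart \<open>c\<close>.\<close>

definition christoffel ::
  "('a, 'n::finite) chart set \<Rightarrow> ('a \<Rightarrow> ('a, 'n) tform) \<Rightarrow> ('a, 'n) chart \<Rightarrow>
     'n \<Rightarrow> 'n \<Rightarrow> 'n \<Rightarrow> real^'n \<Rightarrow> real" where
  "christoffel \<A> g c l j k y =
     1/2 * (\<Sum>m\<in>UNIV. inv_metric_coord \<A> g c l m y *
       (partial j (metric_coord \<A> g c m k) y + partial k (metric_coord \<A> g c m j) y
         - partial m (metric_coord \<A> g c j k) y))"

definition C2_fun :: "('a, 'n::finite) chart set \<Rightarrow> ('a \<Rightarrow> real) \<Rightarrow> bool" where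
  "C2_fun \<A> u \<longleftrightarrow> (\<forall>c\<in>\<A>. Ck_on 2 (u \<circ> chart_inv c) (chart_image c))"

definition differential ::
  "('a, 'n::finite) chart set \<Rightarrow> ('a \<Rightarrow> real) \<Rightarrow> 'a \<Rightarrow> ('a, 'n) covec" where
  "differential \<A> u x =
     (let c = chart_at \<A> x in coord_covec \<A> c x (\<chi> j. partial j (u \<circ> chart_inv c) (snd c x)))"

definition hessian_coord ::
  "('a, 'n::finite) chart set \<Rightarrow> ('a \<Rightarrow> ('a, 'n) tform) \<Rightarrow> ('a, 'n) chart \<Rightarrow>
     ('a \<Rightarrow> real) \<Rightarrow> real^'n \<Rightarrow> real^'n^'n" where
  "hessian_coord \<A> g c u y =
     (\<chi> j k. partial j (partial k (u \<circ> chart_inv c)) y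
       - (\<Sum>l\<in>UNIV. christoffel \<A> g c l j k y * partial l (u \<circ> chart_inv c) y))"

definition hessian ::
  "('a, 'n::finite) chart set \<Rightarrow> ('a \<Rightarrow> ('a, 'n) tform) \<Rightarrow> ('a \<Rightarrow> real) \<Rightarrow> 'a \<Rightarrow>
     ('a, 'n) tform" where
  "hessian \<A> g u x =
     (\<lambda>v w. let c = chart_at \<A> x in v c \<bullet> (hessian_coord \<A> g c u (snd c x) *v w c))"

definition covec_norm ::
  "('a, 'n::finite) chart set \<Rightarrow> ('a \<Rightarrow> ('a, 'n) tform) \<Rightarrow> ('a, 'n) covec \<Rightarrow> real" where
  "covec_norm \<A> g \<alpha> =
     (let x = fst \<alpha>; c = chart_at \<A> x in
        sqrt (\<Sum>j\<in>UNIV. \<Sum>k\<in>UNIV. inv_metric_coord \<A> g c j k (snd c x) *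
               snd \<alpha> (coord_vec \<A> c x j) * snd \<alpha> (coord_vec \<A> c x k)))"

text \<open>The vector \<open>\<lambda>(g\<^sup>-\<^sup>1 B)(x)\<close>, where \<open>B\<close> is the value at \<open>x\<close> of a symmetric
  \<open>(0,2)\<close>-tensor field.\<close>

definition lambda_vec ::
  "('a, 'n::{finite,linorder}) chart set \<Rightarrow> ('a \<Rightarrow> ('a, 'n) tform) \<Rightarrow> 'a \<Rightarrow>
     ('a, 'n) tform \<Rightarrow> real^'n::{finite,linorder}" where
  "lambda_vec \<A> g x B =
     (let c = chart_at \<A> x in
        eigenvalue_vec (matrix_inv (form_matrix \<A> c x (g x)) ** form_matrix \<A> c x B))"


section \<open>The general \<open>p\<close>-Hessian equation\<close>

text \<open>Smoothness on \<open>T\<^sup>*M \<times> \<real>\<close> is expressed in the bundle coordinates \<open>(y, \<xi>, t)\<close> induced by the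
  charts of the base manifold.\<close>

definition smooth_form_field ::
  "'a topology \<Rightarrow> ('a, 'n::finite) chart set \<Rightarrow>
     (('a, 'n) covec \<Rightarrow> real \<Rightarrow> ('a, 'n) tform) \<Rightarrow> bool" where
  "smooth_form_field X \<A> A \<longleftrightarrow>
     (\<forall>\<alpha>\<in>cotangent_bundle X \<A>. \<forall>t. sym_bilinear_at \<A> (fst \<alpha>) (A \<alpha> t)) \<and>
     (\<forall>c\<in>\<A>. smooth_on
        (\<lambda>(y, \<xi>, t). form_matrix \<A> c (chart_inv c y) (A (coord_covec \<A> c (chart_inv c y) \<xi>) t))
        (chart_image c \<times> UNIV \<times> UNIV))"

definition smooth_positive_fun ::
  "'a topology \<Rightarrow> ('a, 'n::finite) chart set \<Rightarrow> (('a, 'n) covec \<Rightarrow> real \<Rightarrow> real) \<Rightarrow> bool" where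
  "smooth_positive_fun X \<A> \<phi> \<longleftrightarrow>
     (\<forall>\<alpha>\<in>cotangent_bundle X \<A>. \<forall>t. \<phi> \<alpha> t > 0) \<and>
     (\<forall>c\<in>\<A>. smooth_on (\<lambda>(y, \<xi>, t). \<phi> (coord_covec \<A> c (chart_inv c y) \<xi>) t)
        (chart_image c \<times> UNIV \<times> UNIV))"

text \<open>The value at \<open>x\<close> of \<open>A(du, u) + \<nabla>\<^sup>2u\<close>.\<close>

definition hessian_op ::
  "('a, 'n::finite) chart set \<Rightarrow> ('a \<Rightarrow> ('a, 'n) tform) \<Rightarrow>
     (('a, 'n) covec \<Rightarrow> real \<Rightarrow> ('a, 'n) tform) \<Rightarrow> ('a \<Rightarrow> real) \<Rightarrow> 'a \<Rightarrow> ('a, 'n) tform" where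
  "hessian_op \<A> g A u x =
     (\<lambda>v w. A (differential \<A> u x) (u x) v w + hessian \<A> g u x v w)"

definition is_solution ::
  "'a topology \<Rightarrow> ('a, 'n::{finite,linorder}) chart set \<Rightarrow> ('a \<Rightarrow> ('a, 'n) tform) \<Rightarrow> nat \<Rightarrow>
     (('a, 'n) covec \<Rightarrow> real \<Rightarrow> ('a, 'n) tform) \<Rightarrow> (('a, 'n) covec \<Rightarrow> real \<Rightarrow> real) \<Rightarrow>
     ('a \<Rightarrow> real) \<Rightarrow> bool" where
  "is_solution X \<A> g p A \<phi> u \<longleftrightarrow>
     C2_fun \<A> u \<and>
     (\<forall>x\<in>topspace X.
        root p (sigma p (lambda_vec \<A> g x (hessian_op \<A> g A u x)))
          = \<phi> (differential \<A> u x) (u x) \<and>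
        lambda_vec \<A> g x (hessian_op \<A> g A u x) \<in> Gamma_cone p)"

definition pseudo_supersolution ::
  "'a topology \<Rightarrow> ('a, 'n::{finite,linorder}) chart set \<Rightarrow> ('a \<Rightarrow> ('a, 'n) tform) \<Rightarrow> nat \<Rightarrow>
     (('a, 'n) covec \<Rightarrow> real \<Rightarrow> ('a, 'n) tform) \<Rightarrow> (('a, 'n) covec \<Rightarrow> real \<Rightarrow> real) \<Rightarrow>
     ('a \<Rightarrow> real) \<Rightarrow> bool" where
  "pseudo_supersolution X \<A> g p A \<phi> ul \<longleftrightarrow>
     (\<exists>\<delta>\<^sub>2>0. \<exists>M\<^sub>2\<ge>0. \<forall>u. is_solution X \<A> g p A \<phi> u \<longrightarrow>
        (\<forall>x\<in>topspace X.
           lambda_vec \<A> g x (hessian \<A> g (\<lambda>z. u z - ul z) x) + \<delta>\<^sub>2 *\<^sub>R ones_vec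
             \<in> closure (Gamma_cone CARD('n)) \<and>
           covec_norm \<A> g (differential \<A> (\<lambda>z. u z - ul z) x) \<le> \<delta>\<^sub>2 \<longrightarrow>
           sigma CARD('n) (lambda_vec \<A> g x
               (\<lambda>v w. \<delta>\<^sub>2 * g x v w + hessian \<A> g (\<lambda>z. u z - ul z) x v w))
             \<le> M\<^sub>2))"

end

theory Submission
  imports Defs "HOL-Computational_Algebra.Polynomial"
begin

text \<open>
  Let \<open>w = u - ul\<close> for a solution \<open>u\<close>, and let \<open>H\<close> be the Hessian of \<open>w\<close>. At a point where
  \<open>H \<ge> - \<delta> g\<close> and \<open>|dw| \<le> \<delta>\<close>, the form \<open>A(du) + \<nabla>\<^sup>2u\<close> equals \<open>W + H\<close> with
  \<open>W = A(d ul + dw) + \<nabla>\<^sup>2ul\<close>, and \<open>W\<close> is close to \<open>A(d ul) + \<nabla>\<^sup>2ul\<close> because \<open>dw\<close> is small and \<open>A\<close>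
  does not see the values of \<open>u\<close>. Let \<open>l\<close> be the eigenvalue vector of \<open>A(d ul) + \<nabla>\<^sup>2ul\<close> and \<open>\<tau>\<close> the
  largest eigenvalue of \<open>H\<close>. By monotonicity of eigenvalues, all eigenvalues of \<open>W + H\<close> lie above those
  of \<open>l\<close> up to a small error \<open>\<eta>\<close>, and evaluating \<open>W + H\<close> on an eigenvector of \<open>H\<close> for \<open>\<tau>\<close> shows
  that the largest one is at least \<open>\<tau>\<close> plus the smallest entry of \<open>l\<close>, again up to \<open>\<eta>\<close>
  (lemma \<open>top_eigenvalue_bound\<close>).

  A vector above \<open>l - 2\<eta>\<close> with a huge last entry has a huge \<open>\<sigma>\<^sub>p\<close>: the hypothesis says that
  \<open>l\<close> enters \<open>\<Gamma>\<^sub>p\<close> after its last entry is raised by \<open>R\<close>, which persists after the subtraction of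
  a small multiple of \<open>(1,\<dots>,1)\<close>; on \<open>\<Gamma>\<^sub>p\<close> the function \<open>\<sigma>\<^sub>p\<close> increases in every entry and is
  affine with positive slope in the last one (lemma \<open>sigma_bound_controls_entry\<close>). But
  \<open>\<sigma>\<^sub>p\<close> of the eigenvalues of \<open>W + H\<close> is \<open>\<phi>(du)\<^sup>p\<close>, which is bounded because \<open>du\<close> is close to
  \<open>d ul\<close> and \<open>\<phi>\<close> does not see the values of \<open>u\<close> either. Hence \<open>\<tau> \<le> T\<close> for a constant \<open>T\<close>, the eigenvalues of
  \<open>\<delta> g + H\<close> lie in \<open>[0, T + \<delta>]\<close>, and their product is at most \<open>(T + \<delta>)\<^sup>n\<close>.

  Three facts carry the argument. First, deleting an entry maps \<open>\<Gamma>\<^sub>p\<close> to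
  \<open>\<Gamma>\<^sub>p\<^sub>-\<^sub>1\<close> (lemma \<open>esym_pos_remove\<close>); this rests on the inequality
  \<open>e\<^sub>k\<^sub>-\<^sub>1 e\<^sub>k\<^sub>+\<^sub>1 \<le> e\<^sub>k\<^sup>2\<close> for entries of any sign, for which an inductive identity is used
  (lemma \<open>esym_newton\<close>). Second, the eigenvalues of \<open>g\<^sup>-\<^sup>1B\<close> exist, and they compare as
  in the Courant-Fischer principle even when both \<open>g\<close> and \<open>B\<close> change
  (lemma \<open>eigenvalue_comparison\<close>). Third, differential, Hessian and eigenvalues can be computed in any chart:
  the eigenvalue vector at a point is defined through a chart that varies arbitrarily with the point,
  so neighbouring points can be compared only after everything has been transported to one fixed
  chart (lemmas \<open>form_matrix_hessian\<close> and \<open>lambda_vec_in_chart\<close>). There all data are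
  continuous, which makes the constants uniform near each point, and compactness makes them
  uniform on the manifold.\<close>

section \<open>Elementary symmetric functions\<close>

text \<open>Index sets other than the whole type are needed because entries are deleted one at a time.\<close>

definition esym :: "nat \<Rightarrow> 'b set \<Rightarrow> ('b \<Rightarrow> real) \<Rightarrow> real" where
  "esym k S x = (\<Sum>J | J \<subseteq> S \<and> card J = k. \<Prod>j\<in>J. x j)"

lemma esym_0: "finite S \<Longrightarrow> esym 0 S x = 1"
proof -
  assume "finite S"
  then have "{J. J \<subseteq> S \<and> card J = 0} = {{}}"
    by (auto dest: finite_subset)
  then show ?thesis by (simp add: esym_def)
qed

lemma esym_Suc_empty: "esym (Suc k) {} x = 0"
  by (simp add: esym_def)

lemma esym_insert:
  assumes "finite S" "i \<notin> S"
  shows "esym (Suc k) (insert i S) x = esym (Suc k) S x + x i * esym k S x"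
proof -
  let ?P = "\<lambda>J. \<Prod>j\<in>J. x j"
  let ?A = "{J. J \<subseteq> S \<and> card J = Suc k}" and ?B = "{J. J \<subseteq> S \<and> card J = k}"
  have fin: "finite ?A" "finite ?B" using assms(1) by simp_all
  have split: "{J. J \<subseteq> insert i S \<and> card J = Suc k} = ?A \<union> insert i ` ?B"
  proof (intro equalityI subsetI)
    fix J assume J: "J \<in> {J. J \<subseteq> insert i S \<and> card J = Suc k}"
    show "J \<in> ?A \<union> insert i ` ?B"
    proof (cases "i \<in> J")
      case True
      have "finite J" using J assms(1) finite_subset by fastforce
      then have "J = insert i (J - {i})" "J - {i} \<in> ?B" using J True by auto
      then show ?thesis by blast
    qed (use J in auto)
  next
    fix J assume "J \<in> ?A \<union> insert i ` ?B"
    then show "J \<in> {J. J \<subseteq> insert i S \<and> card J = Suc k}"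
    proof
      assume "J \<in> insert i ` ?B"
      then obtain K where K: "J = insert i K" "K \<subseteq> S" "card K = k" by blast
      have "finite K" using K(2) assms(1) finite_subset by blast
      then show ?thesis using K assms(2) by (auto simp: card_insert_if)
    qed auto
  qed
  have inj: "inj_on (insert i) ?B" using assms(2) by (auto simp: inj_on_def)
  have "sum ?P (insert i ` ?B) = (\<Sum>K\<in>?B. ?P (insert i K))"
    using inj by (simp add: sum.reindex)
  also have "\<dots> = (\<Sum>K\<in>?B. x i * ?P K)"
  proof (rule sum.cong)
    fix K assume "K \<in> ?B"
    then have "finite K" "i \<notin> K" using assms finite_subset by auto
    then show "?P (insert i K) = x i * ?P K" by simp
  qed simp
  finally have "sum ?P (insert i ` ?B) = x i * esym k S x"
    by (simp add: esym_def sum_distrib_left)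
  moreover have "?A \<inter> insert i ` ?B = {}" using assms(2) by auto
  ultimately show ?thesis
    unfolding esym_def split using fin by (simp add: sum.union_disjoint esym_def)
qed

lemma esym_remove:
  assumes "finite S" "i \<in> S"
  shows "esym (Suc k) S x = esym (Suc k) (S - {i}) x + x i * esym k (S - {i}) x"
  using esym_insert[of "S - {i}" i k x] assms by (simp add: insert_absorb)

lemma esym_cong: "(\<And>j. j \<in> S \<Longrightarrow> x j = y j) \<Longrightarrow> esym k S x = esym k S y"
  unfolding esym_def by (intro sum.cong prod.cong) auto

text \<open>Every monomial of degree \<open>k + 1\<close> arises on the left once for each of its \<open>k + 1\<close> factors.\<close>

lemma sum_times_esym_remove:
  assumes "finite S"
  shows "(\<Sum>i\<in>S. x i * esym k (S - {i}) x) = real (Suc k) * esym (Suc k) S x"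
  using assms
proof (induction S arbitrary: k)
  case empty
  then show ?case by (simp add: esym_Suc_empty)
next
  case (insert a S)
  have eq: "insert a S - {i} = insert a (S - {i})" if "i \<in> S" for i
    using insert.hyps that by auto
  show ?case
  proof (cases k)
    case 0
    then show ?thesis using insert.IH[of 0] insert.hyps by (simp add: esym_0 esym_insert)
  next
    case (Suc r)
    have "(\<Sum>i\<in>S. x i * esym k (insert a S - {i}) x)
        = (\<Sum>i\<in>S. x i * esym k (S - {i}) x) + x a * (\<Sum>i\<in>S. x i * esym r (S - {i}) x)"
      unfolding sum_distrib_left sum.distrib[symmetric]
      by (rule sum.cong) (use insert.hyps in \<open>auto simp: eq Suc esym_insert algebra_simps\<close>)
    then show ?thesis
      using insert by (simp add: esym_insert Suc algebra_simps)
  qed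
qed

text \<open>With \<open>e\<^sub>k\<close> for the whole set and \<open>f\<^sub>k\<close> for the set without \<open>i\<close>, the relation
  \<open>e\<^sub>k\<^sub>+\<^sub>1 = f\<^sub>k\<^sub>+\<^sub>1 + x\<^sub>i f\<^sub>k\<close> and the preceding sum formula give
  \<open>(r + 2)(e\<^sub>r\<^sub>+\<^sub>1\<^sup>2 - e\<^sub>r e\<^sub>r\<^sub>+\<^sub>2) = e\<^sub>r\<^sub>+\<^sub>1\<^sup>2 + (\<Sum>i. x\<^sub>i\<^sup>2 (f\<^sub>r\<^sup>2 - f\<^sub>r\<^sub>-\<^sub>1 f\<^sub>r\<^sub>+\<^sub>1))\<close>.
  The right-hand side is nonnegative by induction on \<open>r\<close>, whatever the signs of the \<open>x\<^sub>i\<close>. This is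
  Newton's inequality without its binomial factors.\<close>

lemma esym_newton:
  assumes "finite S"
  shows "esym r S x * esym (Suc (Suc r)) S x \<le> (esym (Suc r) S x)\<^sup>2"
  using assms
proof (induction r arbitrary: S)
  case (0 S)
  let ?e = "\<lambda>k. esym k S x"
  \<comment> \<open>For \<open>r = 0\<close> the summand is \<open>x\<^sub>i\<^sup>2\<close>, as \<open>f\<^sub>-\<^sub>1\<close> is \<open>0\<close>.\<close>
  let ?t = "\<lambda>i. x i * esym 0 (S - {i}) x * ?e 1 - x i * esym 1 (S - {i}) x * ?e 0"
  have "0 \<le> ?t i" if "i \<in> S" for i
    using esym_remove[of S i 0 x] that 0 by (simp add: esym_0 power2_eq_square[symmetric] algebra_simps)
  then have "0 \<le> (\<Sum>i\<in>S. ?t i)" by (intro sum_nonneg) auto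
  also have "\<dots> = ?e 1 * ?e 1 - 2 * ?e 2 * ?e 0"
    using sum_times_esym_remove[OF 0, of x 0] sum_times_esym_remove[OF 0, of x 1]
    by (simp add: sum_subtractf sum_distrib_right[symmetric] numeral_2_eq_2)
  finally show ?case
    using 0 by (simp add: esym_0 power2_eq_square numeral_2_eq_2)
       (smt (verit) zero_le_square)
next
  case (Suc r S)
  let ?e = "\<lambda>k. esym k S x"
  let ?f = "\<lambda>i k. esym k (S - {i}) x"
  let ?t = "\<lambda>i. x i * ?f i (Suc r) * ?e (Suc (Suc r)) - x i * ?f i (Suc (Suc r)) * ?e (Suc r)"
  have "0 \<le> ?t i" if "i \<in> S" for i
  proof -
    have "?t i = (x i)\<^sup>2 * ((?f i (Suc r))\<^sup>2 - ?f i r * ?f i (Suc (Suc r)))"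
      using esym_remove[of S i r x] esym_remove[of S i "Suc r" x] that Suc.prems
      by (simp add: power2_eq_square algebra_simps)
    then show ?thesis using Suc.IH[of "S - {i}"] Suc.prems by simp
  qed
  then have "0 \<le> (\<Sum>i\<in>S. ?t i)" by (intro sum_nonneg) auto
  also have "\<dots> = real (Suc (Suc r)) * ?e (Suc (Suc r)) * ?e (Suc (Suc r))
      - real (Suc (Suc (Suc r))) * ?e (Suc (Suc (Suc r))) * ?e (Suc r)"
    unfolding sum_subtractf sum_distrib_right[symmetric] sum_times_esym_remove[OF Suc.prems] ..
  finally have "real (r + 3) * (?e (Suc r) * ?e (Suc (Suc (Suc r))))
      \<le> real (r + 2) * (?e (Suc (Suc r)))\<^sup>2"
    by (simp add: power2_eq_square algebra_simps)
  also have "\<dots> \<le> real (r + 3) * (?e (Suc (Suc r)))\<^sup>2"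
    by (intro mult_right_mono) auto
  finally show ?case by (simp add: mult_le_cancel_left_pos)
qed

text \<open>If \<open>f\<^sub>q > 0 \<ge> f\<^sub>q\<^sub>+\<^sub>1\<close> for the set without \<open>i\<close>, then \<open>e\<^sub>q\<^sub>+\<^sub>1 > 0\<close> gives
  \<open>x\<^sub>i > - f\<^sub>q\<^sub>+\<^sub>1 / f\<^sub>q \<ge> 0\<close>, and then \<open>e\<^sub>q\<^sub>+\<^sub>2 > 0\<close> gives
  \<open>f\<^sub>q\<^sub>+\<^sub>2 > - x\<^sub>i f\<^sub>q\<^sub>+\<^sub>1 \<ge> f\<^sub>q\<^sub>+\<^sub>1\<^sup>2 / f\<^sub>q\<close>, which contradicts Newton's inequality.\<close>

lemma esym_pos_remove:
  assumes "finite S" "i \<in> S" and pos: "\<And>q. q \<le> Suc p \<Longrightarrow> 0 < esym q S x" and "q \<le> p"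
  shows "0 < esym q (S - {i}) x"
  using \<open>q \<le> p\<close>
proof (induction q)
  case 0
  then show ?case using assms(1) by (simp add: esym_0)
next
  case (Suc q)
  let ?f = "\<lambda>k. esym k (S - {i}) x"
  have f: "0 < ?f q" using Suc by simp
  show ?case
  proof (rule ccontr)
    assume "\<not> 0 < ?f (Suc q)"
    then have neg: "?f (Suc q) \<le> 0" by simp
    have "0 < ?f (Suc q) + x i * ?f q"
      using pos[of "Suc q"] esym_remove[OF assms(1,2), of q x] Suc.prems by simp
    then have 1: "- ?f (Suc q) \<le> x i * ?f q" by simp
    have 2: "0 < ?f (Suc (Suc q)) + x i * ?f (Suc q)"
      using pos[of "Suc (Suc q)"] esym_remove[OF assms(1,2), of "Suc q" x] Suc.prems by simp
    have "(?f (Suc q))\<^sup>2 = (- ?f (Suc q)) * (- ?f (Suc q))" by (simp add: power2_eq_square)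
    also have "\<dots> \<le> (- ?f (Suc q)) * (x i * ?f q)"
      using 1 neg by (intro mult_left_mono) auto
    also have "\<dots> = ?f q * (- (x i * ?f (Suc q)))" by (simp add: algebra_simps)
    also have "\<dots> < ?f q * ?f (Suc (Suc q))"
      using 2 f by (intro mult_strict_left_mono) auto
    also have "\<dots> \<le> (?f (Suc q))\<^sup>2" using esym_newton assms(1) by blast
    finally show False by simp
  qed
qed

lemma esym_update:
  assumes "finite S" "i \<in> S"
  shows "esym (Suc q) S (x(i := t)) = esym (Suc q) S x + (t - x i) * esym q (S - {i}) x"
proof -
  have "esym k (S - {i}) (x(i := t)) = esym k (S - {i}) x" for k by (rule esym_cong) auto
  then show ?thesis using esym_remove[OF assms] by (simp add: algebra_simps)
qed

text \<open>The entries are raised one at a time. Each step changes \<open>e\<^sub>q\<close> by a nonnegative multiple of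
  \<open>e\<^sub>q\<^sub>-\<^sub>1\<close> of the other entries, which is positive by \<open>esym_pos_remove\<close>; so all
  \<open>e\<^sub>q\<close> with \<open>q \<le> p\<close> stay positive and the next step can follow.\<close>

lemma esym_mono:
  assumes fin: "finite S" and le: "\<And>i. i \<in> S \<Longrightarrow> x i \<le> y i"
    and pos: "\<And>q. q \<le> p \<Longrightarrow> 0 < esym q S x" and "q \<le> p"
  shows "esym q S x \<le> esym q S y"
proof -
  have "esym q S x \<le> esym q S (\<lambda>i. if i \<in> T then y i else x i)" if "finite T" "T \<subseteq> S" "q \<le> p" for T q
    using that
  proof (induction T arbitrary: q)
    case (insert a T)
    let ?z = "\<lambda>i. if i \<in> T then y i else x i"
    have z: "(\<lambda>i. if i \<in> insert a T then y i else x i) = ?z(a := y a)" by auto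
    have zpos: "0 < esym q S ?z" if "q \<le> p" for q
      using insert.IH[of q] insert.prems pos[of q] that by force
    show ?case
    proof (cases q)
      case 0
      then show ?thesis using fin by (simp add: esym_0)
    next
      case (Suc r)
      have "0 < esym r (S - {a}) ?z"
        by (rule esym_pos_remove[where p = r]) (use fin insert.prems zpos Suc in auto)
      moreover have "?z a = x a" using insert.hyps by simp
      ultimately have "esym q S ?z \<le> esym q S (?z(a := y a))"
        using esym_update[of S a r ?z "y a"] fin insert.prems le[of a] Suc by simp
      then show ?thesis using insert.IH[of q] insert.prems unfolding z by simp
    qed
  qed simp
  from this[of S q] fin \<open>q \<le> p\<close>
  have "esym q S x \<le> esym q S (\<lambda>i. if i \<in> S then y i else x i)" by simp
  also have "\<dots> = esym q S y" by (rule esym_cong) simp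
  finally show ?thesis .
qed

text \<open>Deleting all other entries leaves \<open>e\<^sub>1 = x i\<close>.\<close>

lemma esym_pos_card_imp_pos:
  assumes "finite S" "i \<in> S" "\<And>q. q \<le> card S \<Longrightarrow> 0 < esym q S x"
  shows "0 < x i"
  using assms
proof (induction "card S" arbitrary: S)
  case 0
  then show ?case by auto
next
  case (Suc n)
  show ?case
  proof (cases "S = {i}")
    case True
    then show ?thesis using Suc.prems(3)[of 1] esym_insert[of "{}" i 0 x]
      by (simp add: esym_0 esym_Suc_empty)
  next
    case False
    then obtain j where j: "j \<in> S" "j \<noteq> i" using Suc.prems by blast
    show ?thesis
    proof (rule Suc.hyps(1)[of "S - {j}"])
      fix q assume "q \<le> card (S - {j})"
      then show "0 < esym q (S - {j}) x"
        using Suc j by (intro esym_pos_remove[where p = n]) auto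
    qed (use Suc j in auto)
  qed
qed

section \<open>The cones of the Hessian equations\<close>

lemma sigma_eq_esym: "sigma p \<mu> = esym p UNIV (($) \<mu>)"
  by (simp add: sigma_def esym_def)

lemma Gamma_cone_iff_esym: "\<mu> \<in> Gamma_cone p \<longleftrightarrow> (\<forall>q\<le>p. 0 < esym q UNIV (($) (\<mu>::real^'n)))"
proof -
  have "esym 0 UNIV (($) \<mu>) = 1" by (simp add: esym_0)
  then show ?thesis unfolding Gamma_cone_def sigma_eq_esym
    by (auto simp: Ball_def) (metis One_nat_def Suc_leI gr0I zero_less_one)
qed

lemma open_Gamma_cone: "open (Gamma_cone p :: (real^'n) set)"
proof -
  have "Gamma_cone p = (\<Inter>q\<in>{1..p}. {\<mu>::real^'n. 0 < sigma q \<mu>})" by (auto simp: Gamma_cone_def)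
  moreover have "open {\<mu>::real^'n. 0 < sigma q \<mu>}" for q
    unfolding sigma_def by (intro open_Collect_less continuous_intros)
  ultimately show ?thesis by auto
qed

lemma closure_Gamma_cone_nonneg:
  fixes \<mu> :: "real^'n"
  assumes "\<mu> \<in> closure (Gamma_cone CARD('n))"
  shows "0 \<le> \<mu> $ i"
proof -
  have "Gamma_cone CARD('n) \<subseteq> {\<mu>::real^'n. 0 \<le> \<mu> $ i}"
  proof
    fix \<mu> :: "real^'n" assume "\<mu> \<in> Gamma_cone CARD('n)"
    then have "0 < \<mu> $ i"
      using esym_pos_card_imp_pos[OF finite_class.finite_UNIV UNIV_I, of "($) \<mu>" i]
      by (simp add: Gamma_cone_iff_esym)
    then show "\<mu> \<in> {\<mu>. 0 \<le> \<mu> $ i}" by simp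
  qed
  moreover have "closed {\<mu>::real^'n. 0 \<le> \<mu> $ i}" by (intro closed_Collect_le continuous_intros)
  ultimately show ?thesis using assms closure_minimal by blast
qed

text \<open>Once entry \<open>m\<close> of \<open>\<mu>\<close> exceeds \<open>\<kappa>\<^sub>m + R\<close>, monotonicity allows the other entries to be replaced by those of
  \<open>\<kappa>\<close>, and the resulting lower bound for \<open>\<sigma>\<^sub>p\<close> is affine in \<open>\<mu>\<^sub>m\<close> with a positive slope that does not depend
  on \<open>\<mu>\<close>.\<close>

lemma sigma_bound_controls_entry:
  fixes \<kappa> :: "real^'n"
  assumes "1 \<le> p" and \<Gamma>: "\<kappa> + R *\<^sub>R axis m 1 \<in> Gamma_cone p"
  obtains T where "\<And>\<mu>. (\<And>i. \<kappa> $ i \<le> \<mu> $ i) \<Longrightarrow> sigma p \<mu> \<le> C \<Longrightarrow> \<mu> $ m \<le> T"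
proof -
  obtain r where p: "p = Suc r" using \<open>1 \<le> p\<close> by (cases p) auto
  define a where "a = ($) (\<kappa> + R *\<^sub>R axis m 1)"
  have pos: "0 < esym q UNIV a" if "q \<le> p" for q
    using \<Gamma> that unfolding Gamma_cone_iff_esym a_def by blast
  define D where "D = esym r (UNIV - {m}) a"
  have D: "0 < D" unfolding D_def by (rule esym_pos_remove[where p = r]) (use pos p in auto)
  have "\<mu> $ m \<le> a m + max 0 C / D" if ge: "\<And>i. \<kappa> $ i \<le> \<mu> $ i" and C: "sigma p \<mu> \<le> C" for \<mu>
  proof (cases "a m \<le> \<mu> $ m")
    case True
    have "esym p UNIV (a(m := \<mu> $ m)) \<le> sigma p \<mu>"
      unfolding sigma_eq_esym
    proof (rule esym_mono[where p = p])
      fix i show "(a(m := \<mu> $ m)) i \<le> \<mu> $ i" using ge[of i] by (simp add: a_def axis_def)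
    next
      fix q assume q: "q \<le> p"
      have "esym q UNIV a \<le> esym q UNIV (a(m := \<mu> $ m))"
        by (rule esym_mono[where p = p]) (use True pos q in auto)
      then show "0 < esym q UNIV (a(m := \<mu> $ m))" using pos[OF q] by simp
    qed auto
    then have "esym p UNIV a + (\<mu> $ m - a m) * D \<le> C"
      using C esym_update[of UNIV m r a "\<mu> $ m"] by (simp add: p D_def)
    then have "(\<mu> $ m - a m) * D \<le> max 0 C" using pos[of p] by simp
    then show ?thesis using D by (simp add: field_simps)
  next
    case False
    then show ?thesis using D by (smt (verit) divide_nonneg_pos)
  qed
  then show thesis by (rule that)
qed

section \<open>Eigenvalues of a symmetric form relative to a metric\<close>

text \<open>Along \<open>v + t w\<close> the form \<open>h\<close> is \<open>2 t h(v,w) + t\<^sup>2 h(w,w)\<close>, whose linear term would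
  dominate for small \<open>t\<close> of the right sign.\<close>

lemma psd_null_vector_annihilates:
  fixes h :: "'v::real_vector \<Rightarrow> 'v \<Rightarrow> real"
  assumes "bilinear h" and sym: "\<And>x y. h x y = h y x"
    and V: "subspace V" and psd: "\<And>w. w \<in> V \<Longrightarrow> 0 \<le> h w w"
    and v: "v \<in> V" "h v v = 0" and w: "w \<in> V"
  shows "h v w = 0"
proof (rule ccontr)
  assume nz: "h v w \<noteq> 0"
  have ineq: "0 \<le> 2 * t * h v w + t\<^sup>2 * h w w" for t
  proof -
    have "v + t *\<^sub>R w \<in> V" using V v w by (simp add: subspace_add subspace_scale)
    then have "0 \<le> h (v + t *\<^sub>R w) (v + t *\<^sub>R w)" by (rule psd)
    also have "\<dots> = 2 * t * h v w + t\<^sup>2 * h w w"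
      using \<open>bilinear h\<close> v sym[of w v]
      by (simp add: bilinear_ladd bilinear_radd bilinear_lmul bilinear_rmul power2_eq_square algebra_simps)
    finally show ?thesis .
  qed
  \<comment> \<open>The step \<open>t = - h v w / q\<close> makes the quadratic negative; adding \<open>1\<close> covers \<open>h w w = 0\<close>.\<close>
  define q where "q = h w w + 1"
  have q: "q > 0" using psd[OF w] by (simp add: q_def)
  have "0 \<le> 2 * (- h v w / q) * h v w + (- h v w / q)\<^sup>2 * h w w" by (rule ineq)
  also have "\<dots> = (h v w)\<^sup>2 / q * (h w w / q - 2)"
    using q by (simp add: field_simps power2_eq_square)
  also have "\<dots> < 0"
  proof (rule mult_pos_neg)
    show "0 < (h v w)\<^sup>2 / q" using nz q by simp
    show "h w w / q - 2 < 0" using q by (simp add: field_simps q_def)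
  qed
  finally show False by simp
qed

text \<open>A maximizer \<open>v\<close> of the Rayleigh quotient \<open>b(w,w) / g(w,w)\<close> is a null vector of the positive
  semidefinite form \<open>(max) g - b\<close>.\<close>

lemma bilinear_maximal_direction:
  fixes g b :: "'v::euclidean_space \<Rightarrow> 'v \<Rightarrow> real"
  assumes g: "bilinear g" "\<And>x y. g x y = g y x" "\<And>x. x \<noteq> 0 \<Longrightarrow> 0 < g x x"
    and b: "bilinear b" "\<And>x y. b x y = b y x"
    and V: "subspace V" "V \<noteq> {0}"
  obtains v where "v \<in> V" "g v v = 1" "\<And>w. w \<in> V \<Longrightarrow> b v w = b v v * g v w"
    "\<And>w. w \<in> V \<Longrightarrow> b w w \<le> b v v * g w w"
proof -
  let ?K = "V \<inter> sphere 0 1"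
  have "compact ?K"
    using V(1) by (metis closed_subspace compact_Int_closed compact_sphere inf_commute)
  obtain u where u: "u \<in> V" "u \<noteq> 0" using V subspace_0 by blast
  then have "u /\<^sub>R norm u \<in> ?K" using V(1) by (simp add: subspace_scale)
  then have "?K \<noteq> {}" by blast
  have bb: "bounded_bilinear g" "bounded_bilinear b"
    using g(1) b(1) by (simp_all add: bilinear_conv_bounded_bilinear)
  have gnz: "\<forall>w\<in>?K. g w w \<noteq> 0"
  proof
    fix w assume "w \<in> ?K"
    then have "w \<noteq> 0" by auto
    then show "g w w \<noteq> 0" using g(3)[of w] by simp
  qed
  have "continuous_on ?K (\<lambda>w. b w w / g w w)"
    by (intro continuous_on_divide bounded_bilinear.continuous_on[OF bb(1)]
        bounded_bilinear.continuous_on[OF bb(2)] continuous_on_id) (use gnz in blast)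
  then obtain v0 where v0: "v0 \<in> ?K" and max: "\<And>w. w \<in> ?K \<Longrightarrow> b w w / g w w \<le> b v0 v0 / g v0 v0"
    using continuous_attains_sup[OF \<open>compact ?K\<close> \<open>?K \<noteq> {}\<close>] by blast
  define l where "l = b v0 v0 / g v0 v0"
  have v0nz: "v0 \<noteq> 0" "v0 \<in> V" using v0 by auto
  then have gv0: "g v0 v0 > 0" using g(3) by blast
  have le: "b w w \<le> l * g w w" if "w \<in> V" for w
  proof (cases "w = 0")
    case True
    then show ?thesis using g(1) b(1) by (simp add: bilinear_lzero)
  next
    case False
    let ?w = "w /\<^sub>R norm w"
    have "?w \<in> ?K" using False that V(1) by (simp add: subspace_scale)
    then have "b ?w ?w / g ?w ?w \<le> l" using max unfolding l_def by blast
    moreover have "b ?w ?w / g ?w ?w = b w w / g w w"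
      using False g(1) b(1) by (simp add: bilinear_lmul bilinear_rmul field_simps)
    ultimately have "b w w / g w w \<le> l" by simp
    then show ?thesis using g(3)[OF False] by (simp add: field_simps)
  qed
  let ?h = "\<lambda>x y. l * g x y - b x y"
  have "bilinear ?h"
    using g(1) b(1) unfolding bilinear_def linear_iff by (simp add: algebra_simps)
  then have h0: "?h v0 w = 0" if "w \<in> V" for w
    by (rule psd_null_vector_annihilates[where V = V])
      (use g(2) b(2) V(1) le v0nz that gv0 in \<open>auto simp: l_def\<close>)
  define v where "v = v0 /\<^sub>R sqrt (g v0 v0)"
  have gv: "g v v = 1"
    using g(1) gv0 by (simp add: v_def bilinear_lmul bilinear_rmul field_simps)
  have bv: "b v v = l"
    using b(1) gv0 by (simp add: v_def l_def bilinear_lmul bilinear_rmul field_simps)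
  have vw: "b v w = l * g v w" if "w \<in> V" for w
    using g(1) b(1) h0[OF that] by (simp add: v_def bilinear_lmul)
  show thesis
  proof
    show "v \<in> V" using v0nz V(1) by (simp add: v_def subspace_scale)
  qed (use gv bv vw le in auto)
qed

text \<open>The greatest index receives a direction of maximal Rayleigh quotient, and the remaining ones are
  found in its \<open>g\<close>-orthogonal complement. Taking indices in decreasing order makes
  the eigenvalues monotone.\<close>

lemma simultaneous_diagonalization_on:
  fixes g b :: "'v::euclidean_space \<Rightarrow> 'v \<Rightarrow> real" and S :: "'n::linorder set"
  assumes g: "bilinear g" "\<And>x y. g x y = g y x" "\<And>x. x \<noteq> 0 \<Longrightarrow> 0 < g x x"
    and b: "bilinear b" "\<And>x y. b x y = b y x"
    and "finite S" "subspace V" "dim V = card S"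
  shows "\<exists>v l. (\<forall>i\<in>S. v i \<in> V) \<and>
    (\<forall>i\<in>S. \<forall>j\<in>S. g (v i) (v j) = (if i = j then 1 else 0) \<and> b (v i) (v j) = (if i = j then l i else 0)) \<and>
    (\<forall>i\<in>S. \<forall>j\<in>S. i \<le> j \<longrightarrow> l i \<le> l j)"
  using assms(6-)
proof (induction S arbitrary: V rule: finite_linorder_max_induct)
  case empty
  then show ?case by simp
next
  case (insert m S)
  have m: "m \<notin> S" using insert.hyps by auto
  then have dimV: "dim V = Suc (card S)" using insert by simp
  then have "V \<noteq> {0}" by auto
  then obtain u where u: "u \<in> V" "g u u = 1" "\<And>w. w \<in> V \<Longrightarrow> b u w = b u u * g u w"
    "\<And>w. w \<in> V \<Longrightarrow> b w w \<le> b u u * g w w"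
    using bilinear_maximal_direction[OF g b insert.prems(1)] by blast
  define W where "W = {w \<in> V. g u w = 0}"
  have lin: "linear (g u)" using g(1) by (simp add: bilinear_def)
  have W: "subspace W"
    using insert.prems(1) lin unfolding W_def subspace_def
    by (auto simp: linear_add linear_cmul linear_0)
  have "span (insert u W) = V"
  proof
    show "span (insert u W) \<subseteq> V"
      using u(1) insert.prems(1) by (intro span_minimal) (auto simp: W_def)
    show "V \<subseteq> span (insert u W)"
    proof
      fix w assume w: "w \<in> V"
      have "w - g u w *\<^sub>R u \<in> W"
        using w u(1,2) insert.prems(1) lin
        by (simp add: W_def subspace_diff subspace_scale linear_diff linear_cmul)
      then show "w \<in> span (insert u W)"
        using span_breakdown_eq[of w u W] span_base by blast
    qed
  qed
  then have "dim (insert u W) = Suc (card S)" using dimV dim_span by metis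
  moreover have "u \<notin> span W" using W u(2) by (simp add: span_eq_iff[THEN iffD2] W_def)
  ultimately have "dim W = card S" by (simp add: dim_insert)
  from insert.IH[OF W this] obtain v l where vl: "\<forall>i\<in>S. v i \<in> W"
    "\<forall>i\<in>S. \<forall>j\<in>S. g (v i) (v j) = (if i = j then 1 else 0) \<and> b (v i) (v j) = (if i = j then l i else 0)"
    "\<forall>i\<in>S. \<forall>j\<in>S. i \<le> j \<longrightarrow> l i \<le> l j" by (elim exE conjE)
  have gu: "g u (v i) = 0" "g (v i) u = 0" "b u (v i) = 0" "b (v i) u = 0" if "i \<in> S" for i
  proof -
    have W: "v i \<in> V" "g u (v i) = 0" using vl(1) that by (auto simp: W_def)
    then show "g u (v i) = 0" "b u (v i) = 0" using u(3) by simp_all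
    then show "g (v i) u = 0" "b (v i) u = 0" by (metis g(2), metis b(2))
  qed
  have lu: "l i \<le> b u u" if "i \<in> S" for i
    using u(4)[of "v i"] vl(1,2) that unfolding W_def by fastforce
  have notle: "\<not> m \<le> i" if "i \<in> S" for i using insert.hyps that by force
  show ?case
  proof (intro exI conjI)
    show "\<forall>i\<in>insert m S. (v(m := u)) i \<in> V" using vl(1) u(1) by (auto simp: W_def)
    show "\<forall>i\<in>insert m S. \<forall>j\<in>insert m S. g ((v(m := u)) i) ((v(m := u)) j) = (if i = j then 1 else 0)
      \<and> b ((v(m := u)) i) ((v(m := u)) j) = (if i = j then (l(m := b u u)) i else 0)"
      using vl(2) u(2) gu m by auto
    show "\<forall>i\<in>insert m S. \<forall>j\<in>insert m S. i \<le> j \<longrightarrow> (l(m := b u u)) i \<le> (l(m := b u u)) j"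
      using vl(3) lu m notle by auto
  qed
qed

definition spd :: "real^'n^'n \<Rightarrow> bool" where
  "spd G \<longleftrightarrow> transpose G = G \<and> (\<forall>v. v \<noteq> 0 \<longrightarrow> 0 < v \<bullet> (G *v v))"

lemma bilinear_matrix_form: "bilinear (\<lambda>x y. x \<bullet> ((B::real^'n^'n) *v y))"
  unfolding bilinear_def linear_iff
  by (simp add: inner_simps matrix_vector_right_distrib matrix_vector_mult_scaleR)

lemma symmetric_matrix_form:
  fixes B :: "real^'n^'n"
  assumes "transpose B = B" shows "x \<bullet> (B *v y) = y \<bullet> (B *v x)"
  by (metis assms dot_lmul_matrix inner_commute transpose_matrix_vector)

text \<open>Monotonicity identifies the entry at the greatest index with the largest root, and its
  linear factor can be cancelled.\<close>

lemma sorted_roots_unique_on: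
  fixes \<mu> \<nu> :: "'n::linorder \<Rightarrow> real"
  assumes "finite S"
    and "\<forall>i\<in>S. \<forall>j\<in>S. i \<le> j \<longrightarrow> \<mu> i \<le> \<mu> j" "\<forall>i\<in>S. \<forall>j\<in>S. i \<le> j \<longrightarrow> \<nu> i \<le> \<nu> j"
    and "(\<Prod>i\<in>S. [:- \<mu> i, 1:]) = (\<Prod>i\<in>S. [:- \<nu> i, 1:])"
  shows "\<forall>i\<in>S. \<mu> i = \<nu> i"
  using assms
proof (induction S rule: finite_linorder_max_induct)
  case (insert m S)
  have m: "m \<notin> S" using insert.hyps by auto
  have roots: "\<mu> ` insert m S = \<nu> ` insert m S"
  proof -
    have "poly (\<Prod>i\<in>insert m S. [:- \<mu> i, 1:]) r = poly (\<Prod>i\<in>insert m S. [:- \<nu> i, 1:]) r" for r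
      using insert.prems(3) by simp
    then have "(\<Prod>i\<in>insert m S. r - \<mu> i) = (\<Prod>i\<in>insert m S. r - \<nu> i)" for r
      by (simp add: poly_prod)
    then have "(\<exists>i\<in>insert m S. r - \<mu> i = 0) = (\<exists>i\<in>insert m S. r - \<nu> i = 0)" for r
      using insert.hyps(1) by (metis finite_insert prod_zero_iff)
    then have "(r \<in> \<mu> ` insert m S) = (r \<in> \<nu> ` insert m S)" for r
      unfolding image_iff by simp
    then show ?thesis by blast
  qed
  have le: "\<mu> i \<le> \<mu> m" "\<nu> i \<le> \<nu> m" if "i \<in> insert m S" for i
    using insert.prems(1,2) insert.hyps that by (metis insertI1 insert_iff less_imp_le order_refl)+
  have "\<mu> m \<in> \<nu> ` insert m S" "\<nu> m \<in> \<mu> ` insert m S" using roots by blast+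
  then have eq: "\<mu> m = \<nu> m" using le by (metis imageE order_antisym)
  have "(\<Prod>i\<in>S. [:- \<mu> i, 1:]) = (\<Prod>i\<in>S. [:- \<nu> i, 1:])"
  proof -
    have "[:- \<nu> m, 1:] * (\<Prod>i\<in>S. [:- \<mu> i, 1:]) = [:- \<nu> m, 1:] * (\<Prod>i\<in>S. [:- \<nu> i, 1:])"
      using insert.prems(3) unfolding prod.insert[OF insert.hyps(1) m] eq .
    then show ?thesis by (rule mult_left_cancel[THEN iffD1, rotated]) simp
  qed
  with insert.prems(1,2) have "\<forall>i\<in>S. \<mu> i = \<nu> i" by (intro insert.IH) blast+
  then show ?case using eq by simp
qed simp

lemma is_eigenvalue_vec_unique:
  assumes "is_eigenvalue_vec B \<mu>" "is_eigenvalue_vec B \<nu>"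
  shows "\<mu> = \<nu>"
proof -
  have "(\<Prod>i\<in>UNIV. s - \<mu> $ i) = (\<Prod>i\<in>UNIV. s - \<nu> $ i)" for s
    using assms unfolding is_eigenvalue_vec_def by metis
  then have "poly (\<Prod>i\<in>UNIV. [:- \<mu> $ i, 1:]) = poly (\<Prod>i\<in>UNIV. [:- \<nu> $ i, 1:])"
    by (intro ext) (simp add: poly_prod)
  then have "(\<Prod>i\<in>UNIV. [:- \<mu> $ i, 1:]) = (\<Prod>i\<in>UNIV. [:- \<nu> $ i, 1:])"
    by (simp add: poly_eq_poly_eq_iff)
  then have "\<forall>i\<in>UNIV. \<mu> $ i = \<nu> $ i"
    by (intro sorted_roots_unique_on) (use assms in \<open>auto simp: is_eigenvalue_vec_def\<close>)
  then show ?thesis by (simp add: vec_eq_iff)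
qed

lemma eigenvalue_vec_eq: "is_eigenvalue_vec B \<mu> \<Longrightarrow> eigenvalue_vec B = \<mu>"
  unfolding eigenvalue_vec_def using is_eigenvalue_vec_unique by blast

lemma matrix_mult_diff:
  fixes A B C :: "real^'n^'n"
  shows "A ** (B - C) = A ** B - A ** C" "(B - C) ** A = B ** A - C ** A"
  by (simp_all add: vec_eq_iff matrix_matrix_mult_def algebra_simps sum_subtractf)

lemma matrix_mult_scaleR:
  fixes A B :: "real^'n^'n"
  shows "(s *\<^sub>R A) ** B = s *\<^sub>R (A ** B)" "A ** (s *\<^sub>R B) = s *\<^sub>R (A ** B)"
  by (simp_all add: vec_eq_iff matrix_matrix_mult_def sum_distrib_left mult_ac)

lemma spd_mult_mat_minus:
  fixes G B :: "real^'n^'n"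
  assumes "G ** matrix_inv G = mat 1"
  shows "G ** (mat s - matrix_inv G ** B) = s *\<^sub>R G - B"
proof -
  have "mat s = s *\<^sub>R (mat 1 :: real^'n^'n)" by (simp add: vec_eq_iff mat_def)
  then show ?thesis
    using assms by (simp add: matrix_mult_diff matrix_mult_scaleR matrix_mul_assoc)
qed

lemma spd_matrix_inv:
  assumes "spd G" shows "matrix_inv G ** G = mat 1" "G ** matrix_inv G = mat 1"
proof -
  have "G *v x = 0 \<Longrightarrow> x = 0" for x using assms unfolding spd_def by force
  then have "invertible G"
    unfolding invertible_left_inverse using matrix_left_invertible_ker by metis
  then have "G ** matrix_inv G = mat 1 \<and> matrix_inv G ** G = mat 1"
    unfolding matrix_inv_def invertible_def by (rule someI_ex)
  then show "matrix_inv G ** G = mat 1" "G ** matrix_inv G = mat 1" by simp_all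
qed

text \<open>If the rows of \<open>T\<close> are the vectors of a simultaneously diagonalizing basis, then \<open>T G T\<^sup>t = 1\<close> and
  \<open>T B T\<^sup>t\<close> is diagonal. Hence \<open>det (s G - B)\<close> and the characteristic polynomial of \<open>G\<^sup>-\<^sup>1 B\<close> differ
  only by the factor \<open>det G = (det T)\<^sup>-\<^sup>2\<close>. In particular \<open>eigenvalue_vec\<close> denotes
  the actual eigenvalue vector here.\<close>

lemma spd_pencil_eigenbasis:
  fixes G B :: "real^'n::{finite,linorder}^'n::{finite,linorder}"
  assumes G: "spd G" and B: "transpose B = B"
  obtains v where "is_eigenvalue_vec (matrix_inv G ** B) (eigenvalue_vec (matrix_inv G ** B))"
    "\<And>i j. v i \<bullet> (G *v v j) = (if i = j then 1 else 0)"
    "\<And>i j. v i \<bullet> (B *v v j) = (if i = j then eigenvalue_vec (matrix_inv G ** B) $ i else 0)"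
proof -
  have symG: "transpose G = G" and pos: "\<And>x. x \<noteq> 0 \<Longrightarrow> 0 < x \<bullet> (G *v x)"
    using G by (simp_all add: spd_def)
  have "dim (UNIV :: (real^'n::{finite,linorder}) set) = card (UNIV :: 'n::{finite,linorder} set)" by simp
  then have "\<exists>v l. (\<forall>i\<in>UNIV. v i \<in> UNIV) \<and>
      (\<forall>i\<in>UNIV. \<forall>j\<in>UNIV. v i \<bullet> (G *v v j) = (if i = j then 1 else 0)
        \<and> v i \<bullet> (B *v v j) = (if i = j then l i else 0)) \<and>
      (\<forall>i\<in>UNIV. \<forall>j\<in>UNIV. i \<le> (j::'n) \<longrightarrow> l i \<le> l j)"
    by (intro simultaneous_diagonalization_on bilinear_matrix_form symmetric_matrix_form symG B pos
        finite_class.finite_UNIV subspace_UNIV)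
  then obtain v l where vl: "(\<forall>i\<in>UNIV. v i \<in> UNIV) \<and>
      (\<forall>i\<in>UNIV. \<forall>j\<in>UNIV. v i \<bullet> (G *v v j) = (if i = j then 1 else 0)
        \<and> v i \<bullet> (B *v v j) = (if i = j then l i else 0)) \<and>
      (\<forall>i\<in>UNIV. \<forall>j\<in>UNIV. i \<le> (j::'n) \<longrightarrow> l i \<le> l j)"
    by (elim exE) (rule that)
  then have v: "\<And>i j. v i \<bullet> (G *v v j) = (if i = j then 1 else 0)"
     "\<And>i j. v i \<bullet> (B *v v j) = (if i = j then l i else 0)"
     "\<And>i j. i \<le> (j::'n) \<Longrightarrow> l i \<le> l j" by simp_all
  define T where "T = (\<chi> i. v i)"
  have entry: "(T ** M ** transpose T) $ i $ j = v i \<bullet> (M *v v j)" for M i j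
    unfolding T_def matrix_matrix_mult_def transpose_def matrix_vector_mult_def inner_vec_def
    by (simp add: sum_distrib_left sum_distrib_right mult.assoc) (rule sum.swap)
  have TG: "T ** G ** transpose T = mat 1"
    by (simp add: vec_eq_iff entry v mat_def)
  have dT: "det T * det G * det T = 1"
    using arg_cong[OF TG, of det] by (simp add: det_mul det_transpose)
  have "det (mat s - matrix_inv G ** B) = (\<Prod>i\<in>UNIV. s - l i)" for s
  proof -
    have "T ** (s *\<^sub>R G - B) ** transpose T = (\<chi> i j. if i = j then s - l i else 0)"
      by (simp add: vec_eq_iff entry v matrix_vector_mult_diff_rdistrib inner_diff_right
          scaleR_matrix_vector_assoc[symmetric])
    from arg_cong[OF this, of det]
    have "det T * det (s *\<^sub>R G - B) * det T = det (\<chi> i j. if i = j then s - l i else 0)"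
      by (simp only: det_mul det_transpose)
    also have "\<dots> = (\<Prod>i\<in>UNIV. s - l i)" by (subst det_diagonal) simp_all
    finally have 1: "det T * det (s *\<^sub>R G - B) * det T = (\<Prod>i\<in>UNIV. s - l i)" .
    have "s *\<^sub>R G - B = G ** (mat s - matrix_inv G ** B)"
      using spd_mult_mat_minus[OF spd_matrix_inv(2)[OF G]] by metis
    then have "det (s *\<^sub>R G - B) = det G * det (mat s - matrix_inv G ** B)" by (simp add: det_mul)
    then have "(det T * det G * det T) * det (mat s - matrix_inv G ** B) = (\<Prod>i\<in>UNIV. s - l i)"
      using 1 by (simp only: mult_ac)
    then show ?thesis by (simp only: dT mult_1_left)
  qed
  then have "is_eigenvalue_vec (matrix_inv G ** B) (\<chi> i. l i)"
    using v(3) by (simp add: is_eigenvalue_vec_def)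
  moreover from this have "eigenvalue_vec (matrix_inv G ** B) = (\<chi> i. l i)" by (rule eigenvalue_vec_eq)
  ultimately show thesis using v(1,2) by (intro that[of v]) auto
qed

text \<open>The map from coefficients to vectors is injective, because pairing with the basis recovers the coefficients,
  and therefore surjective.\<close>

lemma eigenbasis_expansion:
  fixes G :: "real^'n^'n" and v :: "'n \<Rightarrow> real^'n"
  assumes orth: "\<And>i j. v i \<bullet> (G *v v j) = (if i = j then 1 else 0)"
  shows "x = (\<Sum>i\<in>UNIV. (v i \<bullet> (G *v x)) *\<^sub>R v i)"
proof -
  define f where "f a = (\<Sum>i\<in>UNIV. (a $ i) *\<^sub>R v i)" for a :: "real^'n"
  have lin: "linear f"
    unfolding f_def linear_iff by (simp add: scaleR_left_distrib sum.distrib scaleR_sum_right)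
  have coord: "v j \<bullet> (G *v f a) = a $ j" for a j
    unfolding f_def
    by (simp add: linear_sum[OF matrix_vector_mul_linear] inner_sum_right orth
        matrix_vector_mult_scaleR if_distrib cong: if_cong)
  have "inj f" using coord by (metis injI vec_eq_iff)
  then obtain a where a: "x = f a" using linear_inj_imp_surj[OF lin] by (metis surjD)
  show ?thesis unfolding a coord by (simp add: f_def)
qed

lemma quadratic_form_in_eigenbasis:
  fixes G B :: "real^'n^'n" and v :: "'n \<Rightarrow> real^'n"
  assumes orth: "\<And>i j. v i \<bullet> (G *v v j) = (if i = j then 1 else 0)"
    and diag: "\<And>i j. v i \<bullet> (B *v v j) = (if i = j then l i else 0)"
  shows "x \<bullet> (B *v x) = (\<Sum>i\<in>UNIV. l i * (v i \<bullet> (G *v x))\<^sup>2)"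
proof -
  define a where "a i = v i \<bullet> (G *v x)" for i
  have x: "x = (\<Sum>i\<in>UNIV. a i *\<^sub>R v i)" unfolding a_def by (rule eigenbasis_expansion[OF orth])
  have "x \<bullet> (B *v x) = (\<Sum>i\<in>UNIV. \<Sum>j\<in>UNIV. a i * (a j * (v i \<bullet> (B *v v j))))"
    unfolding x
    by (simp add: linear_sum[OF matrix_vector_mul_linear] inner_sum_right inner_sum_left
        matrix_vector_mult_scaleR sum_distrib_left mult.assoc mult.left_commute)
       (subst sum.swap, simp add: mult.left_commute)
  also have "\<dots> = (\<Sum>i\<in>UNIV. l i * (a i)\<^sup>2)"
    by (simp add: diag if_distrib power2_eq_square mult_ac cong: if_cong)
  finally show ?thesis unfolding a_def .
qed

text \<open>A dimension count as in the Courant-Fischer principle. The \<open>n - 1\<close> linear conditions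
  \<open>G(v\<^sub>i, x) = 0\<close> for \<open>i < k\<close> and \<open>G'(v'\<^sub>i, x) = 0\<close> for \<open>i > k\<close> have a common solution
  \<open>x \<noteq> 0\<close>. For it \<open>B(x,x) \<ge> l\<^sub>k G(x,x)\<close> and \<open>B'(x,x) \<le> l'\<^sub>k G'(x,x)\<close>. Since only the implication between
  the two quadratic inequalities enters, the metric may change together with the form.\<close>

lemma eigenvalue_comparison:
  fixes G B G' B' :: "real^'n::{finite,linorder}^'n::{finite,linorder}"
  assumes G: "spd G" and B: "transpose B = B" and G': "spd G'" and B': "transpose B' = B'"
    and imp: "\<And>x. eigenvalue_vec (matrix_inv G ** B) $ k * (x \<bullet> (G *v x)) \<le> x \<bullet> (B *v x)
      \<Longrightarrow> s * (x \<bullet> (G' *v x)) \<le> x \<bullet> (B' *v x)"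
  shows "s \<le> eigenvalue_vec (matrix_inv G' ** B') $ k"
proof -
  let ?l = "eigenvalue_vec (matrix_inv G ** B)" and ?l' = "eigenvalue_vec (matrix_inv G' ** B')"
  obtain v where v: "is_eigenvalue_vec (matrix_inv G ** B) ?l"
    "\<And>i j. v i \<bullet> (G *v v j) = (if i = j then 1 else 0)"
    "\<And>i j. v i \<bullet> (B *v v j) = (if i = j then ?l $ i else 0)"
    using spd_pencil_eigenbasis[OF G B] by metis
  obtain v' where v': "is_eigenvalue_vec (matrix_inv G' ** B') ?l'"
    "\<And>i j. v' i \<bullet> (G' *v v' j) = (if i = j then 1 else 0)"
    "\<And>i j. v' i \<bullet> (B' *v v' j) = (if i = j then ?l' $ i else 0)"
    using spd_pencil_eigenbasis[OF G' B'] by metis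
  \<comment> \<open>Component \<open>k\<close> of \<open>L\<close> is constantly \<open>0\<close>, so \<open>L\<close> is not surjective and hence not injective.\<close>
  define L where "L x = (\<chi> i. if i < k then v i \<bullet> (G *v x) else if k < i then v' i \<bullet> (G' *v x) else 0)" for x
  have lin: "linear L"
    unfolding L_def linear_iff
    by (simp add: vec_eq_iff matrix_vector_right_distrib matrix_vector_mult_scaleR inner_right_distrib)
  have "L x $ k = 0" for x by (simp add: L_def)
  then have "axis k 1 \<notin> range L" by (metis axis_nth imageE zero_neq_one)
  then have "\<not> inj L" using linear_inj_imp_surj[OF lin] by blast
  then obtain x where x: "x \<noteq> 0" "L x = 0" using linear_inj_iff_eq_0[OF lin] by blast
  have low: "v i \<bullet> (G *v x) = 0" if "i < k" for i
    using arg_cong[OF x(2), of "\<lambda>y. y $ i"] that by (simp add: L_def)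
  have high: "v' i \<bullet> (G' *v x) = 0" if "k < i" for i
    using arg_cong[OF x(2), of "\<lambda>y. y $ i"] that by (auto simp: L_def split: if_splits)
  have id: "v i \<bullet> (G *v v j) = (if i = j then (\<lambda>_. 1) i else 0)"
    "v' i \<bullet> (G' *v v' j) = (if i = j then (\<lambda>_. 1) i else 0)" for i j
    using v(2) v'(2) by simp_all
  have mono: "?l $ k \<le> ?l $ i" "?l' $ i' \<le> ?l' $ k" if "k \<le> i" "i' \<le> k" for i i'
    using v(1) v'(1) that unfolding is_eigenvalue_vec_def by blast+
  have "?l $ k * (x \<bullet> (G *v x)) = (\<Sum>i\<in>UNIV. ?l $ k * (v i \<bullet> (G *v x))\<^sup>2)"
    unfolding quadratic_form_in_eigenbasis[OF v(2) id(1)] by (simp add: sum_distrib_left)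
  also have "\<dots> \<le> (\<Sum>i\<in>UNIV. ?l $ i * (v i \<bullet> (G *v x))\<^sup>2)"
  proof (rule sum_mono)
    fix i
    show "?l $ k * (v i \<bullet> (G *v x))\<^sup>2 \<le> ?l $ i * (v i \<bullet> (G *v x))\<^sup>2"
      using low[of i] mono(1)[of i k] by (cases "i < k") (auto intro: mult_right_mono)
  qed
  also have "\<dots> = x \<bullet> (B *v x)" by (simp add: quadratic_form_in_eigenbasis[OF v(2,3)])
  finally have "s * (x \<bullet> (G' *v x)) \<le> x \<bullet> (B' *v x)" by (rule imp)
  also have "\<dots> = (\<Sum>i\<in>UNIV. ?l' $ i * (v' i \<bullet> (G' *v x))\<^sup>2)"
    by (rule quadratic_form_in_eigenbasis[OF v'(2,3)])
  also have "\<dots> \<le> (\<Sum>i\<in>UNIV. ?l' $ k * (v' i \<bullet> (G' *v x))\<^sup>2)"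
  proof (rule sum_mono)
    fix i
    show "?l' $ i * (v' i \<bullet> (G' *v x))\<^sup>2 \<le> ?l' $ k * (v' i \<bullet> (G' *v x))\<^sup>2"
      using high[of i] mono(2)[of k i] by (cases "k < i") (auto intro: mult_right_mono)
  qed
  also have "\<dots> = ?l' $ k * (x \<bullet> (G' *v x))"
    unfolding quadratic_form_in_eigenbasis[OF v'(2) id(2)] by (simp add: sum_distrib_left)
  finally have "s * (x \<bullet> (G' *v x)) \<le> ?l' $ k * (x \<bullet> (G' *v x))" .
  moreover have "0 < x \<bullet> (G' *v x)" using G' x(1) by (simp add: spd_def)
  ultimately show ?thesis by (simp add: mult_le_cancel_right)
qed

lemma eigenvalue_vec_nth_mono:
  assumes "spd G" "transpose B = B" "i \<le> j"
  shows "eigenvalue_vec (matrix_inv G ** B) $ i \<le> eigenvalue_vec (matrix_inv G ** B) $ j"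
  using spd_pencil_eigenbasis[OF assms(1,2)] assms(3) unfolding is_eigenvalue_vec_def by metis

lemma eigenvector_exists:
  assumes "spd G" "transpose B = B"
  obtains v where "v \<noteq> 0" "v \<bullet> (B *v v) = eigenvalue_vec (matrix_inv G ** B) $ k * (v \<bullet> (G *v v))"
proof -
  obtain v where v: "\<And>i j. v i \<bullet> (G *v v j) = (if i = j then 1 else 0)"
    "\<And>i j. v i \<bullet> (B *v v j) = (if i = j then eigenvalue_vec (matrix_inv G ** B) $ i else 0)"
    using spd_pencil_eigenbasis[OF assms] by metis
  have "v k \<noteq> 0" using v(1)[of k k] by auto
  then show thesis using that[of "v k"] v[of k k] by simp
qed

lemma quadratic_form_ge_of_eigenvalues_ge:
  assumes "spd G" "transpose B = B" "\<And>i. m \<le> eigenvalue_vec (matrix_inv G ** B) $ i"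
  shows "m * (x \<bullet> (G *v x)) \<le> x \<bullet> (B *v x)"
proof -
  obtain v where v: "\<And>i j. v i \<bullet> (G *v v j) = (if i = j then 1 else 0)"
    "\<And>i j. v i \<bullet> (B *v v j) = (if i = j then eigenvalue_vec (matrix_inv G ** B) $ i else 0)"
    using spd_pencil_eigenbasis[OF assms(1,2)] by metis
  then have id: "v i \<bullet> (G *v v j) = (if i = j then (\<lambda>_. 1) i else 0)" for i j by simp
  show ?thesis
    unfolding quadratic_form_in_eigenbasis[OF v] quadratic_form_in_eigenbasis[OF v(1) id]
    by (simp add: sum_distrib_left assms(3) mult_right_mono sum_mono)
qed

lemma eigenvalue_vec_shift:
  assumes G: "spd G" and B: "transpose B = B"
  shows "eigenvalue_vec (matrix_inv G ** (d *\<^sub>R G + B)) = eigenvalue_vec (matrix_inv G ** B) + d *\<^sub>R ones_vec"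
proof (rule eigenvalue_vec_eq)
  let ?l = "eigenvalue_vec (matrix_inv G ** B)"
  have l: "is_eigenvalue_vec (matrix_inv G ** B) ?l" using spd_pencil_eigenbasis[OF G B] by metis
  have "matrix_inv G ** (d *\<^sub>R G + B) = d *\<^sub>R (matrix_inv G ** G) + matrix_inv G ** B"
    by (simp add: matrix_add_ldistrib matrix_mult_scaleR)
  then have "mat s - matrix_inv G ** (d *\<^sub>R G + B) = mat (s - d) - matrix_inv G ** B" for s
    using spd_matrix_inv(1)[OF G] by (simp add: vec_eq_iff mat_def)
  moreover have "s - (?l + d *\<^sub>R ones_vec) $ i = (s - d) - ?l $ i" for s i
    by (simp add: ones_vec_def)
  ultimately show "is_eigenvalue_vec (matrix_inv G ** (d *\<^sub>R G + B)) (?l + d *\<^sub>R ones_vec)"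
    using l unfolding is_eigenvalue_vec_def by (simp add: ones_vec_def diff_diff_eq add.commute)
qed

text \<open>Coordinate changes act on metric and form by congruence, which conjugates \<open>G\<^sup>-\<^sup>1 B\<close> by \<open>J\<close>.\<close>

lemma eigenvalue_vec_congruence:
  fixes G B J :: "real^'n::{finite,linorder}^'n::{finite,linorder}"
  assumes G: "spd G" and G': "spd (transpose J ** G ** J)"
  shows "eigenvalue_vec (matrix_inv (transpose J ** G ** J) ** (transpose J ** B ** J))
    = eigenvalue_vec (matrix_inv G ** B)"
proof -
  let ?G' = "transpose J ** G ** J" and ?B' = "transpose J ** B ** J"
  have "det (mat s - matrix_inv ?G' ** ?B') = det (mat s - matrix_inv G ** B)" for s
  proof -
    have 1: "H ** (mat s - matrix_inv H ** C) = s *\<^sub>R H - C" if "spd H" for H C :: "real^'n::{finite,linorder}^'n::{finite,linorder}"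
      by (rule spd_mult_mat_minus[OF spd_matrix_inv(2)[OF that]])
    have 2: "s *\<^sub>R ?G' - ?B' = transpose J ** (s *\<^sub>R G - B) ** J"
      by (simp add: matrix_mult_diff matrix_mult_scaleR)
    have "det ?G' * det (mat s - matrix_inv ?G' ** ?B') = det (s *\<^sub>R ?G' - ?B')"
      using 1[OF G'] by (metis det_mul)
    also have "\<dots> = det J * det (s *\<^sub>R G - B) * det J" unfolding 2 by (simp add: det_mul det_transpose)
    also have "\<dots> = det J * (det G * det (mat s - matrix_inv G ** B)) * det J"
      using 1[OF G] by (metis det_mul)
    also have "\<dots> = det ?G' * det (mat s - matrix_inv G ** B)" by (simp add: det_mul det_transpose)
    finally have "det ?G' * det (mat s - matrix_inv ?G' ** ?B') = det ?G' * det (mat s - matrix_inv G ** B)" .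
    moreover have "det ?G' \<noteq> 0"
      using spd_matrix_inv(1)[OF G'] by (metis det_I det_mul mult_zero_right zero_neq_one)
    ultimately show ?thesis by simp
  qed
  then show ?thesis unfolding eigenvalue_vec_def is_eigenvalue_vec_def by simp
qed

lemma quadratic_form_le_of_eigenvalues_le:
  assumes "spd G" "transpose B = B" "\<And>i. eigenvalue_vec (matrix_inv G ** B) $ i \<le> m"
  shows "x \<bullet> (B *v x) \<le> m * (x \<bullet> (G *v x))"
proof -
  obtain v where v: "\<And>i j. v i \<bullet> (G *v v j) = (if i = j then 1 else 0)"
    "\<And>i j. v i \<bullet> (B *v v j) = (if i = j then eigenvalue_vec (matrix_inv G ** B) $ i else 0)"
    using spd_pencil_eigenbasis[OF assms(1,2)] by metis
  then have id: "v i \<bullet> (G *v v j) = (if i = j then (\<lambda>_. 1) i else 0)" for i j by simp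
  show ?thesis
    unfolding quadratic_form_in_eigenbasis[OF v] quadratic_form_in_eigenbasis[OF v(1) id]
    by (simp add: sum_distrib_left assms(3) mult_right_mono sum_mono)
qed

section \<open>Bounds that are stable under perturbation\<close>

lemma norm_matrix_vector_mult_le:
  fixes M :: "real^'n^'m"
  shows "norm (M *v x) \<le> norm M * norm x"
proof -
  have "norm (M *v x) = L2_set (\<lambda>i. M $ i \<bullet> x) UNIV"
    by (simp add: norm_vec_def matrix_vector_mult_def inner_vec_def L2_set_def)
  also have "\<dots> \<le> L2_set (\<lambda>i. norm (M $ i) * norm x) UNIV"
    using Cauchy_Schwarz_ineq2 by (simp add: L2_set_def) (intro real_sqrt_le_mono sum_mono, simp add: abs_le_square_iff[symmetric])
  also have "\<dots> = norm M * norm x" by (simp add: L2_set_left_distrib norm_vec_def[of M])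
  finally show ?thesis .
qed

lemma abs_quadratic_form_le:
  fixes M :: "real^'n^'n"
  shows "\<bar>x \<bullet> (M *v x)\<bar> \<le> norm M * (norm x)\<^sup>2"
proof -
  have "\<bar>x \<bullet> (M *v x)\<bar> \<le> norm x * norm (M *v x)" by (rule Cauchy_Schwarz_ineq2)
  also have "\<dots> \<le> norm x * (norm M * norm x)" by (intro mult_left_mono norm_matrix_vector_mult_le) simp
  finally show ?thesis by (simp add: power2_eq_square mult_ac)
qed

lemma spd_coercive:
  fixes G :: "real^'n^'n"
  assumes "spd G"
  obtains m where "0 < m" "\<And>x. m * (norm x)\<^sup>2 \<le> x \<bullet> (G *v x)"
proof -
  have "continuous_on (sphere 0 1) (\<lambda>x. x \<bullet> (G *v x))" by (intro continuous_intros)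
  moreover have "axis undefined 1 \<in> sphere (0::real^'n) 1" by simp
  ultimately obtain x0 where x0: "norm x0 = 1" "\<And>x. norm x = 1 \<Longrightarrow> x0 \<bullet> (G *v x0) \<le> x \<bullet> (G *v x)"
    using continuous_attains_inf[of "sphere 0 1" "\<lambda>x. x \<bullet> (G *v x)"] compact_sphere by fastforce
  show thesis
  proof
    have "x0 \<noteq> 0" using x0(1) by auto
    then show "0 < x0 \<bullet> (G *v x0)" using assms by (simp add: spd_def)
    fix x :: "real^'n"
    show "x0 \<bullet> (G *v x0) * (norm x)\<^sup>2 \<le> x \<bullet> (G *v x)"
    proof (cases "x = 0")
      case False
      then have "x0 \<bullet> (G *v x0) \<le> (x /\<^sub>R norm x) \<bullet> (G *v (x /\<^sub>R norm x))" by (intro x0(2)) simp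
      also have "\<dots> = (x \<bullet> (G *v x)) / (norm x)\<^sup>2"
        by (simp add: matrix_vector_mult_scaleR power2_eq_square field_simps)
      finally show ?thesis using False by (simp add: field_simps)
    qed simp
  qed
qed

text \<open>All errors are at most \<open>(|l| + 1) \<epsilon> |v|\<^sup>2\<close>, and the loss of \<open>\<eta>\<close> in the factor of \<open>G(v,v)\<close> pays for them
  because \<open>G\<close> is bounded below by a positive multiple of \<open>|v|\<^sup>2\<close> near \<open>G0\<close>.\<close>

lemma pencil_lower_bound_stable:
  fixes G0 :: "real^'n^'n"
  assumes "spd G0" "0 < \<eta>"
  obtains \<epsilon> where "0 < \<epsilon>"
    "\<And>G W W0 l v. norm (G - G0) < \<epsilon> \<Longrightarrow> norm (W - W0) < \<epsilon> \<Longrightarrow> \<bar>l\<bar> \<le> L \<Longrightarrow>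
       l * (v \<bullet> (G0 *v v)) \<le> v \<bullet> (W0 *v v) \<Longrightarrow> (l - \<eta>) * (v \<bullet> (G *v v)) \<le> v \<bullet> (W *v v)"
proof -
  obtain m where m: "0 < m" "\<And>x. m * (norm x)\<^sup>2 \<le> x \<bullet> (G0 *v x)" using spd_coercive[OF \<open>spd G0\<close>] by blast
  define N where "N = \<bar>L\<bar> + 1"
  have N: "0 < N" by (simp add: N_def)
  define \<epsilon> where "\<epsilon> = min (m / 2) (\<eta> * (m / 2) / N)"
  have \<epsilon>: "0 < \<epsilon>" "\<epsilon> \<le> m / 2" "N * \<epsilon> \<le> \<eta> * (m / 2)"
  proof -
    show "0 < \<epsilon>" "\<epsilon> \<le> m / 2" using m(1) \<open>0 < \<eta>\<close> N by (simp_all add: \<epsilon>_def)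
    have "\<epsilon> \<le> \<eta> * (m / 2) / N" by (simp add: \<epsilon>_def)
    then show "N * \<epsilon> \<le> \<eta> * (m / 2)" using N by (simp add: field_simps)
  qed
  have "(l - \<eta>) * (v \<bullet> (G *v v)) \<le> v \<bullet> (W *v v)"
    if G: "norm (G - G0) < \<epsilon>" and W: "norm (W - W0) < \<epsilon>" and l: "\<bar>l\<bar> \<le> L"
      and le: "l * (v \<bullet> (G0 *v v)) \<le> v \<bullet> (W0 *v v)" for G W W0 :: "real^'n^'n" and l v
  proof -
    define n where "n = (norm v)\<^sup>2"
    have n: "0 \<le> n" by (simp add: n_def)
    have "\<bar>v \<bullet> ((G - G0) *v v)\<bar> \<le> \<epsilon> * n"
      unfolding n_def by (rule order_trans[OF abs_quadratic_form_le]) (use G in \<open>simp add: mult_right_mono\<close>)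
    then have g: "\<bar>v \<bullet> (G *v v) - v \<bullet> (G0 *v v)\<bar> \<le> \<epsilon> * n"
      by (simp add: matrix_vector_mult_diff_rdistrib inner_diff_right)
    have "\<bar>v \<bullet> ((W - W0) *v v)\<bar> \<le> \<epsilon> * n"
      unfolding n_def by (rule order_trans[OF abs_quadratic_form_le]) (use W in \<open>simp add: mult_right_mono\<close>)
    then have w: "v \<bullet> (W0 *v v) - \<epsilon> * n \<le> v \<bullet> (W *v v)"
      by (simp add: matrix_vector_mult_diff_rdistrib inner_diff_right)
    have "\<epsilon> * n \<le> m / 2 * n" using \<epsilon>(2) n by (rule mult_right_mono)
    then have low: "m / 2 * n \<le> v \<bullet> (G *v v)" using g m(2)[of v] by (simp add: n_def[symmetric])
    have "\<bar>l * (v \<bullet> (G *v v) - v \<bullet> (G0 *v v))\<bar> \<le> L * (\<epsilon> * n)"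
      unfolding abs_mult using l g by (intro mult_mono) auto
    then have "l * (v \<bullet> (G *v v)) - L * (\<epsilon> * n) \<le> l * (v \<bullet> (G0 *v v))"
      by (simp add: algebra_simps)
    moreover have "L * (\<epsilon> * n) + \<epsilon> * n \<le> \<eta> * (v \<bullet> (G *v v))"
    proof -
      have "L * (\<epsilon> * n) + \<epsilon> * n \<le> N * (\<epsilon> * n)"
        using \<epsilon>(1) n by (simp add: N_def distrib_right mult_right_mono)
      also have "\<dots> \<le> \<eta> * (m / 2) * n" using mult_right_mono[OF \<epsilon>(3) n] by (simp only: mult.assoc)
      also have "\<dots> \<le> \<eta> * (v \<bullet> (G *v v))" using low \<open>0 < \<eta>\<close> by (simp add: mult.assoc)
      finally show ?thesis .
    qed
    ultimately show ?thesis using le w by (simp add: left_diff_distrib)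
  qed
  then show thesis using that \<epsilon>(1) by blast
qed

text \<open>Cramer's rule expresses the entries as quotients of determinants.\<close>

lemma continuous_on_matrix_inv:
  fixes G :: "'b::topological_space \<Rightarrow> real^'n^'n"
  assumes "continuous_on S G" "\<And>y. y \<in> S \<Longrightarrow> spd (G y)"
  shows "continuous_on S (\<lambda>y. matrix_inv (G y))"
proof -
  have det: "det (G y) \<noteq> 0" if "y \<in> S" for y
    using spd_matrix_inv(1)[OF assms(2)[OF that]] by (metis det_I det_mul mult_zero_right zero_neq_one)
  have cramer_inv: "matrix_inv (G y) $ j $ k
      = det (\<chi> a b. if b = j then axis k 1 $ a else G y $ a $ b) / det (G y)" if "y \<in> S" for y j k
  proof -
    have "G y *v (matrix_inv (G y) *v axis k 1) = axis k 1"
      by (simp add: matrix_vector_mul_assoc spd_matrix_inv[OF assms(2)[OF that]])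
    then have "matrix_inv (G y) *v axis k 1 = (\<chi> j. det (\<chi> a b. if b = j then axis k 1 $ a else G y $ a $ b) / det (G y))"
      using cramer[OF det[OF that]] by blast
    moreover have "(matrix_inv (G y) *v axis k 1) $ j = matrix_inv (G y) $ j $ k"
      by (simp add: matrix_vector_mult_basis column_def)
    ultimately show ?thesis by simp
  qed
  have entry: "continuous_on S (\<lambda>y. G y $ a $ b)" for a b
    using assms(1) by (intro continuous_intros)
  have cdet: "continuous_on S (\<lambda>y. det (M y))" if "\<And>a b. continuous_on S (\<lambda>y. M y $ a $ b)" for M :: "'b \<Rightarrow> real^'n^'n"
    unfolding det_def by (intro continuous_intros that)
  have "continuous_on S (\<lambda>y. matrix_inv (G y) $ j $ k)" for j k
  proof -
    have "continuous_on S (\<lambda>y. det (\<chi> a b. if b = j then axis k 1 $ a else G y $ a $ b) / det (G y))"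
    proof (intro continuous_on_divide cdet entry ballI det)
      show "continuous_on S (\<lambda>y. (\<chi> a b. if b = j then axis k 1 $ a else G y $ a $ b) $ a $ b)" for a b
        using entry by (cases "b = j") simp_all
    qed auto
    then show ?thesis by (rule continuous_on_eq) (simp add: cramer_inv)
  qed
  then have "continuous_on S (\<lambda>y. \<chi> j k. matrix_inv (G y) $ j $ k)"
    by (intro continuous_on_vec_lambda)
  then show ?thesis by simp
qed

text \<open>For a covector with coordinates \<open>G w\<close>, the square root is its norm with respect to the
  metric \<open>G\<close>; so covectors that are small in the metric have small coordinates, uniformly for \<open>G\<close> near \<open>G0\<close>.\<close>

lemma dual_vector_bound:
  fixes G0 :: "real^'n^'n"
  assumes "spd G0"
  obtains \<epsilon> K where "0 < \<epsilon>" "0 < K"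
    "\<And>G w. norm (G - G0) < \<epsilon> \<Longrightarrow> norm (G *v w) \<le> K * sqrt (w \<bullet> (G *v w))"
proof -
  obtain m where m: "0 < m" "\<And>x. m * (norm x)\<^sup>2 \<le> x \<bullet> (G0 *v x)" using spd_coercive[OF assms] by blast
  define K where "K = (norm G0 + m / 2) * sqrt (2 / m)"
  have "norm (G *v w) \<le> K * sqrt (w \<bullet> (G *v w))" if G: "norm (G - G0) < m / 2" for G :: "real^'n^'n" and w
  proof -
    have "\<bar>w \<bullet> ((G - G0) *v w)\<bar> \<le> m / 2 * (norm w)\<^sup>2"
      by (rule order_trans[OF abs_quadratic_form_le], rule mult_right_mono) (use G in auto)
    then have "\<bar>w \<bullet> (G *v w) - w \<bullet> (G0 *v w)\<bar> \<le> m / 2 * (norm w)\<^sup>2"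
      by (simp add: matrix_vector_mult_diff_rdistrib inner_diff_right)
    then have "m / 2 * (norm w)\<^sup>2 \<le> w \<bullet> (G *v w)" using m(2)[of w] by linarith
    then have "(norm w)\<^sup>2 \<le> 2 / m * (w \<bullet> (G *v w))" using m(1) by (simp add: field_simps)
    then have nw: "norm w \<le> sqrt (2 / m) * sqrt (w \<bullet> (G *v w))"
      unfolding real_sqrt_mult[symmetric] by (rule real_le_rsqrt)
    have "norm G \<le> norm G0 + m / 2" using G norm_triangle_sub[of G G0] by linarith
    then have "norm (G *v w) \<le> (norm G0 + m / 2) * norm w"
      by (intro order_trans[OF norm_matrix_vector_mult_le]) (simp add: mult_right_mono)
    also have "\<dots> \<le> (norm G0 + m / 2) * (sqrt (2 / m) * sqrt (w \<bullet> (G *v w)))"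
      using nw m(1) by (intro mult_left_mono) auto
    finally show ?thesis by (simp add: K_def mult.assoc)
  qed
  moreover have "0 < m / 2" "0 < K"
    using m(1) by (simp_all add: K_def add_nonneg_pos)
  ultimately show thesis using that by blast
qed

text \<open>The heart of the estimate, for the matrices in a chart: \<open>G0\<close> and \<open>W0\<close> are the metric and the
  form \<open>A(d ul) + \<nabla>\<^sup>2ul\<close> at a fixed point, \<open>G\<close> and \<open>W\<close> their perturbations at a neighbouring
  point, and \<open>H\<close> is the Hessian of \<open>u - ul\<close> there. A lower bound for \<open>H\<close> and an upper bound for \<open>\<sigma>\<^sub>p\<close> of \<open>W + H\<close>
  together bound \<open>H\<close> from above.\<close>

lemma top_eigenvalue_bound:
  fixes G0 W0 :: "real^'n::{finite,linorder}^'n::{finite,linorder}"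
  assumes G0: "spd G0" and W0: "transpose W0 = W0" and "1 \<le> p"
    and \<Gamma>: "eigenvalue_vec (matrix_inv G0 ** W0) + R *\<^sub>R last_unit_vec \<in> Gamma_cone p"
  obtains \<epsilon> \<delta> T where "0 < \<epsilon>" "0 < \<delta>"
    "\<And>G W H i. spd G \<Longrightarrow> transpose W = W \<Longrightarrow> transpose H = H \<Longrightarrow> norm (G - G0) < \<epsilon> \<Longrightarrow> norm (W - W0) < \<epsilon> \<Longrightarrow>
       (\<And>i. - \<delta> \<le> eigenvalue_vec (matrix_inv G ** H) $ i) \<Longrightarrow>
       sigma p (eigenvalue_vec (matrix_inv G ** (W + H))) \<le> C \<Longrightarrow>
       eigenvalue_vec (matrix_inv G ** H) $ i \<le> T"
proof -
  define l where "l = eigenvalue_vec (matrix_inv G0 ** W0)"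
  define m where "m = Max (UNIV :: 'n set)"
  define n where "n = Min (UNIV :: 'n set)"
  have m: "i \<le> m" and n: "n \<le> i" for i by (simp_all add: m_def n_def)
  \<comment> \<open>\<open>\<Gamma>\<^sub>p\<close> is open, so all eigenvalues may be lowered a little; one \<open>\<eta>\<close> is
    spent on the perturbation of \<open>W\<close> and \<open>G\<close>, the other on the lower bound \<open>- \<eta>\<close> for \<open>H\<close>.\<close>
  let ?f = "\<lambda>s. l + R *\<^sub>R last_unit_vec - s *\<^sub>R ones_vec"
  have "open (?f -` Gamma_cone p)"
    by (intro continuous_open_vimage open_Gamma_cone) (intro continuous_intros)
  moreover have "0 \<in> ?f -` Gamma_cone p" using \<Gamma> by (simp add: l_def)
  ultimately obtain e where e: "0 < e" "\<And>s. dist s 0 < e \<Longrightarrow> ?f s \<in> Gamma_cone p"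
    unfolding open_dist by blast
  define \<eta> where "\<eta> = e / 4"
  have \<eta>: "0 < \<eta>" "?f (2 * \<eta>) \<in> Gamma_cone p" using e by (auto simp: \<eta>_def dist_real_def)
  define \<kappa> where "\<kappa> = l - (2 * \<eta>) *\<^sub>R ones_vec"
  have "\<kappa> + R *\<^sub>R axis m 1 \<in> Gamma_cone p"
    using \<eta>(2) by (simp add: \<kappa>_def m_def last_unit_vec_def algebra_simps)
  then obtain T where T: "\<And>\<mu>. (\<And>i. \<kappa> $ i \<le> \<mu> $ i) \<Longrightarrow> sigma p \<mu> \<le> C \<Longrightarrow> \<mu> $ m \<le> T"
    using sigma_bound_controls_entry[OF \<open>1 \<le> p\<close>] by metis
  obtain \<epsilon> where \<epsilon>: "0 < \<epsilon>"
    "\<And>G W W0 s v. norm (G - G0) < \<epsilon> \<Longrightarrow> norm (W - W0) < \<epsilon> \<Longrightarrow> \<bar>s\<bar> \<le> norm l \<Longrightarrow>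
       s * (v \<bullet> (G0 *v v)) \<le> v \<bullet> (W0 *v v) \<Longrightarrow> (s - \<eta>) * (v \<bullet> (G *v v)) \<le> v \<bullet> (W *v v)"
    using pencil_lower_bound_stable[OF G0 \<eta>(1)] by metis
  have lk: "\<bar>l $ k\<bar> \<le> norm l" for k by (rule component_le_norm_cart)
  have "eigenvalue_vec (matrix_inv G ** H) $ i \<le> T + \<eta> - l $ n"
    if G: "spd G" and W: "transpose W = W" and H: "transpose H = H"
      and near: "norm (G - G0) < \<epsilon>" "norm (W - W0) < \<epsilon>"
      and low: "\<And>i. - \<eta> \<le> eigenvalue_vec (matrix_inv G ** H) $ i"
      and sig: "sigma p (eigenvalue_vec (matrix_inv G ** (W + H))) \<le> C" for G W H i
  proof -
    let ?t = "eigenvalue_vec (matrix_inv G ** H)" and ?q = "eigenvalue_vec (matrix_inv G ** (W + H))"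
    have WH: "transpose (W + H) = W + H" using W H by (simp add: transpose_def vec_eq_iff)
    have form: "x \<bullet> ((W + H) *v x) = x \<bullet> (W *v x) + x \<bullet> (H *v x)" for x
      by (simp add: matrix_vector_mult_add_rdistrib inner_add_right)
    have Hge: "- \<eta> * (x \<bullet> (G *v x)) \<le> x \<bullet> (H *v x)" for x
      by (rule quadratic_form_ge_of_eigenvalues_ge[OF G H low])
    have "l $ k - 2 * \<eta> \<le> ?q $ k" for k
    proof (rule eigenvalue_comparison[OF G0 W0 G WH])
      fix x assume "eigenvalue_vec (matrix_inv G0 ** W0) $ k * (x \<bullet> (G0 *v x)) \<le> x \<bullet> (W0 *v x)"
      then have "(l $ k - \<eta>) * (x \<bullet> (G *v x)) \<le> x \<bullet> (W *v x)"
        by (intro \<epsilon>(2)[OF near lk]) (simp add: l_def)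
      then show "(l $ k - 2 * \<eta>) * (x \<bullet> (G *v x)) \<le> x \<bullet> ((W + H) *v x)"
        using Hge[of x] unfolding form by (simp add: algebra_simps)
    qed
    then have "?q $ m \<le> T" using sig by (intro T) (simp_all add: \<kappa>_def ones_vec_def)
    moreover have "l $ n - \<eta> + ?t $ m \<le> ?q $ m"
    proof -
      obtain v where v: "v \<noteq> 0" "v \<bullet> (H *v v) = ?t $ m * (v \<bullet> (G *v v))"
        using eigenvector_exists[OF G H] by metis
      have "l $ n * (v \<bullet> (G0 *v v)) \<le> v \<bullet> (W0 *v v)"
        using quadratic_form_ge_of_eigenvalues_ge[OF G0 W0, of "l $ n" v]
          eigenvalue_vec_nth_mono[OF G0 W0 n] by (simp add: l_def)
      then have "(l $ n - \<eta>) * (v \<bullet> (G *v v)) \<le> v \<bullet> (W *v v)" by (rule \<epsilon>(2)[OF near lk])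
      then have 1: "(l $ n - \<eta> + ?t $ m) * (v \<bullet> (G *v v)) \<le> v \<bullet> ((W + H) *v v)"
        using v(2) by (simp add: form distrib_right)
      have "v \<bullet> ((W + H) *v v) \<le> ?q $ m * (v \<bullet> (G *v v))"
        by (rule quadratic_form_le_of_eigenvalues_le[OF G WH]) (rule eigenvalue_vec_nth_mono[OF G WH m])
      with 1 have "(l $ n - \<eta> + ?t $ m) * (v \<bullet> (G *v v)) \<le> ?q $ m * (v \<bullet> (G *v v))" by simp
      moreover have "0 < v \<bullet> (G *v v)" using G v(1) by (simp add: spd_def)
      ultimately show ?thesis by (simp add: mult_le_cancel_right)
    qed
    ultimately show ?thesis using eigenvalue_vec_nth_mono[OF G H m[of i]] by simp
  qed
  then show thesis using that \<epsilon>(1) \<eta>(1) by blast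
qed

section \<open>Derivatives, and the symmetry of second derivatives\<close>

lemma Ck_on_cong:
  assumes "open S" "\<And>x. x \<in> S \<Longrightarrow> f x = g x" "Ck_on k f S"
  shows "Ck_on k g S"
  using assms(2,3)
proof (induction k arbitrary: f g)
  case 0
  then show ?case by (simp cong: continuous_on_cong)
next
  case (Suc k)
  have D: "frechet_derivative f (at x) = frechet_derivative g (at x)" "g differentiable (at x)" if "x \<in> S" for x
  proof -
    have "f differentiable (at x)" using Suc.prems that by simp
    then have 1: "(f has_derivative frechet_derivative f (at x)) (at x)" by (simp add: frechet_derivative_works)
    have "(g has_derivative frechet_derivative f (at x)) (at x)"
      by (rule has_derivative_transform_within_open[OF 1 \<open>open S\<close> that]) (rule Suc.prems)
    then show "frechet_derivative f (at x) = frechet_derivative g (at x)" "g differentiable (at x)"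
      by (auto simp: frechet_derivative_at differentiable_def)
  qed
  have "Ck_on k (\<lambda>x. frechet_derivative g (at x) v) S" for v
    by (rule Suc.IH[of "\<lambda>x. frechet_derivative f (at x) v"]) (use D Suc.prems in auto)
  then show ?case using D by simp
qed

lemma Ck_on_imp_continuous_on: "Ck_on k f S \<Longrightarrow> continuous_on S f"
  by (cases k)
    (auto simp: continuous_on_eq_continuous_within intro: continuous_at_imp_continuous_at_within
      differentiable_imp_continuous_within)

lemma frechet_derivative_linear_compose:
  assumes "bounded_linear L" "f differentiable (at x)"
  shows "frechet_derivative (\<lambda>x. L (f x)) (at x) = (\<lambda>v. L (frechet_derivative f (at x) v))"
    "(\<lambda>x. L (f x)) differentiable (at x)"
proof -
  have "((\<lambda>x. L (f x)) has_derivative (\<lambda>v. L (frechet_derivative f (at x) v))) (at x)"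
    using assms bounded_linear.has_derivative frechet_derivative_works by blast
  then show "frechet_derivative (\<lambda>x. L (f x)) (at x) = (\<lambda>v. L (frechet_derivative f (at x) v))"
    "(\<lambda>x. L (f x)) differentiable (at x)"
    by (auto simp: frechet_derivative_at[symmetric] differentiable_def)
qed

lemma Ck_on_linear_compose:
  assumes "bounded_linear L" "open S" "Ck_on k f S"
  shows "Ck_on k (\<lambda>x. L (f x)) S"
  using assms(3)
proof (induction k arbitrary: f)
  case 0
  then show ?case using assms(1) bounded_linear.continuous_on by auto
next
  case (Suc k)
  have "Ck_on k (\<lambda>x. frechet_derivative (\<lambda>x. L (f x)) (at x) v) S" for v
    by (rule Ck_on_cong[OF assms(2) _ Suc.IH[of "\<lambda>x. frechet_derivative f (at x) v"]])
      (use Suc.prems in \<open>simp_all add: frechet_derivative_linear_compose[OF assms(1)]\<close>)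
  then show ?case using Suc.prems by (auto intro: frechet_derivative_linear_compose(2)[OF assms(1)])
qed

lemma Ck_on_diff:
  assumes "open S" "Ck_on k f S" "Ck_on k g S"
  shows "Ck_on k (\<lambda>x. f x - g x) S"
  using assms(2,3)
proof (induction k arbitrary: f g)
  case (Suc k)
  have df: "(f has_derivative frechet_derivative f (at x)) (at x)"
    and dg: "(g has_derivative frechet_derivative g (at x)) (at x)" if "x \<in> S" for x
    using Suc.prems that by (simp_all add: frechet_derivative_works)
  have D: "((\<lambda>x. f x - g x) has_derivative (\<lambda>v. frechet_derivative f (at x) v - frechet_derivative g (at x) v)) (at x)"
    if "x \<in> S" for x
    using df[OF that] dg[OF that] by (rule has_derivative_diff)
  have "Ck_on k (\<lambda>x. frechet_derivative (\<lambda>x. f x - g x) (at x) v) S" for v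
  proof (rule Ck_on_cong[OF assms(1)])
    show "Ck_on k (\<lambda>x. frechet_derivative f (at x) v - frechet_derivative g (at x) v) S"
      using Suc.prems by (intro Suc.IH) auto
    show "frechet_derivative f (at x) v - frechet_derivative g (at x) v = frechet_derivative (\<lambda>x. f x - g x) (at x) v"
      if "x \<in> S" for x
      using fun_cong[OF frechet_derivative_at[OF D[OF that]], of v] .
  qed
  then show ?case using D unfolding Ck_on.simps differentiable_def by blast
qed (auto intro: continuous_intros)

text \<open>Reduces the mean value theorem in direction \<open>a\<close> to one real variable.\<close>

lemma has_real_derivative_along_line:
  fixes f :: "'v::euclidean_space \<Rightarrow> real"
  assumes "f differentiable (at (y + s *\<^sub>R a))"
  shows "((\<lambda>s. f (y + s *\<^sub>R a)) has_real_derivative frechet_derivative f (at (y + s *\<^sub>R a)) a) (at s)"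
proof -
  let ?D = "frechet_derivative f (at (y + s *\<^sub>R a))"
  have D: "(f has_derivative ?D) (at (y + s *\<^sub>R a))" using assms frechet_derivative_works by blast
  have "((\<lambda>s. y + s *\<^sub>R a) has_derivative (\<lambda>h. h *\<^sub>R a)) (at s)"
    by (auto intro!: derivative_eq_intros)
  from has_derivative_compose[OF this D]
  have "((\<lambda>s. f (y + s *\<^sub>R a)) has_derivative (\<lambda>h. ?D (h *\<^sub>R a))) (at s)" .
  moreover have "?D (h *\<^sub>R a) = ?D a * h" for h
    using has_derivative_linear[OF D] by (simp add: linear_cmul)
  ultimately show ?thesis by (simp add: has_field_derivative_def)
qed

text \<open>The mean value theorem is applied in direction \<open>a\<close> to the difference of \<open>f\<close> in direction \<open>b\<close>, and then
  in direction \<open>b\<close> to the derivative in direction \<open>a\<close>.\<close>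

lemma second_difference_mean_value:
  fixes f :: "'v::euclidean_space \<Rightarrow> real"
  assumes "Ck_on 2 f S" "0 < h"
    and "\<And>s t. 0 \<le> s \<Longrightarrow> s \<le> h \<Longrightarrow> 0 \<le> t \<Longrightarrow> t \<le> h \<Longrightarrow> y + s *\<^sub>R a + t *\<^sub>R b \<in> S"
  shows "\<exists>s\<in>{0..h}. \<exists>t\<in>{0..h}. f (y + h *\<^sub>R a + h *\<^sub>R b) - f (y + h *\<^sub>R a) - f (y + h *\<^sub>R b) + f y
    = h * (h * frechet_derivative (\<lambda>x. frechet_derivative f (at x) a) (at (y + s *\<^sub>R a + t *\<^sub>R b)) b)"
proof -
  have df: "f differentiable (at x)" "(\<lambda>x. frechet_derivative f (at x) v) differentiable (at x)" if "x \<in> S" for x v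
    using assms(1) that by (simp_all add: numeral_2_eq_2)
  let ?p = "\<lambda>s. f ((y + h *\<^sub>R b) + s *\<^sub>R a) - f (y + s *\<^sub>R a)"
  let ?p' = "\<lambda>s. frechet_derivative f (at ((y + h *\<^sub>R b) + s *\<^sub>R a)) a - frechet_derivative f (at (y + s *\<^sub>R a)) a"
  have "DERIV ?p s :> ?p' s" if "0 \<le> s" "s \<le> h" for s
    by (intro DERIV_diff has_real_derivative_along_line df)
      (use assms(3)[of s h] assms(3)[of s 0] that \<open>0 < h\<close> in \<open>simp_all add: algebra_simps\<close>)
  from MVT2[OF \<open>0 < h\<close> this] obtain s where s: "0 < s" "s < h" "?p h - ?p 0 = (h - 0) * ?p' s" by blast
  let ?q = "\<lambda>t. frechet_derivative f (at ((y + s *\<^sub>R a) + t *\<^sub>R b)) a"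
  let ?q' = "\<lambda>t. frechet_derivative (\<lambda>x. frechet_derivative f (at x) a) (at ((y + s *\<^sub>R a) + t *\<^sub>R b)) b"
  have "DERIV ?q t :> ?q' t" if "0 \<le> t" "t \<le> h" for t
    by (intro has_real_derivative_along_line df) (use assms(3)[of s t] that s in simp)
  from MVT2[OF \<open>0 < h\<close> this] obtain t where t: "0 < t" "t < h" "?q h - ?q 0 = (h - 0) * ?q' t" by blast
  have "?q h - ?q 0 = ?p' s" by (simp add: algebra_simps)
  then have "?p h - ?p 0 = h * (h * ?q' t)" using s(3) t(3) by simp
  moreover have "?p h - ?p 0 = f (y + h *\<^sub>R a + h *\<^sub>R b) - f (y + h *\<^sub>R a) - f (y + h *\<^sub>R b) + f y"
    by (simp add: algebra_simps)
  ultimately show ?thesis using s t by (intro bexI[of _ s] bexI[of _ t]) auto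
qed

text \<open>The second difference is symmetric in \<open>a\<close> and \<open>b\<close>, so a mixed derivative in one order
  at some nearby point equals the mixed derivative in the other order at another nearby point; continuity does the
  rest.\<close>

lemma second_derivative_symmetric:
  fixes f :: "'v::euclidean_space \<Rightarrow> real"
  assumes f: "Ck_on 2 f S" and "open S" "y \<in> S"
  shows "frechet_derivative (\<lambda>x. frechet_derivative f (at x) a) (at y) b
    = frechet_derivative (\<lambda>x. frechet_derivative f (at x) b) (at y) a"
proof (rule ccontr)
  define D where "D a b x = frechet_derivative (\<lambda>x. frechet_derivative f (at x) a) (at x) b" for a b x
  assume "\<not> ?thesis"
  then have e: "0 < \<bar>D a b y - D b a y\<bar> / 2" by (simp add: D_def)
  have "continuous_on S (D a b)" for a b using f by (simp add: numeral_2_eq_2 D_def)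
  then have "isCont (D a b) y" for a b
    using \<open>open S\<close> \<open>y \<in> S\<close> by (simp add: continuous_on_eq_continuous_at)
  then have lim: "(D a b \<longlongrightarrow> D a b y) (nhds y)" for a b
    by (simp add: isCont_def tendsto_at_iff_tendsto_nhds)
  have ev: "\<forall>\<^sub>F x in nhds y. dist (D a b x) (D a b y) < \<bar>D a b y - D b a y\<bar> / 2"
    "\<forall>\<^sub>F x in nhds y. dist (D b a x) (D b a y) < \<bar>D a b y - D b a y\<bar> / 2"
    "\<forall>\<^sub>F x in nhds y. x \<in> S"
    by (rule tendstoD[OF lim e] eventually_nhds_in_open[OF \<open>open S\<close> \<open>y \<in> S\<close>])+
  from eventually_conj[OF eventually_conj[OF ev(1) ev(2)] ev(3)]
  obtain r where r: "r > 0" "\<And>x. dist x y < r \<Longrightarrow> dist (D a b x) (D a b y) < \<bar>D a b y - D b a y\<bar> / 2 \<and>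
      dist (D b a x) (D b a y) < \<bar>D a b y - D b a y\<bar> / 2 \<and> x \<in> S"
    unfolding eventually_nhds_metric by auto
  define N where "N = norm a + norm b + 1"
  define h where "h = r / (2 * N)"
  have den: "0 < N" using norm_ge_zero[of a] norm_ge_zero[of b] unfolding N_def by linarith
  have h: "h > 0" using r(1) den by (simp add: h_def)
  have near: "dist (y + s *\<^sub>R a + t *\<^sub>R b) y < r" if "0 \<le> s" "s \<le> h" "0 \<le> t" "t \<le> h" for s t
  proof -
    have "dist (y + s *\<^sub>R a + t *\<^sub>R b) y \<le> norm (s *\<^sub>R a) + norm (t *\<^sub>R b)"
      by (simp add: dist_norm add.assoc norm_triangle_ineq del: norm_scaleR)
    also have "\<dots> \<le> h * norm a + h * norm b" using that by (simp add: add_mono mult_right_mono)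
    also have "\<dots> \<le> h * N" using h by (simp add: N_def algebra_simps)
    also have "\<dots> = r / 2" using den by (simp add: h_def)
    finally show ?thesis using r(1) by simp
  qed
  have near': "dist (y + s *\<^sub>R b + t *\<^sub>R a) y < r" if "0 \<le> s" "s \<le> h" "0 \<le> t" "t \<le> h" for s t
    using near[of t s] that by (simp add: add_ac)
  obtain s t where st: "0 \<le> s" "s \<le> h" "0 \<le> t" "t \<le> h"
     "f (y + h *\<^sub>R a + h *\<^sub>R b) - f (y + h *\<^sub>R a) - f (y + h *\<^sub>R b) + f y = h * (h * D a b (y + s *\<^sub>R a + t *\<^sub>R b))"
    using second_difference_mean_value[OF f h, of y a b] r(2)[OF near] unfolding D_def by (meson atLeastAtMost_iff)
  obtain s' t' where st': "0 \<le> s'" "s' \<le> h" "0 \<le> t'" "t' \<le> h"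
     "f (y + h *\<^sub>R b + h *\<^sub>R a) - f (y + h *\<^sub>R b) - f (y + h *\<^sub>R a) + f y = h * (h * D b a (y + s' *\<^sub>R b + t' *\<^sub>R a))"
    using second_difference_mean_value[OF f h, of y b a] r(2)[OF near'] unfolding D_def by (meson atLeastAtMost_iff)
  have "h * (h * D a b (y + s *\<^sub>R a + t *\<^sub>R b)) = h * (h * D b a (y + s' *\<^sub>R b + t' *\<^sub>R a))"
    unfolding st(5)[symmetric] st'(5)[symmetric] by (simp add: algebra_simps)
  then have "D a b (y + s *\<^sub>R a + t *\<^sub>R b) = D b a (y + s' *\<^sub>R b + t' *\<^sub>R a)" using h by simp
  moreover have "\<bar>D a b (y + s *\<^sub>R a + t *\<^sub>R b) - D a b y\<bar> < \<bar>D a b y - D b a y\<bar> / 2"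
    using r(2)[OF near[OF st(1-4)]] by (simp add: dist_real_def)
  moreover have "\<bar>D b a (y + s' *\<^sub>R b + t' *\<^sub>R a) - D b a y\<bar> < \<bar>D a b y - D b a y\<bar> / 2"
    using r(2)[OF near'[OF st'(1-4)]] by (simp add: dist_real_def)
  ultimately show False by (simp add: abs_if split: if_splits)
qed

lemma frechet_derivative_eq_sum_partial:
  fixes f :: "real^'n \<Rightarrow> real"
  assumes "f differentiable (at x)"
  shows "frechet_derivative f (at x) v = (\<Sum>a\<in>UNIV. partial a f x * v $ a)"
proof -
  have lin: "linear (frechet_derivative f (at x))"
    using assms by (simp add: linear_frechet_derivative)
  have "v = (\<Sum>a\<in>UNIV. v $ a *\<^sub>R axis a 1)"
    by (simp add: vec_eq_iff axis_def if_distrib cong: if_cong)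
  from arg_cong[OF this, of "frechet_derivative f (at x)"]
  have "frechet_derivative f (at x) v = (\<Sum>a\<in>UNIV. v $ a *\<^sub>R frechet_derivative f (at x) (axis a 1))"
    by (simp only: linear_sum[OF lin] linear_cmul[OF lin])
  then show ?thesis by (simp add: partial_def mult.commute)
qed

lemma partial_eqI: "(f has_derivative f') (at x) \<Longrightarrow> partial j f x = f' (axis j 1)"
  unfolding partial_def using frechet_derivative_at by metis

lemma partial_cong_open:
  assumes "open S" "x \<in> S" "\<And>y. y \<in> S \<Longrightarrow> f y = g y" "f differentiable (at x)"
  shows "partial j f x = partial j g x"
  unfolding partial_def
  using frechet_derivative_transform_within_open[of f x S g] assms by simp

lemma partial_mult:
  assumes "f differentiable (at x)" "g differentiable (at x)"
  shows "partial j (\<lambda>y. f y * g y) x = partial j f x * g x + f x * partial j g x"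
proof -
  have "((\<lambda>y. f y * g y) has_derivative (\<lambda>v. f x * frechet_derivative g (at x) v + frechet_derivative f (at x) v * g x)) (at x)"
    using assms by (intro has_derivative_mult) (simp_all add: frechet_derivative_works)
  from partial_eqI[OF this, of j] show ?thesis by (simp add: partial_def)
qed

lemma partial_sum:
  assumes "finite I" "\<And>i. i \<in> I \<Longrightarrow> f i differentiable (at x)"
  shows "partial j (\<lambda>y. \<Sum>i\<in>I. f i y) x = (\<Sum>i\<in>I. partial j (f i) x)"
proof -
  have "((\<lambda>y. \<Sum>i\<in>I. f i y) has_derivative (\<lambda>v. \<Sum>i\<in>I. frechet_derivative (f i) (at x) v)) (at x)"
    using assms by (intro has_derivative_sum) (simp add: frechet_derivative_works)
  from partial_eqI[OF this, of j] show ?thesis by (simp add: partial_def)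
qed

lemma partial_diff:
  assumes "f differentiable (at x)" "g differentiable (at x)"
  shows "partial j (\<lambda>y. f y - g y) x = partial j f x - partial j g x"
proof -
  have "((\<lambda>y. f y - g y) has_derivative (\<lambda>v. frechet_derivative f (at x) v - frechet_derivative g (at x) v)) (at x)"
    using assms by (intro has_derivative_diff) (simp_all add: frechet_derivative_works)
  from partial_eqI[OF this, of j] show ?thesis by (simp add: partial_def)
qed

lemma partial_compose:
  fixes f :: "real^'m \<Rightarrow> real" and \<tau> :: "real^'n \<Rightarrow> real^'m"
  assumes "\<tau> differentiable (at x)" "f differentiable (at (\<tau> x))"
  shows "partial j (\<lambda>y. f (\<tau> y)) x = (\<Sum>a\<in>UNIV. partial a f (\<tau> x) * partial j (\<lambda>y. \<tau> y $ a) x)"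
    and "(\<lambda>y. f (\<tau> y)) differentiable (at x)"
proof -
  have t: "(\<tau> has_derivative frechet_derivative \<tau> (at x)) (at x)"
    and f: "(f has_derivative frechet_derivative f (at (\<tau> x))) (at (\<tau> x))"
    using assms by (simp_all add: frechet_derivative_works)
  have comp: "((\<lambda>y. f (\<tau> y)) has_derivative (\<lambda>v. frechet_derivative f (at (\<tau> x)) (frechet_derivative \<tau> (at x) v))) (at x)"
    using has_derivative_compose[OF t f] .
  then show "(\<lambda>y. f (\<tau> y)) differentiable (at x)" by (auto simp: differentiable_def)
  have "partial j (\<lambda>y. \<tau> y $ a) x = frechet_derivative \<tau> (at x) (axis j 1) $ a" for a
    unfolding partial_def
    using frechet_derivative_linear_compose(1)[OF bounded_linear_vec_nth assms(1)] by simp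
  then show "partial j (\<lambda>y. f (\<tau> y)) x = (\<Sum>a\<in>UNIV. partial a f (\<tau> x) * partial j (\<lambda>y. \<tau> y $ a) x)"
    using partial_eqI[OF comp, of j] frechet_derivative_eq_sum_partial[OF assms(2)] by simp
qed

lemma Ck_on_2_partial:
  fixes f :: "real^'n \<Rightarrow> real"
  assumes "Ck_on 2 f S"
  shows "x \<in> S \<Longrightarrow> f differentiable (at x)" "x \<in> S \<Longrightarrow> partial k f differentiable (at x)"
    "continuous_on S (partial k f)" "continuous_on S (partial j (partial k f))"
proof -
  have 1: "Ck_on 1 (partial k f) S" for k
    using assms unfolding partial_def by (simp add: numeral_2_eq_2)
  then show "x \<in> S \<Longrightarrow> partial k f differentiable (at x)" by simp
  show "x \<in> S \<Longrightarrow> f differentiable (at x)" using assms by (simp add: numeral_2_eq_2)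
  show "continuous_on S (partial k f)" using 1 by (rule Ck_on_imp_continuous_on)
  show "continuous_on S (partial j (partial k f))"
    using 1[of k] unfolding partial_def[of j "partial k f", abs_def] by simp
qed

lemma partial_partial_symmetric:
  fixes f :: "real^'n \<Rightarrow> real"
  assumes "Ck_on 2 f S" "open S" "y \<in> S"
  shows "partial j (partial k f) y = partial k (partial j f) y"
  using second_derivative_symmetric[OF assms] unfolding partial_def .

section \<open>Christoffel symbols and Hessian under a change of coordinates\<close>

definition jacobian_matrix :: "(real^'n \<Rightarrow> real^'n) \<Rightarrow> real^'n \<Rightarrow> real^'n^'n" where
  "jacobian_matrix \<tau> y = (\<chi> a j. partial j (\<lambda>z. \<tau> z $ a) y)"

text \<open>The coefficients \<open>\<Gamma>\<^sup>l\<^sub>j\<^sub>k\<close> for fixed \<open>j\<close>, \<open>k\<close> form a vector indexed by \<open>l\<close>; this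
  makes \<open>G\<close> applied to it the vector of Christoffel symbols of the first kind.\<close>

definition metric_christoffel :: "(real^'n \<Rightarrow> real^'n^'n) \<Rightarrow> 'n \<Rightarrow> 'n \<Rightarrow> real^'n \<Rightarrow> real^'n" where
  "metric_christoffel G j k y = (1/2) *\<^sub>R (matrix_inv (G y) *v
     (\<chi> m. partial j (\<lambda>z. G z $ m $ k) y + partial k (\<lambda>z. G z $ m $ j) y - partial m (\<lambda>z. G z $ j $ k) y))"

definition covariant_hessian :: "(real^'n \<Rightarrow> real^'n^'n) \<Rightarrow> (real^'n \<Rightarrow> real) \<Rightarrow> real^'n \<Rightarrow> real^'n^'n" where
  "covariant_hessian G f y = (\<chi> j k. partial j (partial k f) y
     - (\<Sum>l\<in>UNIV. metric_christoffel G j k y $ l * partial l f y))"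

lemma congruence_entry:
  fixes T g :: "real^'n^'n"
  shows "(transpose T ** g ** T) $ j $ k = (\<Sum>a\<in>UNIV. \<Sum>b\<in>UNIV. T $ a $ j * T $ b $ k * g $ a $ b)"
  unfolding matrix_matrix_mult_def transpose_def
  by (simp add: sum_distrib_right sum_distrib_left mult_ac) (subst sum.swap, simp add: mult_ac)

text \<open>The algebra behind the transformation law. If \<open>G\<close> is a metric with value \<open>g\<close> at \<open>\<tau>(y)\<close> and
  first derivatives \<open>dg\<close> there, and \<open>T\<close>, \<open>S\<close> are the first and second derivatives of \<open>\<tau>\<close> at \<open>y\<close>, then \<open>dG m j k\<close> is the
  derivative in direction \<open>m\<close> of the entry \<open>(j, k)\<close> of the pulled-back metric. In the combination
  on the left the terms with second derivatives cancel in pairs, except for two that agree.\<close>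

lemma christoffel_of_pullback_algebra:
  fixes T g :: "real^'n^'n" and S dg :: "'n \<Rightarrow> 'n \<Rightarrow> 'n \<Rightarrow> real"
  assumes sym: "\<And>a b. g $ a $ b = g $ b $ a" and S: "\<And>a j k. S a j k = S a k j"
  defines "dG \<equiv> \<lambda>m j k. (\<Sum>a\<in>UNIV. \<Sum>b\<in>UNIV. (S a m j * T $ b $ k + T $ a $ j * S b m k) * g $ a $ b
      + T $ a $ j * T $ b $ k * (\<Sum>e\<in>UNIV. dg e a b * T $ e $ m))"
  shows "dG j m k + dG k m j - dG m j k
    = (\<Sum>a\<in>UNIV. T $ a $ m * ((\<Sum>b\<in>UNIV. \<Sum>e\<in>UNIV. T $ b $ j * T $ e $ k * (dg b a e + dg e a b - dg a b e))
        + 2 * (\<Sum>b\<in>UNIV. g $ a $ b * S b j k)))"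
proof -
  \<comment> \<open>\<open>A\<close> collects the terms with second derivatives of \<open>\<tau>\<close>, and \<open>C\<close> those with derivatives of the metric.\<close>
  define A where "A m j k = (\<Sum>a\<in>UNIV. \<Sum>b\<in>UNIV. S a m j * T $ b $ k * g $ a $ b)" for m j k
  define C where "C m j k = (\<Sum>a\<in>UNIV. \<Sum>b\<in>UNIV. \<Sum>e\<in>UNIV. T $ a $ j * T $ b $ k * T $ e $ m * dg e a b)" for m j k
  have A': "(\<Sum>a\<in>UNIV. \<Sum>b\<in>UNIV. T $ a $ j * S b m k * g $ a $ b) = A m k j" for m j k
    unfolding A_def by (subst sum.swap) (simp add: sym mult_ac)
  have dG: "dG m j k = A m j k + A m k j + C m j k" for m j k
  proof -
    have "dG m j k = A m j k + (\<Sum>a\<in>UNIV. \<Sum>b\<in>UNIV. T $ a $ j * S b m k * g $ a $ b) + C m j k"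
      unfolding dG_def A_def C_def
      by (simp add: sum.distrib[symmetric] sum_distrib_left algebra_simps)
    then show ?thesis unfolding A' .
  qed
  have Asym: "A m j k = A j m k" for m j k unfolding A_def by (simp add: S)
  have "(\<Sum>a\<in>UNIV. T $ a $ m * (2 * (\<Sum>b\<in>UNIV. g $ a $ b * S b j k))) = 2 * A j k m"
    unfolding A_def by (subst sum.swap) (simp add: sum_distrib_left sym mult_ac)
  moreover have "(\<Sum>a\<in>UNIV. T $ a $ m * (\<Sum>b\<in>UNIV. \<Sum>e\<in>UNIV. T $ b $ j * T $ e $ k * (dg b a e + dg e a b - dg a b e)))
     = C j m k + C k m j - C m j k"
  proof -
    have 1: "C j m k = (\<Sum>a\<in>UNIV. \<Sum>b\<in>UNIV. \<Sum>e\<in>UNIV. T $ a $ m * (T $ b $ j * T $ e $ k * dg b a e))"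
      unfolding C_def by (rule sum.cong[OF refl], subst sum.swap) (simp add: mult_ac)
    have 2: "C k m j = (\<Sum>a\<in>UNIV. \<Sum>b\<in>UNIV. \<Sum>e\<in>UNIV. T $ a $ m * (T $ b $ j * T $ e $ k * dg e a b))"
      unfolding C_def by (simp add: mult_ac)
    have "C m j k = (\<Sum>a\<in>UNIV. \<Sum>e\<in>UNIV. \<Sum>b\<in>UNIV. T $ a $ j * T $ b $ k * T $ e $ m * dg e a b)"
      unfolding C_def by (rule sum.cong[OF refl], rule sum.swap)
    also have "\<dots> = (\<Sum>e\<in>UNIV. \<Sum>a\<in>UNIV. \<Sum>b\<in>UNIV. T $ a $ j * T $ b $ k * T $ e $ m * dg e a b)"
      by (rule sum.swap)
    finally have 3: "C m j k = (\<Sum>a\<in>UNIV. \<Sum>b\<in>UNIV. \<Sum>e\<in>UNIV. T $ a $ m * (T $ b $ j * T $ e $ k * dg a b e))"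
      by (simp add: mult_ac)
    show ?thesis unfolding 1 2 3
      by (simp add: sum_distrib_left sum.distrib[symmetric] sum_subtractf[symmetric] algebra_simps)
  qed
  ultimately show ?thesis
    unfolding dG distrib_left sum.distrib using Asym[of j m k] Asym[of k m j] Asym[of m j k] Asym[of j k m]
    by simp
qed

text \<open>The classical law
  \<open>\<Sum>\<^sub>l T\<^sup>a\<^sub>l \<Gamma>\<^sup>l\<^sub>j\<^sub>k = \<Sum>\<^sub>b\<^sub>e T\<^sup>b\<^sub>j T\<^sup>e\<^sub>k \<Gamma>'\<^sup>a\<^sub>b\<^sub>e + \<partial>\<^sub>j\<partial>\<^sub>k\<tau>\<^sup>a\<close>. Applying \<open>T\<^sup>t g\<close> to both
  sides gives the Christoffel symbols of the first kind, where the preceding algebra applies.\<close>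

lemma christoffel_of_pullback:
  fixes G H :: "real^'n \<Rightarrow> real^'n^'n" and \<tau> :: "real^'n \<Rightarrow> real^'n"
  assumes "open U" "y \<in> U" and \<tau>: "Ck_on 2 \<tau> U"
    and pull: "\<And>z. z \<in> U \<Longrightarrow> H z = transpose (jacobian_matrix \<tau> z) ** G (\<tau> z) ** jacobian_matrix \<tau> z"
    and dG: "\<And>a b. (\<lambda>z. G z $ a $ b) differentiable (at (\<tau> y))"
    and symG: "transpose (G (\<tau> y)) = G (\<tau> y)"
    and invG: "G (\<tau> y) ** matrix_inv (G (\<tau> y)) = mat 1"
    and invH: "H y ** matrix_inv (H y) = mat 1"
  shows "jacobian_matrix \<tau> y *v metric_christoffel H j k y
    = (\<Sum>b\<in>UNIV. \<Sum>e\<in>UNIV. (jacobian_matrix \<tau> y $ b $ j * jacobian_matrix \<tau> y $ e $ k) *\<^sub>R metric_christoffel G b e (\<tau> y))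
      + (\<chi> l. partial j (partial k (\<lambda>z. \<tau> z $ l)) y)"
proof -
  define T where "T = jacobian_matrix \<tau> y"
  define g where "g = G (\<tau> y)"
  define S where "S a j k = partial j (partial k (\<lambda>z. \<tau> z $ a)) y" for a j k
  define dg where "dg e a b = partial e (\<lambda>z. G z $ a $ b) (\<tau> y)" for e a b
  define \<Gamma> where "\<Gamma> b e = metric_christoffel G b e (\<tau> y)" for b e
  \<comment> \<open>\<open>V\<close> is the claimed value. It suffices that \<open>H(y) \<Gamma>\<^sub>H = T\<^sup>t g V\<close>: since \<open>H(y) = T\<^sup>t g T\<close>, this reads
    \<open>T\<^sup>t g (T \<Gamma>\<^sub>H) = T\<^sup>t g V\<close>, and the invertible factor \<open>T\<^sup>t g\<close> can be cancelled.\<close>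
  define V where "V = (\<Sum>b\<in>UNIV. \<Sum>e\<in>UNIV. (T $ b $ j * T $ e $ k) *\<^sub>R \<Gamma> b e) + (\<chi> l. S l j k)"
  have comp: "Ck_on 2 (\<lambda>z. \<tau> z $ a) U" for a
    by (rule Ck_on_linear_compose[OF bounded_linear_vec_nth \<open>open U\<close> \<tau>])
  have Ssym: "S a j k = S a k j" for a j k
    unfolding S_def by (rule partial_partial_symmetric[OF comp \<open>open U\<close> \<open>y \<in> U\<close>])
  have gsym: "g $ a $ b = g $ b $ a" for a b
    using arg_cong[OF symG, of "\<lambda>M. M $ b $ a"] by (simp add: transpose_def g_def)
  have jac: "(\<lambda>z. jacobian_matrix \<tau> z $ a $ j) = partial j (\<lambda>z. \<tau> z $ a)" for a j
    by (rule ext) (simp add: jacobian_matrix_def)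
  have dT: "(\<lambda>z. jacobian_matrix \<tau> z $ a $ j) differentiable (at y)" for a j
    unfolding jac by (rule Ck_on_2_partial(2)[OF comp \<open>y \<in> U\<close>])
  have pT: "partial m (\<lambda>z. jacobian_matrix \<tau> z $ a $ j) y = S a m j" for a j m
    unfolding jac S_def ..
  have d\<tau>: "\<tau> differentiable (at y)" using \<tau> \<open>y \<in> U\<close> by (simp add: numeral_2_eq_2)
  have dGt: "(\<lambda>z. G (\<tau> z) $ a $ b) differentiable (at y)"
    and pGt: "partial m (\<lambda>z. G (\<tau> z) $ a $ b) y = (\<Sum>e\<in>UNIV. dg e a b * T $ e $ m)" for a b m
    using partial_compose(1)[OF d\<tau> dG[of a b]] partial_compose(2)[OF d\<tau> dG[of a b]]
    by (simp_all add: dg_def T_def jacobian_matrix_def)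
  have dH: "partial m (\<lambda>z. H z $ j $ k) y = (\<Sum>a\<in>UNIV. \<Sum>b\<in>UNIV. (S a m j * T $ b $ k + T $ a $ j * S b m k) * g $ a $ b
      + T $ a $ j * T $ b $ k * (\<Sum>e\<in>UNIV. dg e a b * T $ e $ m))" for m j k
  proof -
    let ?F = "\<lambda>z. \<Sum>a\<in>UNIV. \<Sum>b\<in>UNIV. jacobian_matrix \<tau> z $ a $ j * jacobian_matrix \<tau> z $ b $ k * G (\<tau> z) $ a $ b"
    have "partial m (\<lambda>z. H z $ j $ k) y = partial m ?F y"
      by (rule partial_cong_open[OF \<open>open U\<close> \<open>y \<in> U\<close>, symmetric])
        (auto simp: pull congruence_entry intro!: differentiable_sum differentiable_mult dT dGt)
    also have "\<dots> = (\<Sum>a\<in>UNIV. \<Sum>b\<in>UNIV. partial m (\<lambda>z. jacobian_matrix \<tau> z $ a $ j * jacobian_matrix \<tau> z $ b $ k * G (\<tau> z) $ a $ b) y)"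
      by (simp add: partial_sum differentiable_sum differentiable_mult dT dGt)
    also have "\<dots> = (\<Sum>a\<in>UNIV. \<Sum>b\<in>UNIV. (S a m j * T $ b $ k + T $ a $ j * S b m k) * g $ a $ b
      + T $ a $ j * T $ b $ k * (\<Sum>e\<in>UNIV. dg e a b * T $ e $ m))"
      by (simp add: partial_mult differentiable_mult dT dGt pT pGt T_def[symmetric] g_def[symmetric])
    finally show ?thesis .
  qed
  define K where "K = (\<chi> m. partial j (\<lambda>z. H z $ m $ k) y + partial k (\<lambda>z. H z $ m $ j) y - partial m (\<lambda>z. H z $ j $ k) y)"
  have Kd: "dg b a e + dg e a b - dg a b e = 2 * (g *v \<Gamma> b e) $ a" for a b e
  proof -
    have "g *v \<Gamma> b e = (1/2) *\<^sub>R ((g ** matrix_inv g) *v (\<chi> m. dg b m e + dg e m b - dg m b e))"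
      unfolding \<Gamma>_def metric_christoffel_def
      by (simp add: g_def[symmetric] dg_def[symmetric] matrix_vector_mult_scaleR matrix_vector_mul_assoc)
    also have "\<dots> = (1/2) *\<^sub>R (\<chi> m. dg b m e + dg e m b - dg m b e)"
      using invG by (simp add: g_def)
    finally show ?thesis by simp
  qed
  have gV: "(g *v V) $ a = (\<Sum>b\<in>UNIV. \<Sum>e\<in>UNIV. T $ b $ j * T $ e $ k * (g *v \<Gamma> b e) $ a) + (\<Sum>b\<in>UNIV. g $ a $ b * S b j k)" for a
    unfolding V_def matrix_vector_right_distrib
    by (simp add: linear_sum[OF matrix_vector_mul_linear] matrix_vector_mult_scaleR) (simp add: matrix_vector_mult_def)
  have "K $ m = (2 *\<^sub>R (transpose T *v (g *v V))) $ m" for m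
  proof -
    have "K $ m = (\<Sum>a\<in>UNIV. T $ a $ m * ((\<Sum>b\<in>UNIV. \<Sum>e\<in>UNIV. T $ b $ j * T $ e $ k * (dg b a e + dg e a b - dg a b e))
        + 2 * (\<Sum>b\<in>UNIV. g $ a $ b * S b j k)))"
      unfolding K_def dH using christoffel_of_pullback_algebra[OF gsym Ssym, where T = T and dg = dg and j = j and m = m and k = k] by simp
    also have "\<dots> = (\<Sum>a\<in>UNIV. T $ a $ m * (2 * (g *v V) $ a))"
      unfolding Kd gV by (simp add: sum_distrib_left algebra_simps)
    also have "\<dots> = (2 *\<^sub>R (transpose T *v (g *v V))) $ m"
      unfolding matrix_vector_mult_def[of "transpose T"] by (simp add: transpose_def sum_distrib_left mult_ac)
    finally show ?thesis .
  qed
  then have "K = 2 *\<^sub>R (transpose T *v (g *v V))" by (simp add: vec_eq_iff)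
  then have "metric_christoffel H j k y = matrix_inv (H y) *v (transpose T *v (g *v V))"
    unfolding metric_christoffel_def K_def[symmetric] by (simp add: matrix_vector_mult_scaleR)
  then have "H y *v metric_christoffel H j k y = transpose T *v (g *v V)"
    using invH by (simp add: matrix_vector_mul_assoc[of "H y" "matrix_inv (H y)"])
  moreover have Hy: "H y = transpose T ** g ** T" using pull[OF \<open>y \<in> U\<close>] by (simp add: T_def g_def)
  ultimately have "(transpose T ** g) *v (T *v metric_christoffel H j k y) = (transpose T ** g) *v V"
    by (simp add: matrix_vector_mul_assoc matrix_mul_assoc)
  moreover have "invertible (transpose T ** g)"
    using invH unfolding Hy
    by (metis invertible_det_nz det_mul det_I mult_zero_left zero_neq_one)
  ultimately have "T *v metric_christoffel H j k y = V"
    by (metis inj_matrix_vector_mult injD)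
  then show ?thesis unfolding T_def V_def \<Gamma>_def S_def .
qed

text \<open>The second derivatives of \<open>\<tau>\<close> that the chain rule produces in \<open>\<partial>\<^sub>j\<partial>\<^sub>k(f \<circ> \<tau>)\<close> are those in the transformation
  law of the Christoffel symbols, and they cancel.\<close>

lemma covariant_hessian_of_pullback:
  fixes G H :: "real^'n \<Rightarrow> real^'n^'n" and \<tau> :: "real^'n \<Rightarrow> real^'n"
  assumes "open U" "y \<in> U" and \<tau>: "Ck_on 2 \<tau> U"
    and pull: "\<And>z. z \<in> U \<Longrightarrow> H z = transpose (jacobian_matrix \<tau> z) ** G (\<tau> z) ** jacobian_matrix \<tau> z"
    and dG: "\<And>a b. (\<lambda>z. G z $ a $ b) differentiable (at (\<tau> y))"
    and symG: "transpose (G (\<tau> y)) = G (\<tau> y)"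
    and invG: "G (\<tau> y) ** matrix_inv (G (\<tau> y)) = mat 1"
    and invH: "H y ** matrix_inv (H y) = mat 1"
    and f: "Ck_on 2 f W" "\<tau> ` U \<subseteq> W" "open W"
    and h: "\<And>z. z \<in> U \<Longrightarrow> h z = f (\<tau> z)"
  shows "covariant_hessian H h y = transpose (jacobian_matrix \<tau> y) ** covariant_hessian G f (\<tau> y) ** jacobian_matrix \<tau> y"
proof -
  define T where "T = jacobian_matrix \<tau> y"
  define S where "S a j k = partial j (partial k (\<lambda>z. \<tau> z $ a)) y" for a j k
  have comp: "Ck_on 2 (\<lambda>z. \<tau> z $ a) U" for a
    by (rule Ck_on_linear_compose[OF bounded_linear_vec_nth \<open>open U\<close> \<tau>])
  have d\<tau>: "\<tau> differentiable (at z)" if "z \<in> U" for z using \<tau> that by (simp add: numeral_2_eq_2)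
  have df: "f differentiable (at (\<tau> z))" "partial a f differentiable (at (\<tau> z))" if "z \<in> U" for z a
    using Ck_on_2_partial(1,2)[OF f(1)] f(2) that by blast+
  have first: "partial k h z = (\<Sum>a\<in>UNIV. partial a f (\<tau> z) * partial k (\<lambda>z. \<tau> z $ a) z)" if "z \<in> U" for z k
  proof -
    have "partial k h z = partial k (\<lambda>z. f (\<tau> z)) z"
      using partial_compose(2)[OF d\<tau> df(1), of z] that h
      by (intro partial_cong_open[OF \<open>open U\<close> that, symmetric]) auto
    then show ?thesis using partial_compose(1)[OF d\<tau>[OF that] df(1)[OF that]] by simp
  qed
  have second: "partial j (partial k h) y
      = (\<Sum>a\<in>UNIV. (\<Sum>b\<in>UNIV. partial b (partial a f) (\<tau> y) * T $ b $ j) * T $ a $ k + partial a f (\<tau> y) * S a j k)" for j k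
  proof -
    have dp: "(\<lambda>z. partial a f (\<tau> z)) differentiable (at y)" for a
      by (rule partial_compose(2)[OF d\<tau>[OF \<open>y \<in> U\<close>] df(2)[OF \<open>y \<in> U\<close>]])
    have dT: "(\<lambda>z. partial k (\<lambda>z. \<tau> z $ a) z) differentiable (at y)" for a
      using Ck_on_2_partial(2)[OF comp \<open>y \<in> U\<close>] .
    have "partial j (partial k h) y = partial j (\<lambda>z. \<Sum>a\<in>UNIV. partial a f (\<tau> z) * partial k (\<lambda>z. \<tau> z $ a) z) y"
      by (rule partial_cong_open[OF \<open>open U\<close> \<open>y \<in> U\<close>, symmetric])
        (auto simp: first intro!: differentiable_sum differentiable_mult dp dT)
    also have "\<dots> = (\<Sum>a\<in>UNIV. partial j (\<lambda>z. partial a f (\<tau> z)) y * partial k (\<lambda>z. \<tau> z $ a) y + partial a f (\<tau> y) * S a j k)"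
      using dp dT by (simp add: partial_sum partial_mult differentiable_mult S_def)
    finally show ?thesis
      using partial_compose(1)[OF d\<tau>[OF \<open>y \<in> U\<close>] df(2)[OF \<open>y \<in> U\<close>]] by (simp add: T_def jacobian_matrix_def)
  qed
  have chr: "(\<Sum>l\<in>UNIV. metric_christoffel H j k y $ l * partial l h y)
      = (\<Sum>a\<in>UNIV. partial a f (\<tau> y) * ((\<Sum>b\<in>UNIV. \<Sum>e\<in>UNIV. T $ b $ j * T $ e $ k * metric_christoffel G b e (\<tau> y) $ a) + S a j k))" for j k
  proof -
    have "(\<Sum>l\<in>UNIV. metric_christoffel H j k y $ l * partial l h y)
        = (\<Sum>l\<in>UNIV. \<Sum>a\<in>UNIV. metric_christoffel H j k y $ l * (partial a f (\<tau> y) * T $ a $ l))"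
      unfolding first[OF \<open>y \<in> U\<close>] by (simp add: sum_distrib_left T_def jacobian_matrix_def)
    also have "\<dots> = (\<Sum>a\<in>UNIV. partial a f (\<tau> y) * (T *v metric_christoffel H j k y) $ a)"
      by (subst sum.swap) (simp add: matrix_vector_mult_def sum_distrib_left mult_ac)
    also have "\<dots> = (\<Sum>a\<in>UNIV. partial a f (\<tau> y) * ((\<Sum>b\<in>UNIV. \<Sum>e\<in>UNIV. T $ b $ j * T $ e $ k * metric_christoffel G b e (\<tau> y) $ a) + S a j k))"
    proof -
      have "T *v metric_christoffel H j k y = (\<Sum>b\<in>UNIV. \<Sum>e\<in>UNIV. (T $ b $ j * T $ e $ k) *\<^sub>R metric_christoffel G b e (\<tau> y)) + (\<chi> l. S l j k)"
        unfolding T_def S_def by (rule christoffel_of_pullback[OF assms(1-8)])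
      then show ?thesis by simp
    qed
    finally show ?thesis .
  qed
  have "covariant_hessian H h y $ j $ k = (transpose T ** covariant_hessian G f (\<tau> y) ** T) $ j $ k" for j k
  proof -
    let ?\<Gamma> = "\<lambda>b e a. metric_christoffel G b e (\<tau> y) $ a"
    have "(\<Sum>a\<in>UNIV. partial a f (\<tau> y) * (\<Sum>b\<in>UNIV. \<Sum>e\<in>UNIV. T $ b $ j * T $ e $ k * ?\<Gamma> b e a))
        = (\<Sum>b\<in>UNIV. \<Sum>e\<in>UNIV. T $ b $ j * T $ e $ k * (\<Sum>a\<in>UNIV. ?\<Gamma> b e a * partial a f (\<tau> y)))"
      unfolding sum_distrib_left
      by (subst sum.swap, rule sum.cong[OF refl], subst sum.swap) (simp add: mult_ac)
    moreover have "(\<Sum>a\<in>UNIV. (\<Sum>b\<in>UNIV. partial b (partial a f) (\<tau> y) * T $ b $ j) * T $ a $ k)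
        = (\<Sum>b\<in>UNIV. \<Sum>e\<in>UNIV. T $ b $ j * T $ e $ k * partial b (partial e f) (\<tau> y))"
      unfolding sum_distrib_right by (subst sum.swap) (simp add: mult_ac)
    ultimately show ?thesis
      unfolding covariant_hessian_def[of H] congruence_entry
      by (simp add: second chr covariant_hessian_def[of G] sum.distrib distrib_left right_diff_distrib sum_subtractf)
  qed
  then show ?thesis by (simp add: vec_eq_iff T_def)
qed

section \<open>Tangent vectors, covectors and forms in charts\<close>

lemma chart_inv_mem: "y \<in> chart_image c \<Longrightarrow> chart_inv c y \<in> fst c"
  unfolding chart_inv_def chart_image_def by (rule inv_into_into)

lemma chart_chart_inv: "y \<in> chart_image c \<Longrightarrow> snd c (chart_inv c y) = y"
  unfolding chart_inv_def chart_image_def by (rule f_inv_into_f)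

lemma chart_mem_image: "z \<in> fst c \<Longrightarrow> snd c z \<in> chart_image c"
  unfolding chart_image_def by (rule imageI)

lemma charts_atD: "c \<in> charts_at \<A> x \<Longrightarrow> c \<in> \<A> \<and> x \<in> fst c"
  by (simp add: charts_at_def)

lemma matrix_eq_congruenceI:
  fixes M N J :: "real^'m^'m"
  assumes "\<And>\<xi> \<eta>. \<xi> \<bullet> (M *v \<eta>) = (J *v \<xi>) \<bullet> (N *v (J *v \<eta>))"
  shows "M = transpose J ** N ** J"
proof -
  have "\<xi> \<bullet> (M *v \<eta>) = \<xi> \<bullet> ((transpose J ** N ** J) *v \<eta>)" for \<xi> \<eta>
  proof -
    have "\<xi> \<bullet> ((transpose J ** N ** J) *v \<eta>) = ((N *v (J *v \<eta>)) v* J) \<bullet> \<xi>"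
      by (simp only: matrix_vector_mul_assoc[symmetric] transpose_matrix_vector inner_commute)
    also have "\<dots> = (J *v \<xi>) \<bullet> (N *v (J *v \<eta>))"
      by (subst dot_lmul_matrix) (rule inner_commute)
    finally show ?thesis using assms by simp
  qed
  then have "M *v \<eta> = (transpose J ** N ** J) *v \<eta>" for \<eta> by (metis vector_eq_rdot inner_commute)
  then show ?thesis by (simp add: matrix_eq)
qed

lemma sym_bilinear_at_combination:
  assumes "sym_bilinear_at \<A> x B" "sym_bilinear_at \<A> x C"
  shows "sym_bilinear_at \<A> x (\<lambda>v w. s * B v w + C v w)"
  using assms unfolding sym_bilinear_at_def linear_functional_at_def
  by (simp add: algebra_simps)

lemma form_matrix_combination:
  "form_matrix \<A> c x (\<lambda>v w. s * B v w + C v w) = s *\<^sub>R form_matrix \<A> c x B + form_matrix \<A> c x C"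
  by (simp add: form_matrix_def vec_eq_iff)

context
  fixes X :: "'a topology" and \<A> :: "('a, 'n::finite) chart set"
  assumes atlas: "smooth_atlas X \<A>"
begin

lemma chart_domain_open: "c \<in> \<A> \<Longrightarrow> openin X (fst c)"
  using atlas by (simp add: smooth_atlas_def is_chart_def)

lemma chart_image_open: "c \<in> \<A> \<Longrightarrow> open (chart_image c)"
  using atlas by (simp add: smooth_atlas_def is_chart_def)

lemma chart_homeomorphic_map:
  "c \<in> \<A> \<Longrightarrow> homeomorphic_map (subtopology X (fst c)) (top_of_set (chart_image c)) (snd c)"
  using atlas by (simp add: smooth_atlas_def is_chart_def)

lemma chart_inj: 
  assumes "c \<in> \<A>" shows "inj_on (snd c) (fst c)"
proof -
  have "topspace (subtopology X (fst c)) = fst c"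
    using chart_domain_open[OF assms] openin_subset by fastforce
  then show ?thesis using chart_homeomorphic_map[OF assms] homeomorphic_imp_injective_map by metis
qed

lemma chart_inv_chart: "c \<in> \<A> \<Longrightarrow> z \<in> fst c \<Longrightarrow> chart_inv c (snd c z) = z"
  unfolding chart_inv_def using chart_inj by (simp add: inv_into_f_f)

lemma open_chart_image_of_open:
  assumes "c \<in> \<A>" "openin X U" "U \<subseteq> fst c"
  shows "open (snd c ` U)"
proof -
  have "open_map (subtopology X (fst c)) (top_of_set (chart_image c)) (snd c)"
    using chart_homeomorphic_map[OF assms(1)] by (rule homeomorphic_imp_open_map)
  moreover have "openin (subtopology X (fst c)) U"
    using assms by (metis inf.absorb_iff1 inf_commute openin_subtopology_Int)
  ultimately have "openin (top_of_set (chart_image c)) (snd c ` U)" by (simp add: open_map_def)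
  then show ?thesis using chart_image_open[OF assms(1)] openin_open_trans by blast
qed

lemma open_overlap:
  assumes "c \<in> \<A>" "d \<in> \<A>" shows "open (snd c ` (fst c \<inter> fst d))"
  using assms by (intro open_chart_image_of_open openin_Int chart_domain_open) auto

lemma transition_chart: "c \<in> \<A> \<Longrightarrow> z \<in> fst c \<Longrightarrow> transition c d (snd c z) = snd d z"
  by (simp add: transition_def chart_inv_chart)

lemma transition_Ck: "c \<in> \<A> \<Longrightarrow> d \<in> \<A> \<Longrightarrow> Ck_on k (transition c d) (snd c ` (fst c \<inter> fst d))"
  using atlas by (simp add: smooth_atlas_def smooth_on_def)

lemma charts_at_imp_topspace:
  assumes "c \<in> charts_at \<A> x" shows "x \<in> topspace X"
  using openin_subset[OF chart_domain_open, of c] charts_atD[OF assms] by blast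

lemma chart_at_mem: "x \<in> topspace X \<Longrightarrow> chart_at \<A> x \<in> charts_at \<A> x"
proof -
  assume "x \<in> topspace X"
  then have "x \<in> \<Union>(fst ` \<A>)" using atlas by (simp add: smooth_atlas_def)
  then have "\<exists>c. c \<in> charts_at \<A> x" by (auto simp: charts_at_def)
  then show ?thesis unfolding chart_at_def by (rule someI_ex)
qed

lemma transition_differentiable:
  assumes "c \<in> charts_at \<A> x" "d \<in> charts_at \<A> x"
  shows "transition c d differentiable (at (snd c x))"
proof -
  have "Ck_on (Suc 0) (transition c d) (snd c ` (fst c \<inter> fst d))"
    using charts_atD[OF assms(1)] charts_atD[OF assms(2)] transition_Ck by blast
  moreover have "snd c x \<in> snd c ` (fst c \<inter> fst d)"
    using charts_atD[OF assms(1)] charts_atD[OF assms(2)] by blast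
  ultimately show ?thesis unfolding Ck_on.simps by blast
qed

text \<open>The chain rule for \<open>transition c e = transition d e \<circ> transition c d\<close>, which holds near the
  image of \<open>x\<close>.\<close>

lemma transition_derivative_cocycle:
  assumes c: "c \<in> charts_at \<A> x" and d: "d \<in> charts_at \<A> x" and e: "e \<in> charts_at \<A> x"
  shows "frechet_derivative (transition d e) (at (snd d x)) (frechet_derivative (transition c d) (at (snd c x)) \<xi>)
    = frechet_derivative (transition c e) (at (snd c x)) \<xi>"
proof -
  let ?U = "snd c ` (fst c \<inter> fst d \<inter> fst e)"
  note mem = charts_atD[OF c] charts_atD[OF d] charts_atD[OF e]
  have U: "open ?U"
    using mem by (intro open_chart_image_of_open openin_Int chart_domain_open) auto
  have x: "snd c x \<in> ?U" using mem by blast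
  have cd: "transition c d (snd c x) = snd d x" using mem transition_chart by blast
  have D1: "(transition c d has_derivative frechet_derivative (transition c d) (at (snd c x))) (at (snd c x))"
    using transition_differentiable[OF c d] by (simp add: frechet_derivative_works)
  have D2: "(transition d e has_derivative frechet_derivative (transition d e) (at (snd d x))) (at (transition c d (snd c x)))"
    using transition_differentiable[OF d e] by (simp add: frechet_derivative_works cd)
  have "(transition c e has_derivative
      (\<lambda>\<xi>. frechet_derivative (transition d e) (at (snd d x)) (frechet_derivative (transition c d) (at (snd c x)) \<xi>))) (at (snd c x))"
    by (rule has_derivative_transform_within_open[OF has_derivative_compose[OF D1 D2] U x])
      (use mem in \<open>elim imageE, simp add: transition_chart\<close>)
  then show ?thesis by (metis frechet_derivative_at)
qed

lemma transition_self_derivative: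
  assumes c: "c \<in> charts_at \<A> x"
  shows "frechet_derivative (transition c c) (at (snd c x)) = id"
proof -
  note mem = charts_atD[OF c]
  have "(transition c c has_derivative id) (at (snd c x))"
    by (rule has_derivative_transform_within_open[OF has_derivative_id chart_image_open[of c]])
      (use mem in \<open>simp_all add: chart_mem_image chart_chart_inv transition_def\<close>)
  then show ?thesis by (metis frechet_derivative_at)
qed

lemma tangent_vec_component:
  assumes "c \<in> charts_at \<A> x" shows "tangent_vec \<A> c x \<xi> c = \<xi>"
  using assms by (simp add: tangent_vec_def transition_self_derivative)

lemma tangent_vec_mem: 
  assumes "c \<in> charts_at \<A> x" shows "tangent_vec \<A> c x \<xi> \<in> tangent_space \<A> x"
  using assms by (auto simp: tangent_space_def tangent_vec_def transition_derivative_cocycle)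

text \<open>Together with \<open>tangent_vec_component\<close> and \<open>tangent_vec_mem\<close> this identifies the tangent space with the
  coordinate space of any chart around the point.\<close>

lemma tangent_space_eq_tangent_vec:
  assumes "c \<in> charts_at \<A> x" "v \<in> tangent_space \<A> x"
  shows "v = tangent_vec \<A> c x (v c)"
proof
  fix d show "v d = tangent_vec \<A> c x (v c) d"
  proof (cases "d \<in> charts_at \<A> x")
    case True
    then have "v d = frechet_derivative (transition c d) (at (snd c x)) (v c)"
      using assms unfolding tangent_space_def by blast
    then show ?thesis using True by (simp add: tangent_vec_def)
  next
    case False
    then have "v d = 0" using assms unfolding tangent_space_def by blast
    then show ?thesis using False by (simp add: tangent_vec_def)
  qed
qed

lemma tangent_vec_change_chart:
  assumes "c \<in> charts_at \<A> x" "d \<in> charts_at \<A> x"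
  shows "tangent_vec \<A> c x \<xi> = tangent_vec \<A> d x (frechet_derivative (transition c d) (at (snd c x)) \<xi>)"
  using tangent_space_eq_tangent_vec[OF assms(2) tangent_vec_mem[OF assms(1)], of \<xi>] assms(2)
  by (simp add: tangent_vec_def)

lemma tangent_vec_linear:
  assumes "c \<in> charts_at \<A> x"
  shows "tangent_vec \<A> c x (a *\<^sub>R \<xi> + b *\<^sub>R \<eta>) = (\<lambda>d. a *\<^sub>R tangent_vec \<A> c x \<xi> d + b *\<^sub>R tangent_vec \<A> c x \<eta> d)"
proof
  fix d
  show "tangent_vec \<A> c x (a *\<^sub>R \<xi> + b *\<^sub>R \<eta>) d = a *\<^sub>R tangent_vec \<A> c x \<xi> d + b *\<^sub>R tangent_vec \<A> c x \<eta> d"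
  proof (cases "d \<in> charts_at \<A> x")
    case True
    then have "linear (frechet_derivative (transition c d) (at (snd c x)))"
      using transition_differentiable[OF assms] linear_frechet_derivative by blast
    then show ?thesis using True by (simp add: tangent_vec_def linear_add linear_cmul)
  qed (simp add: tangent_vec_def)
qed

lemma tangent_space_combination:
  assumes "x \<in> topspace X" "v \<in> tangent_space \<A> x" "w \<in> tangent_space \<A> x"
  shows "(\<lambda>c. a *\<^sub>R v c + b *\<^sub>R w c) \<in> tangent_space \<A> x"
proof -
  obtain c where c: "c \<in> charts_at \<A> x" using chart_at_mem[OF assms(1)] by blast
  have "tangent_vec \<A> c x (a *\<^sub>R v c + b *\<^sub>R w c) = (\<lambda>c. a *\<^sub>R v c + b *\<^sub>R w c)"
    unfolding tangent_vec_linear[OF c]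
    using tangent_space_eq_tangent_vec[OF c assms(2)] tangent_space_eq_tangent_vec[OF c assms(3)] by metis
  then show ?thesis using tangent_vec_mem[OF c] by metis
qed

lemma linear_functional_tangent_vec:
  assumes c: "c \<in> charts_at \<A> x" and \<alpha>: "linear_functional_at \<A> x \<alpha>"
  shows "\<alpha> (tangent_vec \<A> c x \<xi>) = (\<Sum>j\<in>UNIV. \<xi> $ j * \<alpha> (coord_vec \<A> c x j))"
proof -
  let ?f = "\<lambda>\<xi>. \<alpha> (tangent_vec \<A> c x \<xi>)"
  have comb: "?f (a *\<^sub>R \<xi> + b *\<^sub>R \<eta>) = a * ?f \<xi> + b * ?f \<eta>" for a b \<xi> \<eta>
    unfolding tangent_vec_linear[OF c]
    using \<alpha> tangent_vec_mem[OF c] unfolding linear_functional_at_def by blast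
  have lin: "linear ?f"
  proof (rule linearI)
    show "?f (\<xi> + \<eta>) = ?f \<xi> + ?f \<eta>" for \<xi> \<eta> using comb[of 1 \<xi> 1 \<eta>] by simp
    show "?f (a *\<^sub>R \<xi>) = a *\<^sub>R ?f \<xi>" for a \<xi> using comb[of a \<xi> 0 \<xi>] by simp
  qed
  have "\<xi> = (\<Sum>j\<in>UNIV. \<xi> $ j *\<^sub>R axis j 1)"
    by (simp add: vec_eq_iff axis_def if_distrib cong: if_cong)
  from arg_cong[OF this, of ?f] show ?thesis
    by (simp add: linear_sum[OF lin] linear_cmul[OF lin] coord_vec_def)
qed

lemma coord_vec_mem: "c \<in> charts_at \<A> x \<Longrightarrow> coord_vec \<A> c x j \<in> tangent_space \<A> x"
  unfolding coord_vec_def by (rule tangent_vec_mem)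

lemma form_on_tangent_vecs:
  assumes c: "c \<in> charts_at \<A> x" and B: "sym_bilinear_at \<A> x B"
  shows "B (tangent_vec \<A> c x \<xi>) (tangent_vec \<A> c x \<eta>) = \<xi> \<bullet> (form_matrix \<A> c x B *v \<eta>)"
proof -
  have lin: "linear_functional_at \<A> x (B v)" if "v \<in> tangent_space \<A> x" for v
    using B that by (simp add: sym_bilinear_at_def)
  have "B (tangent_vec \<A> c x \<xi>) (coord_vec \<A> c x k) = (\<Sum>j\<in>UNIV. \<xi> $ j * B (coord_vec \<A> c x j) (coord_vec \<A> c x k))" for k
  proof -
    have "B (tangent_vec \<A> c x \<xi>) (coord_vec \<A> c x k) = B (coord_vec \<A> c x k) (tangent_vec \<A> c x \<xi>)"
      using B tangent_vec_mem[OF c] coord_vec_mem[OF c] unfolding sym_bilinear_at_def by blast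
    also have "\<dots> = (\<Sum>j\<in>UNIV. \<xi> $ j * B (coord_vec \<A> c x k) (coord_vec \<A> c x j))"
      by (rule linear_functional_tangent_vec[OF c lin[OF coord_vec_mem[OF c]]])
    also have "\<dots> = (\<Sum>j\<in>UNIV. \<xi> $ j * B (coord_vec \<A> c x j) (coord_vec \<A> c x k))"
      using B coord_vec_mem[OF c] unfolding sym_bilinear_at_def by (intro sum.cong) auto
    finally show ?thesis .
  qed
  then have "B (tangent_vec \<A> c x \<xi>) (tangent_vec \<A> c x \<eta>)
      = (\<Sum>k\<in>UNIV. \<Sum>j\<in>UNIV. \<eta> $ k * (\<xi> $ j * B (coord_vec \<A> c x j) (coord_vec \<A> c x k)))"
    unfolding linear_functional_tangent_vec[OF c lin[OF tangent_vec_mem[OF c, of \<xi>]], of \<eta>]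
    by (simp add: sum_distrib_left)
  also have "\<dots> = \<xi> \<bullet> (form_matrix \<A> c x B *v \<eta>)"
    by (subst sum.swap) (simp add: inner_vec_def matrix_vector_mult_def form_matrix_def sum_distrib_left mult_ac)
  finally show ?thesis .
qed

lemma transpose_form_matrix:
  assumes "c \<in> charts_at \<A> x" "sym_bilinear_at \<A> x B"
  shows "transpose (form_matrix \<A> c x B) = form_matrix \<A> c x B"
  using assms coord_vec_mem[OF assms(1)]
  unfolding form_matrix_def transpose_def sym_bilinear_at_def by (simp add: vec_eq_iff)

lemma jacobian_matrix_transition:
  assumes "c \<in> charts_at \<A> x" "d \<in> charts_at \<A> x"
  shows "frechet_derivative (transition c d) (at (snd c x)) \<xi> = jacobian_matrix (transition c d) (snd c x) *v \<xi>"
proof -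
  note diff = transition_differentiable[OF assms]
  have "frechet_derivative (transition c d) (at (snd c x)) \<xi> $ a = (jacobian_matrix (transition c d) (snd c x) *v \<xi>) $ a" for a
    using frechet_derivative_linear_compose[OF bounded_linear_vec_nth diff, of a]
      frechet_derivative_eq_sum_partial[of "\<lambda>z. transition c d z $ a" "snd c x" \<xi>]
    by (simp add: jacobian_matrix_def matrix_vector_mult_def)
  then show ?thesis by (simp add: vec_eq_iff)
qed

text \<open>Both matrices represent the same form on tangent vectors, whose components change by the Jacobian
  matrix of the transition map.\<close>

lemma form_matrix_change_chart:
  assumes c: "c \<in> charts_at \<A> x" and d: "d \<in> charts_at \<A> x" and B: "sym_bilinear_at \<A> x B"
  shows "form_matrix \<A> c x B = transpose (jacobian_matrix (transition c d) (snd c x)) ** form_matrix \<A> d x B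
    ** jacobian_matrix (transition c d) (snd c x)"
proof (rule matrix_eq_congruenceI)
  let ?J = "jacobian_matrix (transition c d) (snd c x)"
  fix \<xi> \<eta>
  show "\<xi> \<bullet> (form_matrix \<A> c x B *v \<eta>) = (?J *v \<xi>) \<bullet> (form_matrix \<A> d x B *v (?J *v \<eta>))"
    unfolding form_on_tangent_vecs[OF c B, symmetric] form_on_tangent_vecs[OF d B, symmetric]
      jacobian_matrix_transition[OF c d, symmetric] tangent_vec_change_chart[OF c d, symmetric] ..
qed

text \<open>By the chain rule the pairing with a tangent vector gives the same number in every chart.\<close>

lemma differential_in_chart:
  assumes c: "c \<in> charts_at \<A> x" and u: "C2_fun \<A> u"
  shows "differential \<A> u x = coord_covec \<A> c x (\<chi> j. partial j (u \<circ> chart_inv c) (snd c x))"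
proof -
  define d where "d = chart_at \<A> x"
  have d: "d \<in> charts_at \<A> x" unfolding d_def using chart_at_mem charts_at_imp_topspace[OF c] by blast
  note mem = charts_atD[OF c] charts_atD[OF d]
  have diff: "u \<circ> chart_inv e differentiable (at (snd e x))" if "e \<in> charts_at \<A> x" for e
  proof -
    have "Ck_on 2 (u \<circ> chart_inv e) (chart_image e)" "snd e x \<in> chart_image e"
      using u charts_atD[OF that] by (simp_all add: C2_fun_def chart_mem_image)
    then show ?thesis by (rule Ck_on_2_partial(1))
  qed
  have inner: "(\<chi> j. partial j (u \<circ> chart_inv e) (snd e x)) \<bullet> \<xi> = frechet_derivative (u \<circ> chart_inv e) (at (snd e x)) \<xi>"
    if "e \<in> charts_at \<A> x" for e \<xi>
    using frechet_derivative_eq_sum_partial[OF diff[OF that]] by (simp add: inner_vec_def)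
  have cd: "transition c d (snd c x) = snd d x" using mem transition_chart by blast
  have "(\<chi> j. partial j (u \<circ> chart_inv d) (snd d x)) \<bullet> v d = (\<chi> j. partial j (u \<circ> chart_inv c) (snd c x)) \<bullet> v c"
    if v: "v \<in> tangent_space \<A> x" for v
  proof -
    have D1: "(transition c d has_derivative frechet_derivative (transition c d) (at (snd c x))) (at (snd c x))"
      using transition_differentiable[OF c d] by (simp add: frechet_derivative_works)
    have D2: "((u \<circ> chart_inv d) has_derivative frechet_derivative (u \<circ> chart_inv d) (at (snd d x))) (at (transition c d (snd c x)))"
      using diff[OF d] by (simp add: frechet_derivative_works cd)
    have "((u \<circ> chart_inv c) has_derivative (\<lambda>\<xi>. frechet_derivative (u \<circ> chart_inv d) (at (snd d x))
        (frechet_derivative (transition c d) (at (snd c x)) \<xi>))) (at (snd c x))"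
      by (rule has_derivative_transform_within_open[OF has_derivative_compose[OF D1 D2] open_overlap[of c d]])
        (use mem in \<open>auto simp: transition_chart chart_inv_chart simp del: split_paired_All\<close>)
    then have "frechet_derivative (u \<circ> chart_inv c) (at (snd c x)) (v c)
      = frechet_derivative (u \<circ> chart_inv d) (at (snd d x)) (frechet_derivative (transition c d) (at (snd c x)) (v c))"
      by (metis frechet_derivative_at)
    moreover have "v d = frechet_derivative (transition c d) (at (snd c x)) (v c)"
      using v c d unfolding tangent_space_def by blast
    ultimately show ?thesis unfolding inner[OF c] inner[OF d] by simp
  qed
  then show ?thesis
    unfolding differential_def Let_def d_def[symmetric] coord_covec_def by auto
qed

lemma coord_covec_mem:
  assumes "c \<in> charts_at \<A> x"
  shows "coord_covec \<A> c x \<xi> \<in> cotangent_bundle X \<A>"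
proof -
  have x: "x \<in> topspace X" by (rule charts_at_imp_topspace[OF assms])
  have "linear_functional_at \<A> x (\<lambda>v. if v \<in> tangent_space \<A> x then \<xi> \<bullet> v c else 0)"
    unfolding linear_functional_at_def
    using tangent_space_combination[OF x] by (simp add: inner_right_distrib)
  then show ?thesis using x by (simp add: coord_covec_def cotangent_bundle_def cotangent_space_def)
qed

lemma C2_fun_diff:
  assumes "C2_fun \<A> u" "C2_fun \<A> v"
  shows "C2_fun \<A> (\<lambda>z. u z - v z)"
  unfolding C2_fun_def
proof
  fix c assume c: "c \<in> \<A>"
  show "Ck_on 2 ((\<lambda>z. u z - v z) \<circ> chart_inv c) (chart_image c)"
    using Ck_on_diff[OF chart_image_open[OF c], of 2 "u \<circ> chart_inv c" "v \<circ> chart_inv c"] assms c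
    by (simp add: C2_fun_def o_def)
qed

lemma hessian_coord_diff:
  assumes c: "c \<in> \<A>" and y: "y \<in> chart_image c" and u: "C2_fun \<A> u" and v: "C2_fun \<A> v"
  shows "hessian_coord \<A> g c (\<lambda>z. u z - v z) y = hessian_coord \<A> g c u y - hessian_coord \<A> g c v y"
    and "partial j ((\<lambda>z. u z - v z) \<circ> chart_inv c) y = partial j (u \<circ> chart_inv c) y - partial j (v \<circ> chart_inv c) y"
proof -
  have 2: "Ck_on 2 (u \<circ> chart_inv c) (chart_image c)" "Ck_on 2 (v \<circ> chart_inv c) (chart_image c)"
    "Ck_on 2 ((\<lambda>z. u z - v z) \<circ> chart_inv c) (chart_image c)"
    using u v C2_fun_diff[OF u v] c by (simp_all add: C2_fun_def)
  have first: "partial j ((\<lambda>z. u z - v z) \<circ> chart_inv c) z = partial j (u \<circ> chart_inv c) z - partial j (v \<circ> chart_inv c) z"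
    if "z \<in> chart_image c" for z j
    using partial_diff[OF Ck_on_2_partial(1)[OF 2(1) that] Ck_on_2_partial(1)[OF 2(2) that], of j]
    by (simp add: o_def)
  then show "partial j ((\<lambda>z. u z - v z) \<circ> chart_inv c) y = partial j (u \<circ> chart_inv c) y - partial j (v \<circ> chart_inv c) y"
    using y by blast
  have second: "partial i (partial j ((\<lambda>z. u z - v z) \<circ> chart_inv c)) y
      = partial i (partial j (u \<circ> chart_inv c)) y - partial i (partial j (v \<circ> chart_inv c)) y" for i j
  proof -
    have "partial i (partial j ((\<lambda>z. u z - v z) \<circ> chart_inv c)) y
        = partial i (\<lambda>z. partial j (u \<circ> chart_inv c) z - partial j (v \<circ> chart_inv c) z) y"
      by (rule partial_cong_open[OF chart_image_open[OF c] y first Ck_on_2_partial(2)[OF 2(3) y]])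
    then show ?thesis
      using partial_diff[OF Ck_on_2_partial(2)[OF 2(1) y] Ck_on_2_partial(2)[OF 2(2) y]] by simp
  qed
  show "hessian_coord \<A> g c (\<lambda>z. u z - v z) y = hessian_coord \<A> g c u y - hessian_coord \<A> g c v y"
    by (simp add: vec_eq_iff hessian_coord_def first[OF y] second right_diff_distrib sum_subtractf)
qed

end

section \<open>Riemannian metric, Hessian and eigenvalues in charts\<close>

text \<open>Coordinate expressions in a chart are those of the matrix-valued function that represents the
  metric there, so that the transformation laws apply.\<close>

lemma christoffel_eq_metric_christoffel:
  "christoffel \<A> g c l j k y
    = metric_christoffel (\<lambda>y. form_matrix \<A> c (chart_inv c y) (g (chart_inv c y))) j k y $ l"
  unfolding christoffel_def metric_christoffel_def metric_coord_def[abs_def] inv_metric_coord_def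
  by (simp add: matrix_vector_mult_def)

lemma hessian_coord_eq_covariant_hessian:
  "hessian_coord \<A> g c u = covariant_hessian (\<lambda>y. form_matrix \<A> c (chart_inv c y) (g (chart_inv c y))) (u \<circ> chart_inv c)"
  by (rule ext) (simp add: hessian_coord_def covariant_hessian_def christoffel_eq_metric_christoffel)

lemma metric_sym_bilinear:
  "riemannian_metric X \<A> g \<Longrightarrow> x \<in> topspace X \<Longrightarrow> sym_bilinear_at \<A> x (g x)"
  by (simp add: riemannian_metric_def)

lemma metric_matrix_Ck:
  "riemannian_metric X \<A> g \<Longrightarrow> c \<in> \<A> \<Longrightarrow>
    Ck_on k (\<lambda>y. form_matrix \<A> c (chart_inv c y) (g (chart_inv c y))) (chart_image c)"
  by (simp add: riemannian_metric_def smooth_on_def)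

lemma charts_at_chart_inv:
  "c \<in> \<A> \<Longrightarrow> y \<in> chart_image c \<Longrightarrow> c \<in> charts_at \<A> (chart_inv c y)"
  using chart_inv_mem[of y c] by (simp add: charts_at_def)

context
  fixes X :: "'a topology" and \<A> :: "('a, 'n::finite) chart set" and g :: "'a \<Rightarrow> ('a, 'n) tform"
  assumes atlas: "smooth_atlas X \<A>" and metric: "riemannian_metric X \<A> g"
begin

lemma spd_metric_matrix:
  assumes c: "c \<in> charts_at \<A> x"
  shows "spd (form_matrix \<A> c x (g x))"
proof -
  have x: "x \<in> topspace X" using charts_at_imp_topspace[OF atlas c] .
  note B = metric_sym_bilinear[OF metric x]
  have "0 < \<xi> \<bullet> (form_matrix \<A> c x (g x) *v \<xi>)" if "\<xi> \<noteq> 0" for \<xi>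
  proof -
    have "tangent_vec \<A> c x \<xi> \<noteq> (\<lambda>_. 0)"
      using tangent_vec_component[OF atlas c, of \<xi>] that by metis
    then have "0 < g x (tangent_vec \<A> c x \<xi>) (tangent_vec \<A> c x \<xi>)"
      using metric x tangent_vec_mem[OF atlas c] unfolding riemannian_metric_def by blast
    then show ?thesis by (simp add: form_on_tangent_vecs[OF atlas c B])
  qed
  then show ?thesis using transpose_form_matrix[OF atlas c B] by (simp add: spd_def)
qed

lemma spd_metric_matrix_coord:
  "c \<in> \<A> \<Longrightarrow> y \<in> chart_image c \<Longrightarrow> spd (form_matrix \<A> c (chart_inv c y) (g (chart_inv c y)))"
  by (intro spd_metric_matrix charts_at_chart_inv)

lemma metric_matrix_entry_Ck:
  assumes "c \<in> \<A>"
  shows "Ck_on k (\<lambda>y. form_matrix \<A> c (chart_inv c y) (g (chart_inv c y)) $ i $ j) (chart_image c)"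
  by (intro Ck_on_linear_compose[OF bounded_linear_vec_nth chart_image_open[OF atlas assms]] metric_matrix_Ck[OF metric] assms)

lemma metric_matrix_transition:
  assumes c: "c \<in> charts_at \<A> x" and d: "d \<in> charts_at \<A> x"
    and z: "z \<in> snd c ` (fst c \<inter> fst d)"
  shows "form_matrix \<A> c (chart_inv c z) (g (chart_inv c z))
    = transpose (jacobian_matrix (transition c d) z)
      ** form_matrix \<A> d (chart_inv d (transition c d z)) (g (chart_inv d (transition c d z)))
      ** jacobian_matrix (transition c d) z"
proof -
  note mem = charts_atD[OF c] charts_atD[OF d]
  obtain q where q: "q \<in> fst c" "q \<in> fst d" "z = snd c q" using z by blast
  have "c \<in> charts_at \<A> q" "d \<in> charts_at \<A> q" using mem q by (simp_all add: charts_at_def)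
  then have "form_matrix \<A> c q (g q) = transpose (jacobian_matrix (transition c d) (snd c q)) ** form_matrix \<A> d q (g q)
    ** jacobian_matrix (transition c d) (snd c q)"
    by (intro form_matrix_change_chart[OF atlas] metric_sym_bilinear[OF metric] charts_at_imp_topspace[OF atlas])
  then show ?thesis using mem q by (simp add: transition_chart[OF atlas] chart_inv_chart[OF atlas])
qed

lemma hessian_coord_change_chart:
  assumes c: "c \<in> charts_at \<A> x" and d: "d \<in> charts_at \<A> x" and u: "C2_fun \<A> u"
  shows "hessian_coord \<A> g c u (snd c x) = transpose (jacobian_matrix (transition c d) (snd c x))
    ** hessian_coord \<A> g d u (snd d x) ** jacobian_matrix (transition c d) (snd c x)"
proof -
  note mem = charts_atD[OF c] charts_atD[OF d]
  let ?G = "\<lambda>e y. form_matrix \<A> e (chart_inv e y) (g (chart_inv e y))"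
  let ?U = "snd c ` (fst c \<inter> fst d)" and ?\<tau> = "transition c d"
  have cd: "?\<tau> (snd c x) = snd d x" using mem by (simp add: transition_chart[OF atlas])
  have im: "snd e x \<in> chart_image e" if "e \<in> charts_at \<A> x" for e
    using charts_atD[OF that] chart_mem_image[of x e] by simp
  have spd: "spd (?G e (snd e x))" if "e \<in> charts_at \<A> x" for e
    using spd_metric_matrix_coord charts_atD[OF that] im[OF that] by simp
  have "covariant_hessian (?G c) (u \<circ> chart_inv c) (snd c x) = transpose (jacobian_matrix ?\<tau> (snd c x))
    ** covariant_hessian (?G d) (u \<circ> chart_inv d) (?\<tau> (snd c x)) ** jacobian_matrix ?\<tau> (snd c x)"
  proof (rule covariant_hessian_of_pullback[where U = ?U and W = "chart_image d"])
    show "open ?U" using mem open_overlap[OF atlas] by simp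
    show "snd c x \<in> ?U" using mem by blast
    show "Ck_on 2 ?\<tau> ?U" using mem transition_Ck[OF atlas] by simp
    show "?G c z = transpose (jacobian_matrix ?\<tau> z) ** ?G d (?\<tau> z) ** jacobian_matrix ?\<tau> z" if "z \<in> ?U" for z
      by (rule metric_matrix_transition[OF c d that])
    show "(\<lambda>z. ?G d z $ a $ b) differentiable (at (?\<tau> (snd c x)))" for a b
      unfolding cd by (rule Ck_on_2_partial(1)[OF metric_matrix_entry_Ck im[OF d]]) (use mem in simp)
    show "transpose (?G d (?\<tau> (snd c x))) = ?G d (?\<tau> (snd c x))"
      unfolding cd using spd[OF d] by (simp add: spd_def)
    show "?G d (?\<tau> (snd c x)) ** matrix_inv (?G d (?\<tau> (snd c x))) = mat 1"
      unfolding cd by (rule spd_matrix_inv(2)[OF spd[OF d]])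
    show "?G c (snd c x) ** matrix_inv (?G c (snd c x)) = mat 1"
      by (rule spd_matrix_inv(2)[OF spd[OF c]])
    show "Ck_on 2 (u \<circ> chart_inv d) (chart_image d)" using u mem by (simp add: C2_fun_def)
    show "?\<tau> ` ?U \<subseteq> chart_image d"
    proof
      fix z assume "z \<in> ?\<tau> ` ?U"
      then obtain q where q: "q \<in> fst c" "q \<in> fst d" "z = ?\<tau> (snd c q)" by blast
      then show "z \<in> chart_image d" using mem by (simp add: transition_chart[OF atlas] chart_mem_image)
    qed
    show "open (chart_image d)" using mem chart_image_open[OF atlas] by simp
    show "(u \<circ> chart_inv c) z = (u \<circ> chart_inv d) (?\<tau> z)" if z: "z \<in> ?U" for z
    proof -
      obtain q where q: "q \<in> fst c" "q \<in> fst d" "z = snd c q" using z by blast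
      then show ?thesis using mem by (simp add: transition_chart[OF atlas] chart_inv_chart[OF atlas])
    qed
  qed
  then show ?thesis unfolding hessian_coord_eq_covariant_hessian cd .
qed

lemma transpose_hessian_coord:
  assumes c: "c \<in> \<A>" and y: "y \<in> chart_image c" and u: "C2_fun \<A> u"
  shows "transpose (hessian_coord \<A> g c u y) = hessian_coord \<A> g c u y"
proof -
  have "partial m (metric_coord \<A> g c j k) y = partial m (metric_coord \<A> g c k j) y" for m j k
  proof (rule partial_cong_open[OF chart_image_open[OF atlas c] y])
    fix z assume z: "z \<in> chart_image c"
    have "transpose (form_matrix \<A> c (chart_inv c z) (g (chart_inv c z))) = form_matrix \<A> c (chart_inv c z) (g (chart_inv c z))"
      using spd_metric_matrix_coord[OF c z] by (simp add: spd_def)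
    from arg_cong[OF this, of "\<lambda>M. M $ k $ j"]
    show "metric_coord \<A> g c j k z = metric_coord \<A> g c k j z" by (simp add: metric_coord_def transpose_def)
  next
    show "metric_coord \<A> g c j k differentiable (at y)"
      unfolding metric_coord_def[abs_def] by (rule Ck_on_2_partial(1)[OF metric_matrix_entry_Ck[OF c] y])
  qed
  then have chr: "christoffel \<A> g c l j k y = christoffel \<A> g c l k j y" for l j k
    unfolding christoffel_def by (simp add: add.commute)
  have "Ck_on 2 (u \<circ> chart_inv c) (chart_image c)" using u c by (simp add: C2_fun_def)
  then have mixed: "partial j (partial k (u \<circ> chart_inv c)) y = partial k (partial j (u \<circ> chart_inv c)) y" for j k
    using chart_image_open[OF atlas c] y by (rule partial_partial_symmetric)
  have "hessian_coord \<A> g c u y $ k $ j = hessian_coord \<A> g c u y $ j $ k" for j k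
    unfolding hessian_coord_def vec_lambda_beta mixed[of j k] chr[of _ j k] ..
  then show ?thesis by (simp add: transpose_def vec_eq_iff)
qed

lemma hessian_sym_bilinear:
  assumes x: "x \<in> topspace X" and u: "C2_fun \<A> u"
  shows "sym_bilinear_at \<A> x (hessian \<A> g u x)"
proof -
  have d: "chart_at \<A> x \<in> charts_at \<A> x" by (rule chart_at_mem[OF atlas x])
  have "transpose (hessian_coord \<A> g (chart_at \<A> x) u (snd (chart_at \<A> x) x)) = hessian_coord \<A> g (chart_at \<A> x) u (snd (chart_at \<A> x) x)"
    by (rule transpose_hessian_coord) (use charts_atD[OF d] u in \<open>simp_all add: chart_mem_image\<close>)
  from symmetric_matrix_form[OF this]
  show ?thesis unfolding sym_bilinear_at_def linear_functional_at_def hessian_def Let_def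
    by (auto simp: matrix_vector_right_distrib matrix_vector_mult_scaleR inner_right_distrib simp del: split_paired_All)
qed

text \<open>The form \<open>hessian\<close> is defined through one chosen chart at \<open>x\<close>; by the transformation law
  its matrix in any other chart is given by the coordinate formula in that chart.\<close>

lemma form_matrix_hessian:
  assumes c: "c \<in> charts_at \<A> x" and u: "C2_fun \<A> u"
  shows "form_matrix \<A> c x (hessian \<A> g u x) = hessian_coord \<A> g c u (snd c x)"
proof -
  define d where "d = chart_at \<A> x"
  have x: "x \<in> topspace X" by (rule charts_at_imp_topspace[OF atlas c])
  have d: "d \<in> charts_at \<A> x" unfolding d_def by (rule chart_at_mem[OF atlas x])
  let ?J = "jacobian_matrix (transition c d) (snd c x)"
  have "form_matrix \<A> c x (hessian \<A> g u x) = transpose ?J ** hessian_coord \<A> g d u (snd d x) ** ?J"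
  proof (rule matrix_eq_congruenceI)
    fix \<xi> \<eta>
    have comp: "tangent_vec \<A> c x \<zeta> d = ?J *v \<zeta>" for \<zeta>
      using d by (simp add: tangent_vec_def jacobian_matrix_transition[OF atlas c d])
    show "\<xi> \<bullet> (form_matrix \<A> c x (hessian \<A> g u x) *v \<eta>) = (?J *v \<xi>) \<bullet> (hessian_coord \<A> g d u (snd d x) *v (?J *v \<eta>))"
      using form_on_tangent_vecs[OF atlas c hessian_sym_bilinear[OF x u], of \<xi> \<eta>]
      by (simp add: hessian_def[of \<A> g u x] Let_def d_def[symmetric] comp)
  qed
  then show ?thesis by (simp add: hessian_coord_change_chart[OF c d u])
qed

text \<open>The vector \<open>w\<close> is the covector with its index raised, so the norm of the covector is the length of \<open>w\<close>. Since
  \<open>covec_norm\<close> is computed in one chosen chart, the vector is found there and then transported to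
  the chart \<open>c\<close>.\<close>

lemma covec_norm_as_dual_vector:
  assumes c: "c \<in> charts_at \<A> x"
  obtains w where "\<eta> = form_matrix \<A> c x (g x) *v w"
    "covec_norm \<A> g (coord_covec \<A> c x \<eta>) = sqrt (w \<bullet> (form_matrix \<A> c x (g x) *v w))"
proof -
  define d where "d = chart_at \<A> x"
  have x: "x \<in> topspace X" by (rule charts_at_imp_topspace[OF atlas c])
  have d: "d \<in> charts_at \<A> x" unfolding d_def by (rule chart_at_mem[OF atlas x])
  define J where "J = jacobian_matrix (transition d c) (snd d x)"
  define Gc where "Gc = form_matrix \<A> c x (g x)"
  define Gd where "Gd = form_matrix \<A> d x (g x)"
  define \<xi> where "\<xi> = transpose J *v \<eta>"
  have G: "Gd = transpose J ** Gc ** J"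
    unfolding Gd_def Gc_def J_def by (rule form_matrix_change_chart[OF atlas d c metric_sym_bilinear[OF metric x]])
  have inv: "Gd ** matrix_inv Gd = mat 1"
    unfolding Gd_def by (rule spd_matrix_inv(2)[OF spd_metric_matrix[OF d]])
  have val: "snd (coord_covec \<A> c x \<eta>) (coord_vec \<A> d x j) = \<xi> $ j" for j
  proof -
    have "coord_vec \<A> d x j c = J *v axis j 1"
      unfolding coord_vec_def using c by (simp add: tangent_vec_def jacobian_matrix_transition[OF atlas d c] J_def)
    then have "snd (coord_covec \<A> c x \<eta>) (coord_vec \<A> d x j) = \<eta> \<bullet> (J *v axis j 1)"
      using coord_vec_mem[OF atlas d] by (simp add: coord_covec_def)
    also have "\<dots> = \<xi> \<bullet> axis j 1" unfolding \<xi>_def by (simp add: dot_lmul_matrix transpose_matrix_vector)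
    finally show ?thesis by (simp add: inner_axis)
  qed
  have dx: "chart_inv d (snd d x) = x" using charts_atD[OF d] chart_inv_chart[OF atlas] by simp
  define \<zeta> where "\<zeta> = matrix_inv Gd *v \<xi>"
  have "covec_norm \<A> g (coord_covec \<A> c x \<eta>)
      = sqrt (\<Sum>j\<in>UNIV. \<Sum>k\<in>UNIV. matrix_inv Gd $ j $ k * \<xi> $ j * \<xi> $ k)"
    unfolding covec_norm_def Let_def
    by (simp add: coord_covec_def d_def[symmetric] val[unfolded coord_covec_def, simplified] inv_metric_coord_def dx Gd_def)
  also have "(\<Sum>j\<in>UNIV. \<Sum>k\<in>UNIV. matrix_inv Gd $ j $ k * \<xi> $ j * \<xi> $ k) = \<xi> \<bullet> \<zeta>"
    by (simp add: \<zeta>_def inner_vec_def matrix_vector_mult_def sum_distrib_left mult_ac)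
  finally have norm: "covec_norm \<A> g (coord_covec \<A> c x \<eta>) = sqrt (\<xi> \<bullet> \<zeta>)" .
  have \<xi>: "\<xi> = Gd *v \<zeta>" unfolding \<zeta>_def by (simp add: matrix_vector_mul_assoc inv)
  define w where "w = J *v \<zeta>"
  have "invertible (transpose J)"
    using inv unfolding G
    by (metis invertible_det_nz det_mul det_I mult_zero_left zero_neq_one)
  moreover have "transpose J *v \<eta> = transpose J *v (Gc *v w)"
    using \<xi> unfolding \<xi>_def G w_def by (simp add: matrix_vector_mul_assoc matrix_mul_assoc)
  ultimately have \<eta>: "\<eta> = Gc *v w" by (metis inj_matrix_vector_mult injD)
  have "\<xi> \<bullet> \<zeta> = \<eta> \<bullet> w" unfolding \<xi>_def w_def by (simp add: dot_lmul_matrix transpose_matrix_vector)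
  then show thesis using that[of w] norm \<eta> by (simp add: Gc_def inner_commute)
qed

lemma continuous_on_hessian_coord:
  assumes c: "c \<in> \<A>" and u: "C2_fun \<A> u"
  shows "continuous_on (chart_image c) (hessian_coord \<A> g c u)"
proof -
  let ?G = "\<lambda>y. form_matrix \<A> c (chart_inv c y) (g (chart_inv c y))"
  have u2: "Ck_on 2 (u \<circ> chart_inv c) (chart_image c)" using u c by (simp add: C2_fun_def)
  have G: "continuous_on (chart_image c) (partial m (metric_coord \<A> g c j k))" for m j k
    unfolding metric_coord_def[abs_def] by (rule Ck_on_2_partial(3)[OF metric_matrix_entry_Ck[OF c]])
  have "continuous_on (chart_image c) (\<lambda>y. matrix_inv (?G y))"
    by (rule continuous_on_matrix_inv[OF Ck_on_imp_continuous_on[OF metric_matrix_Ck[OF metric c]] spd_metric_matrix_coord[OF c]])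
  then have "continuous_on (chart_image c) (inv_metric_coord \<A> g c j k)" for j k
    unfolding inv_metric_coord_def[abs_def] by (intro continuous_intros)
  then have "continuous_on (chart_image c) (christoffel \<A> g c l j k)" for l j k
    unfolding christoffel_def[abs_def] by (intro continuous_intros G)
  then have "continuous_on (chart_image c) (\<lambda>y. hessian_coord \<A> g c u y $ j $ k)" for j k
    unfolding hessian_coord_def using Ck_on_2_partial(3,4)[OF u2]
    by (simp add: continuous_intros)
  then have "continuous_on (chart_image c) (\<lambda>y. \<chi> j k. hessian_coord \<A> g c u y $ j $ k)"
    by (intro continuous_on_vec_lambda)
  then show ?thesis by simp
qed

end

text \<open>Metric and form undergo the same congruence under a change of charts.\<close>

lemma lambda_vec_in_chart:
  fixes \<A> :: "('a, 'n::{finite,linorder}) chart set"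
  assumes atlas: "smooth_atlas X \<A>" and metric: "riemannian_metric X \<A> g"
    and c: "c \<in> charts_at \<A> x" and B: "sym_bilinear_at \<A> x B"
  shows "lambda_vec \<A> g x B = eigenvalue_vec (matrix_inv (form_matrix \<A> c x (g x)) ** form_matrix \<A> c x B)"
proof -
  define d where "d = chart_at \<A> x"
  have x: "x \<in> topspace X" by (rule charts_at_imp_topspace[OF atlas c])
  have d: "d \<in> charts_at \<A> x" unfolding d_def by (rule chart_at_mem[OF atlas x])
  let ?J = "jacobian_matrix (transition c d) (snd c x)"
  have G: "form_matrix \<A> c x (g x) = transpose ?J ** form_matrix \<A> d x (g x) ** ?J"
    by (rule form_matrix_change_chart[OF atlas c d metric_sym_bilinear[OF metric x]])
  have "eigenvalue_vec (matrix_inv (form_matrix \<A> c x (g x)) ** form_matrix \<A> c x B)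
      = eigenvalue_vec (matrix_inv (form_matrix \<A> d x (g x)) ** form_matrix \<A> d x B)"
    unfolding G form_matrix_change_chart[OF atlas c d B]
    by (rule eigenvalue_vec_congruence[OF spd_metric_matrix[OF atlas metric d]])
      (use spd_metric_matrix[OF atlas metric c] in \<open>simp add: G\<close>)
  then show ?thesis by (simp add: lambda_vec_def Let_def d_def)
qed

section \<open>The pseudo-supersolution condition\<close>

lemma sigma_card_le:
  fixes \<mu> :: "real^'n"
  assumes "\<And>i. 0 \<le> \<mu> $ i" "\<And>i. \<mu> $ i \<le> M"
  shows "sigma CARD('n) \<mu> \<le> M ^ CARD('n)"
proof -
  have "{J :: 'n set. card J = CARD('n)} = {UNIV}" by (auto dest: card_eq_UNIV_imp_eq_UNIV[rotated])
  then have "sigma CARD('n) \<mu> = (\<Prod>i\<in>UNIV. \<mu> $ i)" by (simp add: sigma_def)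
  also have "\<dots> \<le> (\<Prod>i\<in>(UNIV::'n set). M)" using assms by (intro prod_mono) auto
  finally show ?thesis by simp
qed

text \<open>Near \<open>x0\<close> everything is expressed in one chart, where it depends continuously on the point and
  on the coordinates \<open>\<zeta>\<close> of \<open>d(u - ul)\<close>. At \<open>x0\<close> and \<open>\<zeta> = 0\<close> the data are those of \<open>ul\<close>, so for nearby
  points and small \<open>\<zeta>\<close> they are perturbations to which \<open>top_eigenvalue_bound\<close> applies.\<close>

lemma local_top_eigenvalue_bound:
  fixes X :: "'a topology"
    and \<A> :: "('a, 'n::{finite,linorder}) chart set"
    and g :: "'a \<Rightarrow> ('a, 'n) tform"
    and A :: "('a, 'n) covec \<Rightarrow> real \<Rightarrow> ('a, 'n) tform"
    and \<phi> :: "('a, 'n) covec \<Rightarrow> real \<Rightarrow> real"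
  assumes atlas: "smooth_atlas X \<A>" and metric: "riemannian_metric X \<A> g" and p: "1 \<le> p"
    and A: "smooth_form_field X \<A> A" and \<phi>: "smooth_positive_fun X \<A> \<phi>"
    and At: "\<forall>\<alpha>\<in>cotangent_bundle X \<A>. \<forall>s t.
           \<forall>v\<in>tangent_space \<A> (fst \<alpha>). \<forall>w\<in>tangent_space \<A> (fst \<alpha>). A \<alpha> s v w = A \<alpha> t v w"
    and \<phi>t: "\<forall>\<alpha>\<in>cotangent_bundle X \<A>. \<forall>s t. \<phi> \<alpha> s = \<phi> \<alpha> t"
    and ul: "C2_fun \<A> ul" and x0: "x0 \<in> topspace X"
    and \<Gamma>: "lambda_vec \<A> g x0 (hessian_op \<A> g A ul x0) + R *\<^sub>R last_unit_vec \<in> Gamma_cone p"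
  shows "\<exists>U \<delta> T. openin X U \<and> x0 \<in> U \<and> 0 < \<delta> \<and>
    (\<forall>u. is_solution X \<A> g p A \<phi> u \<longrightarrow> (\<forall>x\<in>U.
       (\<forall>i. - \<delta> \<le> lambda_vec \<A> g x (hessian \<A> g (\<lambda>z. u z - ul z) x) $ i) \<longrightarrow>
       covec_norm \<A> g (differential \<A> (\<lambda>z. u z - ul z) x) \<le> \<delta> \<longrightarrow>
       (\<forall>i. lambda_vec \<A> g x (hessian \<A> g (\<lambda>z. u z - ul z) x) $ i \<le> T)))"
proof -
  define c where "c = chart_at \<A> x0"
  have c0: "c \<in> charts_at \<A> x0" unfolding c_def by (rule chart_at_mem[OF atlas x0])
  have c: "c \<in> \<A>" and x0c: "x0 \<in> fst c" using charts_atD[OF c0] by simp_all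
  define y0 where "y0 = snd c x0"
  have y0: "y0 \<in> chart_image c" unfolding y0_def by (rule chart_mem_image[OF x0c])
  have y0x0: "chart_inv c y0 = x0" unfolding y0_def by (rule chart_inv_chart[OF atlas c x0c])
  have opn: "open (chart_image c)" by (rule chart_image_open[OF atlas c])
  define grad where "grad u y = (\<chi> j. partial j (u \<circ> chart_inv c) y)" for u y
  define G where "G y = form_matrix \<A> c (chart_inv c y) (g (chart_inv c y))" for y
  \<comment> \<open>Independence of \<open>t\<close> allows the value of \<open>u\<close> to be replaced by \<open>0\<close> in \<open>A\<close> and \<open>\<phi>\<close>. This makes the
    bounds uniform in \<open>u\<close>, although the values of solutions may be unbounded.\<close>
  define AA where "AA y \<xi> = form_matrix \<A> c (chart_inv c y) (A (coord_covec \<A> c (chart_inv c y) \<xi>) 0)" for y \<xi>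
  define W where "W y \<zeta> = AA y (grad ul y + \<zeta>) + hessian_coord \<A> g c ul y" for y \<zeta>
  define \<Phi> where "\<Phi> y \<zeta> = \<phi> (coord_covec \<A> c (chart_inv c y) (grad ul y + \<zeta>)) 0" for y \<zeta>

  have charts: "c \<in> charts_at \<A> x" "x \<in> topspace X" if "x \<in> fst c" for x
  proof -
    show 1: "c \<in> charts_at \<A> x" using c that by (simp add: charts_at_def)
    show "x \<in> topspace X" by (rule charts_at_imp_topspace[OF atlas 1])
  qed
  have op_matrix: "sym_bilinear_at \<A> x (hessian_op \<A> g A u x) \<and>
      form_matrix \<A> c x (hessian_op \<A> g A u x) = AA (snd c x) (grad u (snd c x)) + hessian_coord \<A> g c u (snd c x)"
    if x: "x \<in> fst c" and u: "C2_fun \<A> u" for x u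
  proof -
    define \<alpha> where "\<alpha> = differential \<A> u x"
    have inv: "chart_inv c (snd c x) = x" by (rule chart_inv_chart[OF atlas c x])
    have \<alpha>: "\<alpha> = coord_covec \<A> c x (grad u (snd c x))"
      unfolding \<alpha>_def grad_def by (rule differential_in_chart[OF atlas charts(1)[OF x] u])
    have mem: "\<alpha> \<in> cotangent_bundle X \<A>" unfolding \<alpha> by (rule coord_covec_mem[OF atlas charts(1)[OF x]])
    have fst: "fst \<alpha> = x" by (simp add: \<alpha> coord_covec_def)
    have symA: "sym_bilinear_at \<A> x (A \<alpha> t)" for t
      using A mem fst unfolding smooth_form_field_def by blast
    have H: "sym_bilinear_at \<A> x (hessian \<A> g u x)" by (rule hessian_sym_bilinear[OF atlas metric charts(2)[OF x] u])
    have op: "hessian_op \<A> g A u x = (\<lambda>v w. 1 * A \<alpha> (u x) v w + hessian \<A> g u x v w)"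
      by (simp add: hessian_op_def \<alpha>_def)
    have "form_matrix \<A> c x (A \<alpha> (u x)) = form_matrix \<A> c x (A \<alpha> 0)"
      using At mem fst coord_vec_mem[OF atlas charts(1)[OF x]] unfolding form_matrix_def by (simp add: vec_eq_iff)
    then have "form_matrix \<A> c x (A \<alpha> (u x)) = AA (snd c x) (grad u (snd c x))"
      unfolding AA_def inv \<alpha> .
    then have "form_matrix \<A> c x (hessian_op \<A> g A u x) = AA (snd c x) (grad u (snd c x)) + hessian_coord \<A> g c u (snd c x)"
      unfolding op form_matrix_combination form_matrix_hessian[OF atlas metric charts(1)[OF x] u] by simp
    moreover have "sym_bilinear_at \<A> x (hessian_op \<A> g A u x)"
      unfolding op by (rule sym_bilinear_at_combination[OF symA H])
    ultimately show ?thesis by blast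
  qed
  have symAA: "transpose (AA y \<xi>) = AA y \<xi>" if "y \<in> chart_image c" for y \<xi>
  proof -
    have y: "c \<in> charts_at \<A> (chart_inv c y)" by (rule charts_at_chart_inv[OF c that])
    have "sym_bilinear_at \<A> (chart_inv c y) (A (coord_covec \<A> c (chart_inv c y) \<xi>) 0)"
    proof -
      let ?\<alpha> = "coord_covec \<A> c (chart_inv c y) \<xi>"
      have "sym_bilinear_at \<A> (fst ?\<alpha>) (A ?\<alpha> 0)"
        using A coord_covec_mem[OF atlas y] unfolding smooth_form_field_def by blast
      then show ?thesis by (simp add: coord_covec_def)
    qed
    then show ?thesis unfolding AA_def by (rule transpose_form_matrix[OF atlas y])
  qed
  have symW: "transpose (W y \<zeta>) = W y \<zeta>" if "y \<in> chart_image c" for y \<zeta>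
    using symAA[OF that] transpose_hessian_coord[OF atlas metric c that ul]
    by (simp add: W_def transpose_def vec_eq_iff)
  have spdG: "spd (G y)" if "y \<in> chart_image c" for y
    unfolding G_def by (rule spd_metric_matrix_coord[OF atlas metric c that])

  \<comment> \<open>All data are jointly continuous in the point \<open>y\<close> and the deviation \<open>\<zeta>\<close>.\<close>
  let ?D = "chart_image c \<times> (UNIV :: (real^'n::{finite,linorder}) set)"
  have ul2: "Ck_on 2 (ul \<circ> chart_inv c) (chart_image c)" using ul c by (simp add: C2_fun_def)
  have cgrad: "continuous_on (chart_image c) (grad ul)"
    unfolding grad_def by (intro continuous_on_vec_lambda Ck_on_2_partial(3)[OF ul2])
  have cpt: "continuous_on ?D (\<lambda>z. (fst z, grad ul (fst z) + snd z, 0::real))"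
    by (intro continuous_intros continuous_on_compose2[OF cgrad]) auto
  have img: "(\<lambda>z. (fst z, grad ul (fst z) + snd z, 0::real)) ` ?D \<subseteq> chart_image c \<times> UNIV \<times> UNIV"
    by auto
  have "Ck_on 0 (\<lambda>(y, \<xi>, t). form_matrix \<A> c (chart_inv c y) (A (coord_covec \<A> c (chart_inv c y) \<xi>) t)) (chart_image c \<times> UNIV \<times> UNIV)"
    using A c unfolding smooth_form_field_def smooth_on_def by blast
  from continuous_on_compose2[OF this[unfolded Ck_on.simps] cpt img]
  have "continuous_on ?D (\<lambda>z. AA (fst z) (grad ul (fst z) + snd z))"
    unfolding AA_def by simp
  then have cW: "continuous_on ?D (\<lambda>z. W (fst z) (snd z))"
    unfolding W_def
    by (intro continuous_intros continuous_on_compose2[OF continuous_on_hessian_coord[OF atlas metric c ul]]) auto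
  have "Ck_on 0 (\<lambda>(y, \<xi>, t). \<phi> (coord_covec \<A> c (chart_inv c y) \<xi>) t) (chart_image c \<times> UNIV \<times> UNIV)"
    using \<phi> c unfolding smooth_positive_fun_def smooth_on_def by blast
  from continuous_on_compose2[OF this[unfolded Ck_on.simps] cpt img]
  have c\<Phi>: "continuous_on ?D (\<lambda>z. \<Phi> (fst z) (snd z))"
    unfolding \<Phi>_def by simp
  have "continuous_on (chart_image c) G"
    unfolding G_def by (rule Ck_on_imp_continuous_on[OF metric_matrix_Ck[OF metric c]])
  then have cG: "continuous_on ?D (\<lambda>z. G (fst z))"
    by (rule continuous_on_compose2[OF _ continuous_on_fst[OF continuous_on_id]]) auto

  \<comment> \<open>The right-hand side of the equation stays below \<open>\<Phi> y0 0 + 1\<close> near \<open>(y0, 0)\<close>; since the bound \<open>T\<close>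
    depends on \<open>C\<close>, this number is fixed before the neighbourhood is chosen.\<close>
  define C where "C = (\<Phi> y0 0 + 1) ^ p"
  have "lambda_vec \<A> g x0 (hessian_op \<A> g A ul x0) = eigenvalue_vec (matrix_inv (G y0) ** W y0 0)"
    using lambda_vec_in_chart[OF atlas metric c0] op_matrix[OF x0c ul]
    by (simp add: G_def W_def y0x0 y0_def[symmetric])
  then have \<Gamma>0: "eigenvalue_vec (matrix_inv (G y0) ** W y0 0) + R *\<^sub>R last_unit_vec \<in> Gamma_cone p"
    using \<Gamma> by simp
  obtain \<epsilon> \<delta> T where \<epsilon>: "0 < \<epsilon>" and \<delta>: "0 < \<delta>" and bound:
    "\<And>G' W' H i. spd G' \<Longrightarrow> transpose W' = W' \<Longrightarrow> transpose H = H \<Longrightarrow> norm (G' - G y0) < \<epsilon> \<Longrightarrow>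
       norm (W' - W y0 0) < \<epsilon> \<Longrightarrow> (\<And>i. - \<delta> \<le> eigenvalue_vec (matrix_inv G' ** H) $ i) \<Longrightarrow>
       sigma p (eigenvalue_vec (matrix_inv G' ** (W' + H))) \<le> C \<Longrightarrow>
       eigenvalue_vec (matrix_inv G' ** H) $ i \<le> T"
    using top_eigenvalue_bound[OF spdG[OF y0] symW[OF y0] p \<Gamma>0, of C] by metis
  obtain \<epsilon>' K where \<epsilon>': "0 < \<epsilon>'" and K: "0 < K"
    "\<And>G' w. norm (G' - G y0) < \<epsilon>' \<Longrightarrow> norm (G' *v w) \<le> K * sqrt (w \<bullet> (G' *v w))"
    using dual_vector_bound[OF spdG[OF y0]] by metis
  have openD: "open ?D" using opn by (intro open_Times) auto
  have z0: "(y0, 0) \<in> ?D" using y0 by simp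
  have lim: "((\<lambda>z. F (fst z) (snd z)) \<longlongrightarrow> F y0 0) (nhds (y0, 0))"
    if "continuous_on ?D (\<lambda>z. F (fst z) (snd z))" for F :: "real^'n::{finite,linorder} \<Rightarrow> real^'n::{finite,linorder} \<Rightarrow> 'z::topological_space"
    using that openD z0 continuous_on_eq_continuous_at[OF openD] isCont_def tendsto_at_iff_tendsto_nhds
    by (metis (no_types, lifting) fst_conv snd_conv)
  have "\<forall>\<^sub>F z in nhds (y0, 0). dist (W (fst z) (snd z)) (W y0 0) < \<epsilon> \<and> dist (G (fst z)) (G y0) < min \<epsilon> \<epsilon>'
      \<and> \<Phi> (fst z) (snd z) < \<Phi> y0 0 + 1 \<and> z \<in> ?D"
    using \<epsilon> \<epsilon>' lim[OF cG] openD z0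
    by (intro eventually_conj tendstoD[OF lim[OF cW]] tendstoD[OF lim[OF cG]] order_tendstoD(2)[OF lim[OF c\<Phi>]]
        eventually_nhds_in_open) auto
  then obtain r where r: "0 < r" and near: "\<And>z. dist z (y0, 0) < r \<Longrightarrow>
      dist (W (fst z) (snd z)) (W y0 0) < \<epsilon> \<and> dist (G (fst z)) (G y0) < min \<epsilon> \<epsilon>'
      \<and> \<Phi> (fst z) (snd z) < \<Phi> y0 0 + 1 \<and> z \<in> ?D"
    unfolding eventually_nhds_metric by blast
  define U where "U = {x \<in> fst c. snd c x \<in> ball y0 (r / 2)}"
  \<comment> \<open>A covector of norm at most \<open>\<delta>'\<close> has coordinates of norm at most \<open>r / 4\<close>.\<close>
  define \<delta>' where "\<delta>' = min \<delta> (r / (4 * K))"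
  have \<delta>': "0 < \<delta>'" "\<delta>' \<le> \<delta>" "K * \<delta>' < r / 2"
  proof -
    show "0 < \<delta>'" "\<delta>' \<le> \<delta>" using \<delta> r K(1) by (simp_all add: \<delta>'_def)
    have "\<delta>' \<le> r / (4 * K)" by (simp add: \<delta>'_def)
    then have "K * \<delta>' \<le> r / 4" using K(1) by (simp add: field_simps)
    then show "K * \<delta>' < r / 2" using r by simp
  qed
  have U: "openin X U"
  proof -
    have "continuous_map (subtopology X (fst c)) euclidean (snd c)"
      using homeomorphic_imp_continuous_map[OF chart_homeomorphic_map[OF atlas c]]
      by (simp add: continuous_map_in_subtopology)
    then have "openin (subtopology X (fst c)) {x \<in> topspace (subtopology X (fst c)). snd c x \<in> ball y0 (r / 2)}"
      by (rule openin_continuous_map_preimage) simp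
    moreover have "topspace (subtopology X (fst c)) = fst c"
      using openin_subset[OF chart_domain_open[OF atlas c]] by auto
    ultimately have "openin (subtopology X (fst c)) U" unfolding U_def by metis
    then show ?thesis using openin_open_subtopology[OF chart_domain_open[OF atlas c]] by blast
  qed
  have "lambda_vec \<A> g x (hessian \<A> g (\<lambda>z. u z - ul z) x) $ i \<le> T"
    if sol: "is_solution X \<A> g p A \<phi> u" and xU: "x \<in> U"
      and low: "\<And>i. - \<delta>' \<le> lambda_vec \<A> g x (hessian \<A> g (\<lambda>z. u z - ul z) x) $ i"
      and small: "covec_norm \<A> g (differential \<A> (\<lambda>z. u z - ul z) x) \<le> \<delta>'" for u x i
  proof -
    define w where "w = (\<lambda>z. u z - ul z)"
    have u: "C2_fun \<A> u" using sol by (simp add: is_solution_def)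
    have w: "C2_fun \<A> w" unfolding w_def by (rule C2_fun_diff[OF atlas u ul])
    have xc: "x \<in> fst c" using xU by (simp add: U_def)
    note ch = charts[OF xc]
    define y where "y = snd c x"
    define \<zeta> where "\<zeta> = grad w y"
    define H where "H = hessian_coord \<A> g c w y"
    have y: "y \<in> chart_image c" unfolding y_def by (rule chart_mem_image[OF xc])
    have yx: "chart_inv c y = x" unfolding y_def by (rule chart_inv_chart[OF atlas c xc])
    have dy: "dist y y0 < r / 2" using xU by (simp add: U_def y_def dist_commute)
    have Gx: "form_matrix \<A> c x (g x) = G y" by (simp add: G_def yx)
    have "dist (y, 0) (y0, 0) < r" using dy r by (simp add: dist_Pair_Pair)
    then have nearG: "dist (G y) (G y0) < min \<epsilon> \<epsilon>'" using near by fastforce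
    \<comment> \<open>The smallness of \<open>dw\<close> is given in the metric norm, but closeness in the chart refers to its coordinates.\<close>
    obtain q where q: "\<zeta> = G y *v q" "covec_norm \<A> g (coord_covec \<A> c x \<zeta>) = sqrt (q \<bullet> (G y *v q))"
      using covec_norm_as_dual_vector[OF atlas metric ch(1), of \<zeta>] unfolding Gx by metis
    have "differential \<A> w x = coord_covec \<A> c x \<zeta>"
      unfolding \<zeta>_def grad_def y_def by (rule differential_in_chart[OF atlas ch(1) w])
    then have "sqrt (q \<bullet> (G y *v q)) \<le> \<delta>'" using small q(2) by (simp add: w_def)
    then have "norm \<zeta> \<le> K * \<delta>'"
      unfolding q(1) using K nearG by (intro order_trans[OF K(2)]) (auto simp: dist_norm)
    then have n\<zeta>: "norm \<zeta> < r / 2" using \<delta>'(3) by simp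
    have "dist (y, \<zeta>) (y0, 0) \<le> dist y y0 + dist \<zeta> 0"
      unfolding dist_Pair_Pair by (rule sqrt_sum_squares_le_sum) auto
    then have "dist (y, \<zeta>) (y0, 0) < r" using dy n\<zeta> by simp
    from near[OF this] have nearW: "dist (W y \<zeta>) (W y0 0) < \<epsilon>" and near\<Phi>: "\<Phi> y \<zeta> < \<Phi> y0 0 + 1" by simp_all
    \<comment> \<open>In the chart the operator splits as \<open>W y \<zeta> + H\<close>, a small perturbation of the data of \<open>ul\<close> plus the
      Hessian of \<open>w\<close>.\<close>
    have gradu: "grad u y = grad ul y + \<zeta>"
      unfolding \<zeta>_def grad_def w_def hessian_coord_diff(2)[OF atlas c y u ul] by (simp add: vec_eq_iff)
    have hessu: "hessian_coord \<A> g c u y = hessian_coord \<A> g c ul y + H"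
      unfolding H_def w_def hessian_coord_diff(1)[OF atlas c y u ul] by simp
    have "form_matrix \<A> c x (hessian_op \<A> g A u x) = W y \<zeta> + H"
      using op_matrix[OF xc u] by (simp add: W_def y_def[symmetric] gradu hessu)
    then have lamu: "lambda_vec \<A> g x (hessian_op \<A> g A u x) = eigenvalue_vec (matrix_inv (G y) ** (W y \<zeta> + H))"
      using lambda_vec_in_chart[OF atlas metric ch(1)] op_matrix[OF xc u] by (simp add: Gx)
    have lamw: "lambda_vec \<A> g x (hessian \<A> g w x) = eigenvalue_vec (matrix_inv (G y) ** H)"
      using lambda_vec_in_chart[OF atlas metric ch(1) hessian_sym_bilinear[OF atlas metric ch(2) w]]
      by (simp add: form_matrix_hessian[OF atlas metric ch(1) w] Gx H_def y_def)
    have du: "differential \<A> u x = coord_covec \<A> c x (grad ul y + \<zeta>)"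
    proof -
      have "differential \<A> u x = coord_covec \<A> c x (grad u y)"
        unfolding grad_def y_def by (rule differential_in_chart[OF atlas ch(1) u])
      then show ?thesis unfolding gradu .
    qed
    have mem: "differential \<A> u x \<in> cotangent_bundle X \<A>"
      unfolding du by (rule coord_covec_mem[OF atlas ch(1)])
    have "\<phi> (differential \<A> u x) (u x) = \<phi> (differential \<A> u x) 0" using \<phi>t mem by blast
    then have "root p (sigma p (lambda_vec \<A> g x (hessian_op \<A> g A u x))) = \<Phi> y \<zeta>"
      using sol ch(2) by (simp add: is_solution_def \<Phi>_def yx du)
    moreover have "0 < sigma p (lambda_vec \<A> g x (hessian_op \<A> g A u x))"
      using sol ch(2) p by (auto simp: is_solution_def Gamma_cone_def)
    ultimately have sig: "sigma p (lambda_vec \<A> g x (hessian_op \<A> g A u x)) = \<Phi> y \<zeta> ^ p" and "0 < \<Phi> y \<zeta>"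
      using p by (metis less_le_trans real_root_pow_pos zero_less_one, metis less_le_trans real_root_gt_zero zero_less_one)
    have "sigma p (eigenvalue_vec (matrix_inv (G y) ** (W y \<zeta> + H))) \<le> C"
      unfolding lamu[symmetric] sig C_def using near\<Phi> \<open>0 < \<Phi> y \<zeta>\<close> by (intro power_mono) auto
    moreover have "- \<delta> \<le> eigenvalue_vec (matrix_inv (G y) ** H) $ i" for i
      using low[of i] \<delta>'(2) lamw by (simp add: w_def)
    moreover have "transpose H = H" unfolding H_def by (rule transpose_hessian_coord[OF atlas metric c y w])
    ultimately have "eigenvalue_vec (matrix_inv (G y) ** H) $ i \<le> T"
      using nearG nearW by (intro bound[OF spdG[OF y] symW[OF y]]) (auto simp: dist_norm)
    then show ?thesis using lamw by (simp add: w_def)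
  qed
  moreover have "x0 \<in> U" using x0c r by (simp add: U_def y0_def)
  ultimately show ?thesis using U \<delta>'(1) by blast
qed

theorem proposition3p8:
  fixes X :: "'a topology"
    and \<A> :: "('a, 'n::{finite,linorder}) chart set"
    and g :: "'a \<Rightarrow> ('a, 'n) tform"
    and A :: "('a, 'n) covec \<Rightarrow> real \<Rightarrow> ('a, 'n) tform"
    and \<phi> :: "('a, 'n) covec \<Rightarrow> real \<Rightarrow> real"
    and ul :: "'a \<Rightarrow> real"
    and p :: nat
    and R :: real
  assumes "closed_manifold X \<A>"
    and "connected_space X"
    and "riemannian_metric X \<A> g"
    and "p \<in> {1..CARD('n)}"
    and "smooth_form_field X \<A> A"
    and "smooth_positive_fun X \<A> \<phi>"
    and "R \<ge> 0"
    and "\<forall>\<alpha>\<in>cotangent_bundle X \<A>. \<forall>s t.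
           \<forall>v\<in>tangent_space \<A> (fst \<alpha>). \<forall>w\<in>tangent_space \<A> (fst \<alpha>). A \<alpha> s v w = A \<alpha> t v w"
    and "\<forall>\<alpha>\<in>cotangent_bundle X \<A>. \<forall>s t. \<phi> \<alpha> s = \<phi> \<alpha> t"
    and "C2_fun \<A> ul"
    and "\<forall>x\<in>topspace X.
           lambda_vec \<A> g x (hessian_op \<A> g A ul x) + R *\<^sub>R last_unit_vec \<in> Gamma_cone p"
  shows "pseudo_supersolution X \<A> g p A \<phi> ul"
proof -
  have atlas: "smooth_atlas X \<A>" and cpt: "compact_space X"
    using assms(1) by (simp_all add: closed_manifold_def smooth_manifold_def)
  note metric = assms(3)
  define P where "P x U \<delta> T \<longleftrightarrow> openin X U \<and> x \<in> U \<and> 0 < \<delta> \<and>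
    (\<forall>u. is_solution X \<A> g p A \<phi> u \<longrightarrow> (\<forall>x\<in>U.
       (\<forall>i. - \<delta> \<le> lambda_vec \<A> g x (hessian \<A> g (\<lambda>z. u z - ul z) x) $ i) \<longrightarrow>
       covec_norm \<A> g (differential \<A> (\<lambda>z. u z - ul z) x) \<le> \<delta> \<longrightarrow>
       (\<forall>i. lambda_vec \<A> g x (hessian \<A> g (\<lambda>z. u z - ul z) x) $ i \<le> T)))" for x U \<delta> T
  have p: "1 \<le> p" using assms(4) by simp
  have "\<forall>x\<in>topspace X. \<exists>U \<delta> T. P x U \<delta> T"
    unfolding P_def using local_top_eigenvalue_bound[OF atlas metric p assms(5,6,8,9,10)] assms(11) by blast
  then obtain U \<delta> T where P: "\<And>x. x \<in> topspace X \<Longrightarrow> P x (U x) (\<delta> x) (T x)" by metis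
  have "compactin X (topspace X)" using cpt by (simp add: compact_space_def)
  moreover have "\<And>V. V \<in> U ` topspace X \<Longrightarrow> openin X V" "topspace X \<subseteq> \<Union>(U ` topspace X)"
    using P unfolding P_def by blast+
  ultimately obtain \<F> where \<F>: "finite \<F>" "\<F> \<subseteq> U ` topspace X" "topspace X \<subseteq> \<Union>\<F>"
    unfolding compactin_def by metis
  then obtain F where F: "finite F" "F \<subseteq> topspace X" "\<F> = U ` F"
    by (meson finite_subset_image)
  \<comment> \<open>The elements \<open>1\<close> and \<open>0\<close> cover the case that \<open>F\<close> is empty.\<close>
  define d where "d = Min (insert 1 (\<delta> ` F))"
  define t where "t = Max (insert 0 (T ` F))"
  have d: "0 < d" using F(1,2) P unfolding d_def P_def by auto
  have d_le: "d \<le> \<delta> z" and t_ge: "T z \<le> t" if "z \<in> F" for z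
    using F(1) that by (simp_all add: d_def t_def)
  have t: "0 \<le> t" using F(1) by (simp add: t_def)
  show ?thesis
    unfolding pseudo_supersolution_def
  proof (intro exI conjI allI impI ballI)
    show "0 < d" by (rule d)
    show "0 \<le> (d + t) ^ CARD('n)" using d t by simp
    fix u x assume sol: "is_solution X \<A> g p A \<phi> u" and x: "x \<in> topspace X"
      and *: "lambda_vec \<A> g x (hessian \<A> g (\<lambda>z. u z - ul z) x) + d *\<^sub>R ones_vec \<in> closure (Gamma_cone CARD('n)) \<and>
         covec_norm \<A> g (differential \<A> (\<lambda>z. u z - ul z) x) \<le> d"
    define w where "w = (\<lambda>z. u z - ul z)"
    let ?l = "lambda_vec \<A> g x (hessian \<A> g w x)"
    obtain c where c: "c \<in> charts_at \<A> x" using chart_at_mem[OF atlas x] by blast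
    have w: "C2_fun \<A> w"
      unfolding w_def using sol assms(10) by (intro C2_fun_diff[OF atlas]) (simp_all add: is_solution_def)
    note H = hessian_sym_bilinear[OF atlas metric x w] and g = metric_sym_bilinear[OF metric x]
    have low: "- d \<le> ?l $ i" for i
      using closure_Gamma_cone_nonneg[OF conjunct1[OF *], of i] by (simp add: ones_vec_def w_def)
    obtain z where z: "z \<in> F" "x \<in> U z" using \<F>(3) F(3) x by blast
    have "P z (U z) (\<delta> z) (T z)" using P F(2) z(1) by blast
    moreover have "- \<delta> z \<le> ?l $ i" for i using low[of i] d_le[OF z(1)] by simp
    ultimately have "?l $ i \<le> T z" for i
      using sol z(2) conjunct2[OF *] d_le[OF z(1)] unfolding P_def w_def by (meson order_trans)
    then have up: "?l $ i \<le> t" for i using t_ge[OF z(1)] order_trans by blast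
    have "lambda_vec \<A> g x (\<lambda>v v'. d * g x v v' + hessian \<A> g w x v v') = ?l + d *\<^sub>R ones_vec"
      unfolding lambda_vec_in_chart[OF atlas metric c sym_bilinear_at_combination[OF g H]]
        lambda_vec_in_chart[OF atlas metric c H] form_matrix_combination
      by (rule eigenvalue_vec_shift[OF spd_metric_matrix[OF atlas metric c] transpose_form_matrix[OF atlas c H]])
    moreover have "sigma CARD('n) (?l + d *\<^sub>R ones_vec) \<le> (d + t) ^ CARD('n)"
    proof (rule sigma_card_le)
      fix i
      show "0 \<le> (?l + d *\<^sub>R ones_vec) $ i" using low[of i] by (simp add: ones_vec_def)
      show "(?l + d *\<^sub>R ones_vec) $ i \<le> d + t" using up[of i] by (simp add: ones_vec_def)
    qed
    ultimately show "sigma CARD('n) (lambda_vec \<A> g x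
         (\<lambda>v v'. d * g x v v' + hessian \<A> g (\<lambda>z. u z - ul z) x v v')) \<le> (d + t) ^ CARD('n)"
      unfolding w_def by simp
  qed
qed

end
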